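(* Let $\mathbb{X}$ be a complete, separable metric space with metric $d$, equipped with a locally finite reference measure $\mu$ such that for every $x\in\mathbb{X}$ the pushforward $\mu_x$ of $\mu$ under $y\mapsto d(y,x)$ is absolutely continuous with respect to Lebesgue measure on $[0,\infty)$. Let $\phi$ be a repulsive, tempered potential on $\mathbb{X}$ with potential-weighted connective constant $\Delta_\phi$. Then for every $0\le\lambda_0<e/\Delta_\phi$ there exist a simply connected open set $D\subset\mathbb{C}$ containing the interval $[0,\lambda_0]$ and a constant $C>0$ such that for every $\lambda\in D$ and every measurable $\Lambda\subset\mathbb{X}$ with $\mu(\Lambda)<\infty$, $$|\log Z_\Lambda(\lambda)|\le C\,\mu(\Lambda).$$
   Context: A potential is a measurable symmetric function $\phi:\mathbb{X}\times\mathbb{X}\to(-\infty,\infty]$; it is repulsive if $\phi\ge 0$ everywhere, and tempered if $C_\phi:=\sup_{v\in\mathbb{X}}\int_{\mathbb{X}}|1-e^{-\phi(x,v)}|\,d\mu(x)<\infty$. The measure $\mu$ is a Borel measure; locally finite means finite on bounded Borel sets. Conventions: $e^{-\infty}=0$, $0\cdot(+\infty)=0$, empty sums are $0$, and $e/0=+\infty$. Partition function: with $H(x_1,\dots,x_k)=\sum_{1\le i<j\le k}\phi(x_i,x_j)$, for $\lambda\in\mathbb{C}$, $$Z_\Lambda(\lambda)=1+\sum_{k\ge1}\frac{\lambda^k}{k!}\int_{\Lambda^k}e^{-H(x_1,\dots,x_k)}\,d\mu(x_1)\cdots d\mu(x_k).$$ The bound includes the assertion that $Z_\Lambda$ has no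 zeros in $D$; $\log Z_\Lambda$ denotes the analytic branch on $D$ with $\log Z_\Lambda(0)=0$. Potential-weighted connective constant: for $k\ge1$ let $$V_k:=\sup_{v_0\in\mathbb{X}}\int_{\mathbb{X}^k}\prod_{j=1}^k\left(\exp\Big(-\sum_{i=0}^{j-2}\mathbf{1}_{d(v_j,v_i)<d(v_i,v_{i+1})}\,\phi(v_j,v_i)\Big)\cdot\big(1-e^{-\phi(v_j,v_{j-1})}\big)\right)d\mu^k(v_1,\dots,v_k),$$ and $\Delta_\phi:=\lim_{k\to\infty}V_k^{1/k}=\inf_{k\ge1}V_k^{1/k}$. *)

theory Defs
  imports "HOL-Complex_Analysis.Complex_Analysis"
begin

text \<open>The function \<open>t \<mapsto> e\<^sup>-\<^sup>t\<close> on \<open>(-\<infinity>,\<infinity>]\<close>, with \<open>e\<^sup>-\<^sup>\<infinity> = 0\<close>. The value at \<open>-\<infinity>\<close> is irrelevant.\<close>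

definition exp_neg :: "ereal \<Rightarrow> real" where
  "exp_neg t = (if t = \<infinity> then 0 else exp (- real_of_ereal t))"

definition potential :: "'a::polish_space measure \<Rightarrow> ('a \<Rightarrow> 'a \<Rightarrow> ereal) \<Rightarrow> bool" where
  "potential M \<phi> \<longleftrightarrow>
     (\<lambda>(x, y). \<phi> x y) \<in> borel_measurable (M \<Otimes>\<^sub>M M) \<and>
     (\<forall>x y. \<phi> x y = \<phi> y x) \<and>
     (\<forall>x y. - \<infinity> < \<phi> x y)"

definition repulsive :: "('a \<Rightarrow> 'a \<Rightarrow> ereal) \<Rightarrow> bool" where
  "repulsive \<phi> \<longleftrightarrow> (\<forall>x y. 0 \<le> \<phi> x y)"

definition temperedness :: "'a measure \<Rightarrow> ('a \<Rightarrow> 'a \<Rightarrow> ereal) \<Rightarrow> ennreal" where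
  "temperedness M \<phi> = (SUP v. \<integral>\<^sup>+ x. ennreal \<bar>1 - exp_neg (\<phi> x v)\<bar> \<partial>M)"

definition tempered :: "'a measure \<Rightarrow> ('a \<Rightarrow> 'a \<Rightarrow> ereal) \<Rightarrow> bool" where
  "tempered M \<phi> \<longleftrightarrow> temperedness M \<phi> < \<infinity>"

definition locally_finite :: "'a::metric_space measure \<Rightarrow> bool" where
  "locally_finite M \<longleftrightarrow> (\<forall>B\<in>sets borel. bounded B \<longrightarrow> emeasure M B < \<infinity>)"

definition hamiltonian :: "('a \<Rightarrow> 'a \<Rightarrow> ereal) \<Rightarrow> nat \<Rightarrow> (nat \<Rightarrow> 'a) \<Rightarrow> ereal" where
  "hamiltonian \<phi> k x = (\<Sum>j\<in>{1..k}. \<Sum>i\<in>{1..<j}. \<phi> (x i) (x j))"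

definition partition_function ::
    "'a measure \<Rightarrow> ('a \<Rightarrow> 'a \<Rightarrow> ereal) \<Rightarrow> 'a set \<Rightarrow> complex \<Rightarrow> complex" where
  "partition_function M \<phi> \<Lambda> z =
     1 + (\<Sum>n. let k = Suc n in
            z ^ k / fact k *
            complex_of_real
              (LINT x:({1..k} \<rightarrow>\<^sub>E \<Lambda>)|(\<Pi>\<^sub>M i\<in>{1..k}. M). exp_neg (hamiltonian \<phi> k x)))"

text \<open>
  In the integrand of \<open>V\<^sub>k\<close>, \<open>v\<close> stands for the whole path \<open>v\<^sub>0, \<dots>, v\<^sub>k\<close>. The index range
  \<open>0 \<le> i \<le> j - 2\<close> is \<open>{..<j - 1}\<close>, which is empty for \<open>j = 1\<close>. For a repulsive potential the
  integrand is nonnegative, so the coercion into \<^typ>\<open>ennreal\<close> below truncates nothing.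
\<close>

definition pwcc_integrand ::
    "('a::metric_space \<Rightarrow> 'a \<Rightarrow> ereal) \<Rightarrow> nat \<Rightarrow> (nat \<Rightarrow> 'a) \<Rightarrow> real" where
  "pwcc_integrand \<phi> k v =
     (\<Prod>j\<in>{1..k}.
        exp_neg (\<Sum>i\<in>{..<j - 1}.
          if dist (v j) (v i) < dist (v i) (v (i + 1)) then \<phi> (v j) (v i) else 0) *
        (1 - exp_neg (\<phi> (v j) (v (j - 1)))))"

definition pwcc_V ::
    "'a::metric_space measure \<Rightarrow> ('a \<Rightarrow> 'a \<Rightarrow> ereal) \<Rightarrow> nat \<Rightarrow> ennreal" where
  "pwcc_V M \<phi> k =
     (SUP v0. \<integral>\<^sup>+ v. ennreal (pwcc_integrand \<phi> k (v(0 := v0))) \<partial>(\<Pi>\<^sub>M j\<in>{1..k}. M))"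

text \<open>
  The connective constant \<open>lim V\<^sub>k\<^sup>1\<^sup>/\<^sup>k\<close>. For a repulsive tempered potential
  \<open>V\<^sub>k \<le> C\<^sub>\<phi>\<^sup>k < \<infinity>\<close>, so passing to real numbers loses nothing, and \<open>V\<close> is submultiplicative,
  so the limit exists (and equals the infimum over \<open>k \<ge> 1\<close>).
\<close>

definition connective_constant ::
    "'a::metric_space measure \<Rightarrow> ('a \<Rightarrow> 'a \<Rightarrow> ereal) \<Rightarrow> real" where
  "connective_constant M \<phi> = lim (\<lambda>k. root k (enn2real (pwcc_V M \<phi> k)))"

text \<open>On a connected \<open>D\<close> containing \<open>0\<close> such an \<open>L\<close> is unique on \<open>D\<close>.\<close>

definition log_branch :: "complex set \<Rightarrow> (complex \<Rightarrow> complex) \<Rightarrow> (complex \<Rightarrow> complex) \<Rightarrow> bool" where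
  "log_branch D f L \<longleftrightarrow> L holomorphic_on D \<and> (\<forall>z\<in>D. exp (L z) = f z) \<and> L 0 = 0"

end

theory Submission
  imports Defs "HOL-Probability.Probability"
begin

text \<open>
  For an activity \<open>g\<close> put \<open>Z(g) = \<Sum>\<^sub>k 1/k! \<integral> \<Prod> g(x\<^sub>i) \<Prod> e(x\<^sub>i, x\<^sub>j)\<close> with \<open>e = exp(-\<phi>)\<close>. Switching on the
  factor \<open>e(v, \<cdot>)\<close> on growing balls around \<open>v\<close> shows that \<open>s = ln Z(g) - ln Z(g e(v, \<cdot>))\<close> satisfies
  \<open>s(g, v) = \<integral> g(w) (1 - e(v, w)) exp(-s(g\<^sub>v\<^sub>w, w)) dw\<close>, where \<open>g\<^sub>v\<^sub>w\<close> carries the factor \<open>e(v, \<cdot>)\<close> on the ball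
  of radius \<open>d(v, w)\<close>. No mass may sit on a sphere for this.

  Iterating the recursion from \<open>0\<close> gives entire functions \<open>S\<^sub>n\<close> of the fugacity \<open>z\<close>. With respect to the
  metric \<open>e\<^sup>-\<^sup>s |ds|\<^sup>2\<close>, Cauchy--Schwarz and \<open>x e\<^sup>-\<^sup>x \<le> 1/e\<close> show that one step contracts by
  \<open>\<lambda>/e\<close> times the weights whose \<open>k\<close>-fold composition is bounded by \<open>V\<^sub>k\<close>. As \<open>\<Sum>\<^sub>k (\<lambda>/e)\<^sup>k V\<^sub>k\<close> converges, the
  \<open>S\<^sub>n\<close> stay within a fixed distance of their nonnegative real values on a complex neighbourhood of
  \<open>[0, \<lambda>\<^sub>0]\<close> that does not depend on the volume.

  By Montel's theorem a subsequence of \<open>z \<mapsto> \<integral>\<^sub>\<Lambda> exp(-S\<^sub>n)\<close> converges there. For small real \<open>z\<close> the recursion is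
  a plain contraction, so the limit is the derivative of \<open>ln Z\<close>. Hence its primitive \<open>L\<close> has \<open>exp L = Z\<close> near
  \<open>0\<close>, and by the identity theorem on the whole neighbourhood; zero-freeness is a consequence.
\<close>

section \<open>Grand canonical partition functions with variable activity\<close>

text \<open>Once t C \<ge> 1 the recursion need not contract in the plain distance, and k-fold steps
  in that distance point only to the range \<lambda> \<Delta> < 1. The weight gains the factor e: if
  s = t \<integral> wt exp(-s_w), then |ds| \<le> t \<integral> wt exp(-s_w) |ds_w|, and
  Cauchy-Schwarz for the density wt exp(-s_w) gives |ds|^2 \<le> s t \<integral> wt exp(-s_w)
  |ds_w|^2. The value s comes back as a factor, so multiplying by exp(-s) leaves s exp(-s) \<le>
  1/e. No tangent vectors are transported in the formal argument. The complex iterate at z is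
  compared with the real iterate of the same depth at a real t near z. The weight is taken at the
  real iterate, which lies in [0, t C], so it is comparable to 1 uniformly in the volume. Both
  iterations start from 0, so |z - t| alone drives the difference. Of absolute continuity the locale
  keeps \<open>sphere_null\<close>, and of \<phi> the Boltzmann factor \<open>e\<close>, for which a
  hard core is just the value 0.\<close>

locale repulsive_gas =
  fixes M :: "'a::polish_space measure" and e :: "'a \<Rightarrow> 'a \<Rightarrow> real" and C :: real
  assumes sets_M [measurable_cong, simp]: "sets M = sets borel"
    and sigma_finite_M: "sigma_finite_measure M"
    and sphere_null: "\<And>x r. emeasure M {y. dist y x = r} = 0"
    and e_measurable: "(\<lambda>(x, y). e x y) \<in> borel_measurable (borel \<Otimes>\<^sub>M borel)"
    and e_sym: "\<And>x y. e x y = e y x"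
    and e_nonneg [simp]: "\<And>x y. 0 \<le> e x y"
    and e_le_1 [simp]: "\<And>x y. e x y \<le> 1"
    and mayer_bound: "\<And>v. (\<integral>\<^sup>+ x. ennreal (1 - e v x) \<partial>M) \<le> ennreal C"
    and C_nonneg: "0 \<le> C"
begin

sublocale sigma_finite_measure M
  by (fact sigma_finite_M)

sublocale MM: pair_sigma_finite M M
  by standard

sublocale prod_sf: product_sigma_finite "\<lambda>_::nat. M"
  by standard

lemma space_M [simp]: "space M = UNIV"
  using sets_eq_imp_space_eq[OF sets_M] by simp

lemma e_comp_measurable [measurable (raw)]:
  assumes "f \<in> N \<rightarrow>\<^sub>M borel" "g \<in> N \<rightarrow>\<^sub>M borel"
  shows "(\<lambda>x. e (f x) (g x)) \<in> borel_measurable N"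
  using measurable_compose[OF measurable_Pair[OF assms] e_measurable] by simp

abbreviation E :: "'a \<Rightarrow> 'a \<Rightarrow> ennreal" where
  "E x y \<equiv> ennreal (e x y)"

lemma E_le_1 [simp]: "E x y \<le> 1"
  by (simp add: ennreal_le_1)

lemma mult_E_le_self [simp]: "a * E x y \<le> a"
  using mult_left_mono[OF E_le_1, of a x y] by simp

text \<open>The k-particle configuration integral. Values in \<open>ennreal\<close> let Fubini and
  rearrangements of series pass without integrability conditions.\<close>

definition W :: "nat \<Rightarrow> ('a \<Rightarrow> ennreal) \<Rightarrow> ennreal" where
  "W k g = (\<integral>\<^sup>+ x. (\<Prod>i\<in>{1..k}. g (x i)) * (\<Prod>j\<in>{1..k}. \<Prod>i\<in>{1..<j}. E (x i) (x j))
              \<partial>(\<Pi>\<^sub>M i\<in>{1..k}. M))"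

lemma W_measurable [measurable (raw)]:
  assumes [measurable]: "(\<lambda>(p, x). g p x) \<in> borel_measurable (N \<Otimes>\<^sub>M M)"
  shows "(\<lambda>p. W k (g p)) \<in> borel_measurable N"
proof -
  interpret sigma_finite_measure "\<Pi>\<^sub>M i\<in>{1..k}. M"
    by (rule prod_sf.sigma_finite) simp
  show ?thesis
    unfolding W_def by measurable
qed

lemma W_0 [simp]: "W 0 g = 1"
  by (simp add: W_def PiM_empty nn_integral_count_space_finite)

text \<open>Fixing the last point at w multiplies the activity of the others by \<open>E w\<close>.
  Activities are functions because this operation leads out of the constants.\<close>

lemma W_Suc:
  assumes g [measurable]: "g \<in> borel_measurable M"
  shows "W (Suc k) g = (\<integral>\<^sup>+ w. g w * W k (\<lambda>x. g x * E w x) \<partial>M)"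
proof -
  have I: "{1..Suc k} = insert (Suc k) {1..k}" by auto
  have meas: "(\<lambda>x. (\<Prod>i\<in>{1..Suc k}. g (x i)) * (\<Prod>j\<in>{1..Suc k}. \<Prod>i\<in>{1..<j}. E (x i) (x j)))
      \<in> borel_measurable (\<Pi>\<^sub>M i\<in>{1..Suc k}. M)"
    by measurable
  have "W (Suc k) g = (\<integral>\<^sup>+ w. (\<integral>\<^sup>+ x. (\<Prod>i\<in>{1..Suc k}. g ((x(Suc k := w)) i)) *
       (\<Prod>j\<in>{1..Suc k}. \<Prod>i\<in>{1..<j}. E ((x(Suc k := w)) i) ((x(Suc k := w)) j)) \<partial>(\<Pi>\<^sub>M i\<in>{1..k}. M)) \<partial>M)"
    unfolding W_def using meas unfolding I
    by (subst prod_sf.product_nn_integral_insert_rev) simp_all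
  also have "\<dots> = (\<integral>\<^sup>+ w. (\<integral>\<^sup>+ x. g w * ((\<Prod>i\<in>{1..k}. g (x i) * E w (x i)) *
       (\<Prod>j\<in>{1..k}. \<Prod>i\<in>{1..<j}. E (x i) (x j))) \<partial>(\<Pi>\<^sub>M i\<in>{1..k}. M)) \<partial>M)"
  proof (intro nn_integral_cong)
    fix w and x :: "nat \<Rightarrow> 'a"
    have 1: "(\<Prod>i\<in>{1..Suc k}. g ((x(Suc k := w)) i)) = g w * (\<Prod>i\<in>{1..k}. g (x i))"
      unfolding I by (subst prod.insert) (auto intro!: prod.cong)
    have 2: "(\<Prod>j\<in>{1..Suc k}. \<Prod>i\<in>{1..<j}. E ((x(Suc k := w)) i) ((x(Suc k := w)) j)) =
      (\<Prod>i\<in>{1..k}. E w (x i)) * (\<Prod>j\<in>{1..k}. \<Prod>i\<in>{1..<j}. E (x i) (x j))"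
      unfolding I by (subst prod.insert)
        (auto intro!: prod.cong arg_cong2[where f="(*)"] simp: e_sym atLeastLessThanSuc_atLeastAtMost)
    show "(\<Prod>i\<in>{1..Suc k}. g ((x(Suc k := w)) i)) *
       (\<Prod>j\<in>{1..Suc k}. \<Prod>i\<in>{1..<j}. E ((x(Suc k := w)) i) ((x(Suc k := w)) j)) =
       g w * ((\<Prod>i\<in>{1..k}. g (x i) * E w (x i)) *
       (\<Prod>j\<in>{1..k}. \<Prod>i\<in>{1..<j}. E (x i) (x j)))"
      unfolding 1 2 by (simp add: prod.distrib ac_simps)
  qed
  also have "\<dots> = (\<integral>\<^sup>+ w. g w * W k (\<lambda>x. g x * E w x) \<partial>M)"
    unfolding W_def by (intro nn_integral_cong nn_integral_cmult) measurable
  finally show ?thesis .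
qed

lemma W_mono: "(\<And>x. g' x \<le> g x) \<Longrightarrow> W k g' \<le> W k g"
  unfolding W_def by (intro nn_integral_mono mult_mono prod_mono_ennreal) auto

lemma W_le_power:
  "g \<in> borel_measurable M \<Longrightarrow> W k g \<le> (\<integral>\<^sup>+ x. g x \<partial>M) ^ k"
proof (induction k arbitrary: g)
  case (Suc k)
  note [measurable] = Suc.prems
  have "W (Suc k) g \<le> (\<integral>\<^sup>+ w. g w * (\<integral>\<^sup>+ x. g x \<partial>M) ^ k \<partial>M)"
    unfolding W_Suc[OF Suc.prems]
  proof (intro nn_integral_mono mult_left_mono)
    fix w
    have "W k (\<lambda>x. g x * E w x) \<le> W k g"
      by (intro W_mono) simp
    also have "\<dots> \<le> (\<integral>\<^sup>+ x. g x \<partial>M) ^ k"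
      using Suc by simp
    finally show "W k (\<lambda>x. g x * E w x) \<le> (\<integral>\<^sup>+ x. g x \<partial>M) ^ k" .
  qed auto
  also have "\<dots> = (\<integral>\<^sup>+ x. g x \<partial>M) ^ Suc k"
    by (subst nn_integral_multc) (simp_all add: mult.commute)
  finally show ?case .
qed simp

text \<open>The counterpart of b^(k+1) + (k+1) (a-b) b^k \<le> a^(k+1) \<le> b^(k+1) + (k+1) (a-b)
  a^k with a = g' + f and b = g'. In the induction the activity of the last point w is split: its
  part f gives one increment term, and the induction hypothesis under its part g' gives k+1 more
  once the two integrals are exchanged.\<close>

lemma W_increment:
  assumes "g' \<in> borel_measurable M" "f \<in> borel_measurable M"
  shows W_increment_le: "W (Suc k) (\<lambda>x. g' x + f x) \<le>
           W (Suc k) g' + of_nat (Suc k) * (\<integral>\<^sup>+ w. f w * W k (\<lambda>x. (g' x + f x) * E w x) \<partial>M)"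
    and W_increment_ge: "W (Suc k) g' + of_nat (Suc k) * (\<integral>\<^sup>+ w. f w * W k (\<lambda>x. g' x * E w x) \<partial>M)
           \<le> W (Suc k) (\<lambda>x. g' x + f x)"
proof -
  show "W (Suc k) (\<lambda>x. g' x + f x) \<le>
           W (Suc k) g' + of_nat (Suc k) * (\<integral>\<^sup>+ w. f w * W k (\<lambda>x. (g' x + f x) * E w x) \<partial>M)"
    using assms
  proof (induction k arbitrary: g' f)
    case 0
    note [measurable] = 0
    show ?case
      by (simp add: W_Suc nn_integral_add)
  next
    case (Suc k)
    note [measurable] = Suc.prems
    let ?g = "\<lambda>x. g' x + f x"
    let ?F = "\<lambda>w. W (Suc k) (\<lambda>x. ?g x * E w x)"
    have "W (Suc (Suc k)) ?g = (\<integral>\<^sup>+ w. f w * ?F w + g' w * ?F w \<partial>M)"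
      by (subst W_Suc) (auto simp: distrib_right add.commute intro!: nn_integral_cong)
    also have "\<dots> \<le> (\<integral>\<^sup>+ w. f w * ?F w + g' w * (W (Suc k) (\<lambda>x. g' x * E w x) +
        of_nat (Suc k) * (\<integral>\<^sup>+ u. f u * E w u * W k (\<lambda>x. ?g x * E w x * E u x) \<partial>M)) \<partial>M)"
    proof (intro nn_integral_mono add_left_mono mult_left_mono)
      fix w
      show "?F w \<le> W (Suc k) (\<lambda>x. g' x * E w x) +
        of_nat (Suc k) * (\<integral>\<^sup>+ u. f u * E w u * W k (\<lambda>x. ?g x * E w x * E u x) \<partial>M)"
        using Suc.IH[of "\<lambda>x. g' x * E w x" "\<lambda>x. f x * E w x"] by (simp add: distrib_right)
    qed auto
    also have "\<dots> = (\<integral>\<^sup>+ w. f w * ?F w \<partial>M) + W (Suc (Suc k)) g' +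
        of_nat (Suc k) * (\<integral>\<^sup>+ w. (\<integral>\<^sup>+ u. g' w * (f u * E w u * W k (\<lambda>x. ?g x * E w x * E u x)) \<partial>M) \<partial>M)"
    proof -
      have "(\<integral>\<^sup>+ w. g' w * (of_nat (Suc k) * (\<integral>\<^sup>+ u. f u * E w u * W k (\<lambda>x. ?g x * E w x * E u x) \<partial>M)) \<partial>M) =
        of_nat (Suc k) * (\<integral>\<^sup>+ w. (\<integral>\<^sup>+ u. g' w * (f u * E w u * W k (\<lambda>x. ?g x * E w x * E u x)) \<partial>M) \<partial>M)"
        by (simp only: mult.left_commute[of _ "of_nat _"]) (simp add: nn_integral_cmult)
      then show ?thesis
        by (simp only: distrib_left W_Suc[OF Suc.prems(1)] add.assoc) (simp add: nn_integral_add)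
    qed
    finally have A: "W (Suc (Suc k)) ?g \<le> (\<integral>\<^sup>+ w. f w * ?F w \<partial>M) + W (Suc (Suc k)) g' +
        of_nat (Suc k) * (\<integral>\<^sup>+ w. (\<integral>\<^sup>+ u. g' w * (f u * E w u * W k (\<lambda>x. ?g x * E w x * E u x)) \<partial>M) \<partial>M)" .
    have "(\<integral>\<^sup>+ w. (\<integral>\<^sup>+ u. g' w * (f u * E w u * W k (\<lambda>x. ?g x * E w x * E u x)) \<partial>M) \<partial>M)
       = (\<integral>\<^sup>+ u. f u * (\<integral>\<^sup>+ w. g' w * E u w * W k (\<lambda>x. ?g x * E u x * E w x) \<partial>M) \<partial>M)"
      by (subst MM.Fubini') (auto simp: nn_integral_cmult[symmetric] e_sym ac_simps intro!: nn_integral_cong)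
    \<comment> \<open>After the exchange w plays the added particle of \<open>W_Suc\<close>; raising
      its activity from g' to g' + f completes \<open>?F u\<close>.\<close>
    also have "\<dots> \<le> (\<integral>\<^sup>+ u. f u * ?F u \<partial>M)"
    proof (intro nn_integral_mono mult_left_mono)
      fix u
      show "(\<integral>\<^sup>+ w. g' w * E u w * W k (\<lambda>x. ?g x * E u x * E w x) \<partial>M) \<le> ?F u"
        by (subst W_Suc) (auto intro!: nn_integral_mono mult_right_mono)
    qed auto
    finally have "W (Suc (Suc k)) ?g \<le> (\<integral>\<^sup>+ w. f w * ?F w \<partial>M) + W (Suc (Suc k)) g' +
        of_nat (Suc k) * (\<integral>\<^sup>+ u. f u * ?F u \<partial>M)"
      by (intro order_trans[OF A] add_left_mono mult_left_mono) auto
    then show ?case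
      by (simp only: of_nat_Suc[of "Suc k"] distrib_right mult_1_left ac_simps)
  qed
  show "W (Suc k) g' + of_nat (Suc k) * (\<integral>\<^sup>+ w. f w * W k (\<lambda>x. g' x * E w x) \<partial>M)
           \<le> W (Suc k) (\<lambda>x. g' x + f x)"
    using assms
  proof (induction k arbitrary: g' f)
    case 0
    note [measurable] = 0
    show ?case
      by (simp add: W_Suc nn_integral_add)
  next
    case (Suc k)
    note [measurable] = Suc.prems
    let ?g = "\<lambda>x. g' x + f x"
    let ?F = "\<lambda>w. W (Suc k) (\<lambda>x. g' x * E w x)"
    \<comment> \<open>In the lower bound every activity is g', so the exchange is an equality. The
      loss comes from the induction hypothesis and the monotonicity of W.\<close>
    have B: "(\<integral>\<^sup>+ u. f u * ?F u \<partial>M) =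
        (\<integral>\<^sup>+ w. (\<integral>\<^sup>+ u. g' w * (f u * E w u * W k (\<lambda>x. g' x * E w x * E u x)) \<partial>M) \<partial>M)"
    proof -
      have "(\<integral>\<^sup>+ u. f u * ?F u \<partial>M) =
        (\<integral>\<^sup>+ u. f u * (\<integral>\<^sup>+ w. g' w * E u w * W k (\<lambda>x. g' x * E u x * E w x) \<partial>M) \<partial>M)"
        by (simp add: W_Suc)
      also have "(\<integral>\<^sup>+ w. (\<integral>\<^sup>+ u. g' w * (f u * E w u * W k (\<lambda>x. g' x * E w x * E u x)) \<partial>M) \<partial>M) = \<dots>"
        by (subst MM.Fubini') (auto simp: nn_integral_cmult[symmetric] e_sym ac_simps intro!: nn_integral_cong)
      finally show ?thesis by simp
    qed
    have "W (Suc (Suc k)) g' + of_nat (Suc (Suc k)) * (\<integral>\<^sup>+ w. f w * ?F w \<partial>M) =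
      (\<integral>\<^sup>+ w. f w * ?F w \<partial>M) + W (Suc (Suc k)) g' + of_nat (Suc k) * (\<integral>\<^sup>+ u. f u * ?F u \<partial>M)"
      by (simp only: of_nat_Suc[of "Suc k"] distrib_right mult_1_left ac_simps)
    also have "\<dots> = (\<integral>\<^sup>+ w. f w * ?F w \<partial>M) + W (Suc (Suc k)) g' + of_nat (Suc k) *
        (\<integral>\<^sup>+ w. (\<integral>\<^sup>+ u. g' w * (f u * E w u * W k (\<lambda>x. g' x * E w x * E u x)) \<partial>M) \<partial>M)"
      by (simp only: B)
    also have "\<dots> =
       (\<integral>\<^sup>+ w. f w * ?F w + g' w * (?F w +
        of_nat (Suc k) * (\<integral>\<^sup>+ u. f u * E w u * W k (\<lambda>x. g' x * E w x * E u x) \<partial>M)) \<partial>M)"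
    proof -
      have "(\<integral>\<^sup>+ w. g' w * (of_nat (Suc k) * (\<integral>\<^sup>+ u. f u * E w u * W k (\<lambda>x. g' x * E w x * E u x) \<partial>M)) \<partial>M) =
        of_nat (Suc k) * (\<integral>\<^sup>+ w. (\<integral>\<^sup>+ u. g' w * (f u * E w u * W k (\<lambda>x. g' x * E w x * E u x)) \<partial>M) \<partial>M)"
        by (simp only: mult.left_commute[of _ "of_nat _"]) (simp add: nn_integral_cmult)
      then show ?thesis
        by (simp only: distrib_left W_Suc[OF Suc.prems(1)] add.assoc) (simp add: nn_integral_add)
    qed
    also have "\<dots> \<le> (\<integral>\<^sup>+ w. f w * W (Suc k) (\<lambda>x. ?g x * E w x) + g' w * W (Suc k) (\<lambda>x. ?g x * E w x) \<partial>M)"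
    proof (intro nn_integral_mono add_mono mult_left_mono)
      fix w
      show "?F w + of_nat (Suc k) * (\<integral>\<^sup>+ u. f u * E w u * W k (\<lambda>x. g' x * E w x * E u x) \<partial>M)
        \<le> W (Suc k) (\<lambda>x. ?g x * E w x)"
        using Suc.IH[of "\<lambda>x. g' x * E w x" "\<lambda>x. f x * E w x"] by (simp add: distrib_right)
    qed (auto intro!: W_mono mult_right_mono)
    also have "\<dots> = W (Suc (Suc k)) ?g"
      by (subst W_Suc) (auto simp: distrib_right add.commute intro!: nn_integral_cong)
    finally show ?case .
  qed
qed


section \<open>Summation over the number of particles\<close>

definition Z :: "('a \<Rightarrow> ennreal) \<Rightarrow> ennreal" where
  "Z g = (\<Sum>k. ennreal (inverse (fact k)) * W k g)"

lemma Z_measurable [measurable (raw)]: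
  assumes [measurable]: "(\<lambda>(p, x). g p x) \<in> borel_measurable (N \<Otimes>\<^sub>M M)"
  shows "(\<lambda>p. Z (g p)) \<in> borel_measurable N"
  unfolding Z_def by measurable

lemma Z_mono: "(\<And>x. g' x \<le> g x) \<Longrightarrow> Z g' \<le> Z g"
  unfolding Z_def by (intro suminf_le mult_left_mono W_mono) auto

lemma Z_ge_1: "1 \<le> Z g"
  using sum_le_suminf[of "\<lambda>k. ennreal (inverse (fact k)) * W k g" "{0}"] by (simp add: Z_def)

lemma Z_split: "Z g = 1 + (\<Sum>k. ennreal (inverse (fact (Suc k))) * W (Suc k) g)"
proof -
  have "(\<lambda>k. ennreal (inverse (fact k)) * W k g) sums
     ((\<Sum>k. ennreal (inverse (fact (Suc k))) * W (Suc k) g) + ennreal (inverse (fact 0)) * W 0 g)"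
    by (intro sums_Suc summable_sums summableI)
  then show ?thesis
    unfolding Z_def by (simp add: sums_iff add.commute)
qed

lemma fact_Suc_ennreal: "ennreal (inverse (fact (Suc k))) * of_nat (Suc k) = ennreal (inverse (fact k))"
proof -
  have "inverse (fact (Suc k)) * real (Suc k) = inverse (fact k)"
    by (simp add: field_simps del: of_nat_Suc)
  then show ?thesis
    by (metis ennreal_mult ennreal_of_nat_eq_real_of_nat inverse_nonnegative_iff_nonnegative fact_ge_zero of_nat_0_le_iff)
qed

text \<open>Written with (k+1) / (k+1)! instead of 1 / k!, so that it adds term by term to the tail
  in \<open>Z_split\<close> and matches \<open>W_increment\<close>.\<close>

lemma nn_integral_Z:
  assumes [measurable]: "f \<in> borel_measurable M" "g \<in> borel_measurable M"
  shows "(\<integral>\<^sup>+ w. f w * Z (\<lambda>x. g x * E w x) \<partial>M) =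
    (\<Sum>k. ennreal (inverse (fact (Suc k))) * (of_nat (Suc k) * (\<integral>\<^sup>+ w. f w * W k (\<lambda>x. g x * E w x) \<partial>M)))"
proof -
  have "(\<integral>\<^sup>+ w. f w * Z (\<lambda>x. g x * E w x) \<partial>M) =
     (\<integral>\<^sup>+ w. (\<Sum>k. ennreal (inverse (fact k)) * (f w * W k (\<lambda>x. g x * E w x))) \<partial>M)"
    unfolding Z_def ennreal_suminf_cmult[symmetric] by (simp add: mult.left_commute)
  also have "\<dots> = (\<Sum>k. ennreal (inverse (fact k)) * (\<integral>\<^sup>+ w. f w * W k (\<lambda>x. g x * E w x) \<partial>M))"
    by (simp add: nn_integral_suminf nn_integral_cmult)
  finally show ?thesis
    by (simp only: mult.assoc[symmetric] fact_Suc_ennreal)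
qed

lemma Z_increment_le:
  assumes [measurable]: "g' \<in> borel_measurable M" "f \<in> borel_measurable M"
  shows "Z (\<lambda>x. g' x + f x) \<le> Z g' + (\<integral>\<^sup>+ w. f w * Z (\<lambda>x. (g' x + f x) * E w x) \<partial>M)"
proof -
  have "Z (\<lambda>x. g' x + f x) \<le> 1 + (\<Sum>k. ennreal (inverse (fact (Suc k))) * (W (Suc k) g' +
     of_nat (Suc k) * (\<integral>\<^sup>+ w. f w * W k (\<lambda>x. (g' x + f x) * E w x) \<partial>M)))"
    unfolding Z_split[of "\<lambda>x. g' x + f x"]
    by (intro add_left_mono suminf_le mult_left_mono W_increment_le) auto
  also have "\<dots> = Z g' + (\<integral>\<^sup>+ w. f w * Z (\<lambda>x. (g' x + f x) * E w x) \<partial>M)"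
    by (subst nn_integral_Z) (simp_all only: distrib_left suminf_add[OF summableI summableI, symmetric] Z_split[of g'] add.assoc, measurable)
  finally show ?thesis .
qed

lemma Z_increment_ge:
  assumes [measurable]: "g' \<in> borel_measurable M" "f \<in> borel_measurable M"
  shows "Z g' + (\<integral>\<^sup>+ w. f w * Z (\<lambda>x. g' x * E w x) \<partial>M) \<le> Z (\<lambda>x. g' x + f x)"
proof -
  have "Z g' + (\<integral>\<^sup>+ w. f w * Z (\<lambda>x. g' x * E w x) \<partial>M) = 1 + (\<Sum>k. ennreal (inverse (fact (Suc k))) * (W (Suc k) g' +
     of_nat (Suc k) * (\<integral>\<^sup>+ w. f w * W k (\<lambda>x. g' x * E w x) \<partial>M)))"
    by (subst nn_integral_Z) (simp_all only: distrib_left suminf_add[OF summableI summableI, symmetric] Z_split[of g'] add.assoc, measurable)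
  also have "\<dots> \<le> Z (\<lambda>x. g' x + f x)"
    unfolding Z_split[of "\<lambda>x. g' x + f x"]
    by (intro add_left_mono suminf_le mult_left_mono W_increment_ge) auto
  finally show ?thesis .
qed

lemma Z_le_exp:
  assumes [measurable]: "g \<in> borel_measurable M" and g: "(\<integral>\<^sup>+ x. g x \<partial>M) \<le> ennreal G" and "0 \<le> G"
  shows "Z g \<le> ennreal (exp G)"
proof -
  have "Z g \<le> (\<Sum>k. ennreal (inverse (fact k) * G ^ k))"
    unfolding Z_def
  proof (intro suminf_le)
    fix k
    have "W k g \<le> ennreal (G ^ k)"
      using order_trans[OF W_le_power power_mono[OF g]] \<open>0 \<le> G\<close> by (simp add: ennreal_power)
    then show "ennreal (inverse (fact k)) * W k g \<le> ennreal (inverse (fact k) * G ^ k)"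
      by (simp add: ennreal_mult mult_left_mono \<open>0 \<le> G\<close>)
  qed auto
  also have "\<dots> = ennreal (exp G)"
    using exp_converges[of G] \<open>0 \<le> G\<close> by (intro suminf_ennreal_eq) auto
  finally show ?thesis .
qed

section \<open>Logarithmic increments of the partition function\<close>

definition zeta :: "('a \<Rightarrow> ennreal) \<Rightarrow> real" where
  "zeta g = enn2real (Z g)"

lemma ennreal_zeta:
  assumes [measurable]: "g \<in> borel_measurable M" and g: "(\<integral>\<^sup>+ x. g x \<partial>M) < \<infinity>"
  shows "ennreal (zeta g) = Z g"
proof -
  obtain G where "(\<integral>\<^sup>+ x. g x \<partial>M) = ennreal G" "0 \<le> G"
    using g by (cases "\<integral>\<^sup>+ x. g x \<partial>M") auto
  then have "Z g < \<infinity>"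
    using Z_le_exp[of g G] by (auto simp: top_unique less_top[symmetric])
  then show ?thesis
    by (simp add: zeta_def less_top)
qed

lemma zeta_ge_1:
  assumes [measurable]: "g \<in> borel_measurable M" and g: "(\<integral>\<^sup>+ x. g x \<partial>M) < \<infinity>"
  shows "1 \<le> zeta g"
proof -
  have "ennreal 1 \<le> ennreal (zeta g)"
    using Z_ge_1[of g] by (simp only: ennreal_zeta assms ennreal_1)
  moreover have "0 \<le> zeta g" by (simp add: zeta_def)
  ultimately show ?thesis by (subst (asm) ennreal_le_iff)
qed

text \<open>A first-order expansion of ln zeta with quadratic remainder that presupposes no
  differentiability. The increment of ln zeta and the integral I both lie between l / zeta(g' + f)
  and u / zeta(g'), and this interval has length at most 2 exp(G) d^2. Leaving q free between the
  two ratios allows the density of any intermediate activity, even one that varies with w.\<close>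

lemma ln_zeta_increment:
  assumes [measurable]: "g' \<in> borel_measurable M" "f \<in> borel_measurable M" "q \<in> borel_measurable M"
    and G: "(\<integral>\<^sup>+ x. g' x + f x \<partial>M) \<le> ennreal G" "0 \<le> G"
    and d: "(\<integral>\<^sup>+ x. f x \<partial>M) = ennreal d" "0 \<le> d"
    and q: "\<And>w. f w \<noteq> 0 \<Longrightarrow> zeta (\<lambda>x. g' x * E w x) / zeta (\<lambda>x. g' x + f x) \<le> q w"
           "\<And>w. f w \<noteq> 0 \<Longrightarrow> q w \<le> zeta (\<lambda>x. (g' x + f x) * E w x) / zeta g'"
    and I: "(\<integral>\<^sup>+ w. f w * ennreal (q w) \<partial>M) = ennreal I" "0 \<le> I"
  shows "\<bar>ln (zeta (\<lambda>x. g' x + f x)) - ln (zeta g') - I\<bar> \<le> 2 * exp G * d\<^sup>2"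
proof -
  let ?g = "\<lambda>x. g' x + f x"
  have le_G: "(\<integral>\<^sup>+ x. h x \<partial>M) \<le> ennreal G" if "\<And>x. h x \<le> ?g x" for h
    by (rule order_trans[OF nn_integral_mono G(1)]) (simp add: that)
  have fin: "(\<integral>\<^sup>+ x. h x \<partial>M) < \<infinity>" if "\<And>x. h x \<le> ?g x" for h
    using le_G[OF that] by (rule order.strict_trans1) simp
  have le1: "g' x * E w x \<le> ?g x" "g' x * E w x \<le> g' x" "g' x \<le> ?g x" "?g x * E w x \<le> ?g x" "f x * E w x \<le> f x" for w x
    by (auto intro: order_trans[OF mult_E_le_self])
  have zg [simp]: "ennreal (zeta ?g) = Z ?g" "ennreal (zeta g') = Z g'"
    "ennreal (zeta (\<lambda>x. g' x * E w x)) = Z (\<lambda>x. g' x * E w x)"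
    "ennreal (zeta (\<lambda>x. ?g x * E w x)) = Z (\<lambda>x. ?g x * E w x)" for w
    by (intro ennreal_zeta fin le1; measurable)+
  have ge1: "1 \<le> zeta ?g" "1 \<le> zeta g'"
    by (intro zeta_ge_1 fin le1; simp)+
  \<comment> \<open>The bound on the change of Z caused by adding f; below it is used for g' itself
    and, uniformly in w, for the activities damped by \<open>E w\<close>.\<close>
  define c where "c = exp G * d"
  have c0: "0 \<le> c" using d by (simp add: c_def)
  have Zg_le: "Z (\<lambda>x. ?g x * E w x) \<le> ennreal (exp G)" for w
    by (intro Z_le_exp le_G le1 G) measurable
  define U L where "U = (\<integral>\<^sup>+ w. f w * Z (\<lambda>x. ?g x * E w x) \<partial>M)"
    and "L = (\<integral>\<^sup>+ w. f w * Z (\<lambda>x. g' x * E w x) \<partial>M)"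
  have "U \<le> (\<integral>\<^sup>+ w. f w * ennreal (exp G) \<partial>M)"
    unfolding U_def by (intro nn_integral_mono mult_left_mono Zg_le) simp
  then have Uc: "U \<le> ennreal c"
    using d by (simp add: nn_integral_multc c_def ennreal_mult mult.commute)
  have "U \<le> (\<integral>\<^sup>+ w. f w * (Z (\<lambda>x. g' x * E w x) + ennreal c) \<partial>M)"
    unfolding U_def
  proof (intro nn_integral_mono mult_left_mono)
    fix w
    have "Z (\<lambda>x. ?g x * E w x) \<le> Z (\<lambda>x. g' x * E w x) +
        (\<integral>\<^sup>+ u. f u * E w u * Z (\<lambda>x. (g' x * E w x + f x * E w x) * E u x) \<partial>M)"
      using Z_increment_le[of "\<lambda>x. g' x * E w x" "\<lambda>x. f x * E w x"] by (simp add: distrib_right)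
    also have "(\<integral>\<^sup>+ u. f u * E w u * Z (\<lambda>x. (g' x * E w x + f x * E w x) * E u x) \<partial>M) \<le>
        (\<integral>\<^sup>+ u. f u * ennreal (exp G) \<partial>M)"
    proof (intro nn_integral_mono mult_mono le1)
      fix u
      show "Z (\<lambda>x. (g' x * E w x + f x * E w x) * E u x) \<le> ennreal (exp G)"
        by (intro Z_le_exp le_G G) (auto simp flip: distrib_right intro: order_trans[OF mult_E_le_self])
    qed auto
    also have "\<dots> = ennreal c"
      using d by (simp add: nn_integral_multc c_def ennreal_mult mult.commute)
    finally show "Z (\<lambda>x. ?g x * E w x) \<le> Z (\<lambda>x. g' x * E w x) + ennreal c"
      by (simp add: add_left_mono)
  qed auto
  also have "\<dots> = L + ennreal (c * d)"
    using d c0 by (simp add: distrib_left nn_integral_add nn_integral_multc nn_integral_cmult L_def ennreal_mult mult.commute)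
  finally have ULc: "U \<le> L + ennreal (c * d)" .
  have "L \<le> (\<integral>\<^sup>+ w. f w * Z g' \<partial>M)"
    unfolding L_def by (intro nn_integral_mono mult_left_mono Z_mono le1) simp
  then have Ld: "L \<le> ennreal (d * zeta g')"
    using d by (simp add: nn_integral_multc ennreal_mult' mult.commute)
  obtain u where u: "U = ennreal u" "0 \<le> u" using Uc by (cases U) (auto simp: top_unique)
  obtain l where l: "L = ennreal l" "0 \<le> l" using Ld by (cases L) (auto simp: top_unique)
  have "ennreal (zeta ?g) \<le> ennreal (zeta g' + u)"
    using Z_increment_le[of g' f] u ge1 by (simp add: U_def)
  then have 1: "zeta ?g \<le> zeta g' + u" using u ge1 by (subst (asm) ennreal_le_iff) auto
  have "ennreal (zeta g' + l) \<le> ennreal (zeta ?g)"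
    using Z_increment_ge[of g' f] l ge1 by (simp add: L_def)
  then have 2: "zeta g' + l \<le> zeta ?g" using ge1 by (subst (asm) ennreal_le_iff) auto
  have 3: "u \<le> l + c * d" using ULc u l c0 d by (simp flip: ennreal_plus)
  have 4: "u \<le> c" using Uc u c0 by simp
  have 5: "l \<le> d * zeta g'" using Ld l ge1 d by (simp add: mult_nonneg_nonneg)
  have "ennreal I * ennreal (zeta g') = (\<integral>\<^sup>+ w. f w * ennreal (q w) * ennreal (zeta g') \<partial>M)"
    unfolding I(1)[symmetric] by (simp add: nn_integral_multc)
  also have "\<dots> \<le> U"
    unfolding U_def
  proof (intro nn_integral_mono)
    fix w
    show "f w * ennreal (q w) * ennreal (zeta g') \<le> f w * Z (\<lambda>x. ?g x * E w x)"
    proof (cases "f w = 0")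
      case False
      have "q w * zeta g' \<le> zeta (\<lambda>x. ?g x * E w x)"
        using q(2)[OF False] ge1 by (simp add: field_simps)
      then have "ennreal (q w) * ennreal (zeta g') \<le> ennreal (zeta (\<lambda>x. ?g x * E w x))"
        using ge1 by (simp only: ennreal_mult''[symmetric] ennreal_leI)
      then show ?thesis
        by (simp add: mult.assoc mult_left_mono)
    qed simp
  qed
  finally have 6: "I * zeta g' \<le> u"
    using u I ge1 by (simp add: ennreal_mult''[symmetric] del: zg)
  have "L \<le> (\<integral>\<^sup>+ w. f w * ennreal (q w) * ennreal (zeta ?g) \<partial>M)"
    unfolding L_def
  proof (intro nn_integral_mono)
    fix w
    show "f w * Z (\<lambda>x. g' x * E w x) \<le> f w * ennreal (q w) * ennreal (zeta ?g)"
    proof (cases "f w = 0")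
      case False
      have "zeta (\<lambda>x. g' x * E w x) \<le> q w * zeta ?g"
        using q(1)[OF False] ge1 by (simp add: field_simps)
      then have "ennreal (zeta (\<lambda>x. g' x * E w x)) \<le> ennreal (q w) * ennreal (zeta ?g)"
        using ge1 by (simp only: ennreal_mult''[symmetric] ennreal_leI)
      then show ?thesis
        by (simp add: mult.assoc mult_left_mono)
    qed simp
  qed
  also have "\<dots> = ennreal I * ennreal (zeta ?g)"
    unfolding I(1)[symmetric] by (simp add: nn_integral_multc)
  finally have 7: "l \<le> I * zeta ?g"
    using l I ge1 by (simp add: ennreal_mult''[symmetric] del: zg)
  have bound: "u / zeta g' - l / zeta ?g \<le> 2 * c * d"
  proof -
    \<comment> \<open>Two errors of size at most c d each: u against l, and the denominator zeta g'
      against zeta ?g.\<close>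
    have "u / zeta g' - l / zeta ?g \<le> (l + c * d) / zeta g' - l / zeta ?g"
      using 3 ge1 by (simp add: divide_right_mono)
    also have "\<dots> = c * d / zeta g' + l / zeta g' * (zeta ?g - zeta g') / zeta ?g"
      using ge1 by (simp add: field_simps)
    also have "\<dots> \<le> c * d / 1 + d * c / 1"
    proof (intro add_mono frac_le mult_mono)
      show "l / zeta g' \<le> d" using 5 ge1 by (simp add: field_simps)
    qed (use c0 d ge1 l 1 2 4 in auto)
    finally show ?thesis by simp
  qed
  have "ln (zeta ?g) - ln (zeta g') \<le> (zeta ?g - zeta g') / zeta g'"
    using ge1 by (intro ln_diff_le) auto
  also have "\<dots> \<le> u / zeta g'" using 1 ge1 by (intro divide_right_mono) auto
  finally have A: "ln (zeta ?g) - ln (zeta g') \<le> u / zeta g'" .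
  have "ln (zeta g') - ln (zeta ?g) \<le> (zeta g' - zeta ?g) / zeta ?g"
    using ge1 by (intro ln_diff_le) auto
  also have "\<dots> \<le> - l / zeta ?g" using 2 ge1 by (intro divide_right_mono) auto
  finally have B: "l / zeta ?g \<le> ln (zeta ?g) - ln (zeta g')" by simp
  have "I \<le> u / zeta g'" "l / zeta ?g \<le> I"
    using 6 7 ge1 by (auto simp: field_simps)
  with A B bound show ?thesis
    by (simp add: c_def power2_eq_square abs_le_iff mult.assoc)
qed

end

section \<open>The recursion for the density\<close>

text \<open>Bisection of the values of m, not of the interval: each halving turns one square into
  two squares of a quarter the size, so the bound halves. Continuity of m provides the midpoint
  values; no Lipschitz condition enters, so m may be the cdf of any atomless measure.\<close>

lemma eq_endpoints_if_quadratic_increments: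
  fixes F m :: "real \<Rightarrow> real"
  assumes ab: "a \<le> b" and cont: "continuous_on {a..b} m"
    and incr: "\<And>r s. a \<le> r \<Longrightarrow> r \<le> s \<Longrightarrow> s \<le> b \<Longrightarrow> \<bar>F s - F r\<bar> \<le> K * (m s - m r)\<^sup>2"
    and mono: "\<And>r s. a \<le> r \<Longrightarrow> r \<le> s \<Longrightarrow> s \<le> b \<Longrightarrow> m r \<le> m s"
  shows "F a = F b"
proof -
  have *: "\<bar>F s - F r\<bar> \<le> K * (m s - m r)\<^sup>2 / 2 ^ n" if "a \<le> r" "r \<le> s" "s \<le> b" for r s n
    using that
  proof (induction n arbitrary: r s)
    case 0
    then show ?case using incr by simp
  next
    case (Suc n)
    have "continuous_on {r..s} m"
      by (rule continuous_on_subset[OF cont]) (use Suc.prems in auto)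
    then obtain c where c: "r \<le> c" "c \<le> s" "m c = (m r + m s) / 2"
      using IVT'[of m r "(m r + m s) / 2" s] Suc.prems mono[of r s] by auto
    have "\<bar>F s - F r\<bar> \<le> K * (m s - m c)\<^sup>2 / 2 ^ n + K * (m c - m r)\<^sup>2 / 2 ^ n"
    proof -
      have "\<bar>F s - F c\<bar> \<le> K * (m s - m c)\<^sup>2 / 2 ^ n" "\<bar>F c - F r\<bar> \<le> K * (m c - m r)\<^sup>2 / 2 ^ n"
        using Suc.prems c(1,2) by (intro Suc.IH; simp)+
      then show ?thesis by linarith
    qed
    also have "\<dots> = K * (m s - m r)\<^sup>2 / 2 ^ Suc n"
      unfolding c(3) by (simp add: field_simps power2_eq_square)
    finally show ?case .
  qed
  have "(\<lambda>n. K * (m b - m a)\<^sup>2 * (1 / 2) ^ n) \<longlonglongrightarrow> K * (m b - m a)\<^sup>2 * 0"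
    by (intro tendsto_mult_left LIMSEQ_realpow_zero) auto
  then have "\<bar>F b - F a\<bar> \<le> 0"
    using *[of a b] ab by (intro LIMSEQ_le_const) (auto simp: field_simps)
  then show ?thesis by simp
qed

context repulsive_gas
begin

lemma zeta_mono:
  assumes [measurable]: "g \<in> borel_measurable M" and "(\<integral>\<^sup>+ x. g x \<partial>M) < \<infinity>" and le: "\<And>x. g' x \<le> g x"
  shows "zeta g' \<le> zeta g"
proof -
  have "Z g < \<infinity>"
    using ennreal_zeta[OF assms(1,2)] by (metis ennreal_less_top infinity_ennreal_def)
  then show ?thesis
    unfolding zeta_def by (intro enn2real_mono Z_mono le) auto
qed

lemma zeta_measurable [measurable (raw)]:
  assumes [measurable]: "(\<lambda>(p, x). g p x) \<in> borel_measurable (N \<Otimes>\<^sub>M M)"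
  shows "(\<lambda>p. zeta (g p)) \<in> borel_measurable N"
  unfolding zeta_def by measurable

text \<open>Multiplied by g w, this is the one-point density at w of the gas with activity
  g.\<close>

definition density_ratio :: "('a \<Rightarrow> ennreal) \<Rightarrow> 'a \<Rightarrow> real" where
  "density_ratio g w = zeta (\<lambda>x. g x * E w x) / zeta g"

lemma density_ratio_measurable [measurable (raw)]:
  assumes [measurable]: "(\<lambda>(p, x). g p x) \<in> borel_measurable (N \<Otimes>\<^sub>M M)" "f \<in> N \<rightarrow>\<^sub>M borel"
  shows "(\<lambda>p. density_ratio (g p) (f p)) \<in> borel_measurable N"
  unfolding density_ratio_def by measurable

lemma density_ratio_bounds:
  assumes [measurable]: "g \<in> borel_measurable M" and g: "(\<integral>\<^sup>+ x. g x \<partial>M) < \<infinity>"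
  shows "0 < density_ratio g w" "density_ratio g w \<le> 1"
proof -
  have fin: "(\<integral>\<^sup>+ x. g x * E w x \<partial>M) < \<infinity>"
    by (rule le_less_trans[OF nn_integral_mono g]) simp
  have "1 \<le> zeta g" "1 \<le> zeta (\<lambda>x. g x * E w x)" "zeta (\<lambda>x. g x * E w x) \<le> zeta g"
    using g fin by (auto intro!: zeta_ge_1 zeta_mono)
  then show "0 < density_ratio g w" "density_ratio g w \<le> 1"
    by (auto simp: density_ratio_def)
qed

text \<open>The activity of the overview with e(v, .) switched on inside the ball through w. The
  strict inequality is that of the indicator in V_k.\<close>

definition branch :: "('a \<Rightarrow> ennreal) \<Rightarrow> 'a \<Rightarrow> 'a \<Rightarrow> 'a \<Rightarrow> ennreal" where
  "branch g v w x = g x * (if dist x v < dist v w then E v x else 1)"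

lemma branch_measurable [measurable (raw)]:
  assumes [measurable]: "(\<lambda>p. g p (x p)) \<in> borel_measurable N" "v \<in> N \<rightarrow>\<^sub>M borel" "w \<in> N \<rightarrow>\<^sub>M borel" "x \<in> N \<rightarrow>\<^sub>M borel"
  shows "(\<lambda>p. branch (g p) (v p) (w p) (x p)) \<in> borel_measurable N"
  unfolding branch_def by measurable

lemma branch_le [simp]: "branch g v w x \<le> g x"
  by (simp add: branch_def)

lemma ln_zeta_recursion:
  assumes g [measurable]: "g \<in> borel_measurable M" and G: "(\<integral>\<^sup>+ x. g x \<partial>M) \<le> ennreal G" "0 \<le> G"
  shows "ln (zeta g) - ln (zeta (\<lambda>x. g x * E v x)) =
    enn2real (\<integral>\<^sup>+ w. g w * ennreal (1 - e v w) * ennreal (density_ratio (branch g v w) w) \<partial>M)"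
proof -
  have fin: "(\<integral>\<^sup>+ x. h x \<partial>M) < \<infinity>" if "\<And>x. h x \<le> g x" for h
    by (rule le_less_trans[OF nn_integral_mono le_less_trans[OF G(1)]]) (auto simp: that)
  \<comment> \<open>a bounded radius with the same order as \<open>dist x v\<close>, so that the endpoints below are \<open>-1\<close> and \<open>1\<close>\<close>
  define \<rho> where "\<rho> x = dist x v / (1 + dist x v)" for x
  have [measurable]: "\<rho> \<in> borel_measurable borel"
    unfolding \<rho>_def by measurable
  have \<rho>_less_iff: "\<rho> x < \<rho> w \<longleftrightarrow> dist x v < dist v w" for x w
    unfolding \<rho>_def by (simp add: divide_less_eq pos_less_divide_eq less_divide_eq field_simps dist_commute add_pos_nonneg)
  have \<rho>_bounds: "0 \<le> \<rho> x" "\<rho> x < 1" for x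
    by (auto simp: \<rho>_def divide_less_eq add_pos_nonneg)
  define q where "q w = density_ratio (branch g v w) w" for w
  have q_meas [measurable]: "q \<in> borel_measurable M"
    unfolding q_def by measurable
  have q01: "0 < q w" "q w \<le> 1" for w
    unfolding q_def by (intro density_ratio_bounds fin; simp)+
  define h where "h x = g x * ennreal (1 - e v x)" for x
  have [measurable]: "h \<in> borel_measurable M" unfolding h_def by measurable
  have h_le: "h x \<le> g x" for x
    unfolding h_def by (rule mult_left_mono[of _ 1 "g x", simplified]) (simp_all add: ennreal_le_1)
  define gr where "gr r x = g x * (if \<rho> x \<le> r then E v x else 1)" for r x
  define f where "f r s x = h x * indicator {x. r < \<rho> x \<and> \<rho> x \<le> s} x" for r s x
  have [measurable]: "gr r \<in> borel_measurable M" "f r s \<in> borel_measurable M" for r s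
    unfolding gr_def f_def by measurable
  have gr_le: "gr r x \<le> g x" and f_le: "f r s x \<le> h x" "f r s x \<le> g x" for r s x
    using h_le[of x] by (auto simp: gr_def f_def indicator_def)
  have gr_split: "gr r = (\<lambda>x. gr s x + f r s x)" if "r \<le> s" for r s
  proof
    fix x
    have "g x = g x * E v x + g x * ennreal (1 - e v x)"
      unfolding distrib_left[symmetric] by (subst ennreal_plus[symmetric]) auto
    then show "gr r x = gr s x + f r s x"
      using that by (auto simp: gr_def f_def h_def indicator_def)
  qed
  \<comment> \<open>The distribution of the radius under h = g (1 - e(v, .)), the activity that the
    factor e(v, .) removes. Its cdf serves as the continuous m of the bisection lemma; it has no
    atoms because spheres are null.\<close>
  define \<nu> where "\<nu> = distr (density M h) borel \<rho>"
  interpret \<nu>: finite_borel_measure \<nu>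
  proof (intro finite_borel_measure.intro finite_measureI finite_borel_measure_axioms.intro)
    have "emeasure \<nu> (space \<nu>) = (\<integral>\<^sup>+ x. h x \<partial>M)"
      unfolding \<nu>_def by (subst emeasure_distr) (auto simp: emeasure_density space_density)
    then show "emeasure \<nu> (space \<nu>) \<noteq> \<infinity>"
      using fin[of h] h_le by auto
  qed (simp add: \<nu>_def)
  have em: "emeasure \<nu> A = (\<integral>\<^sup>+ x. h x * indicator (\<rho> -` A) x \<partial>M)" if "A \<in> sets borel" for A
    unfolding \<nu>_def using that measurable_sets_borel[OF _ that, of \<rho>]
    by (subst emeasure_distr) (auto simp: emeasure_density space_density)
  have no_atom: "measure \<nu> {c} = 0" for c
  proof -
    have inv: "\<rho> x / (1 - \<rho> x) = dist x v" for x
    proof -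
      have pos: "0 < 1 + dist x v" by (simp add: add_pos_nonneg)
      then have "1 - \<rho> x = 1 / (1 + dist x v)"
        unfolding \<rho>_def by (simp add: diff_divide_eq_iff)
      then show ?thesis using pos by (simp only: \<rho>_def) simp
    qed
    have sub: "\<rho> -` {c} \<subseteq> {x. dist x v = c / (1 - c)}"
    proof
      fix x assume "x \<in> \<rho> -` {c}"
      then have "\<rho> x = c" by simp
      then show "x \<in> {x. dist x v = c / (1 - c)}"
        using inv[of x] by (simp only: mem_Collect_eq)
    qed
    have "emeasure M (\<rho> -` {c}) = 0"
      by (rule emeasure_eq_0[OF _ sphere_null sub]) simp
    moreover have "\<rho> -` {c} \<in> sets M"
      using measurable_sets_borel[of \<rho> borel "{c}"] by simp
    ultimately have "\<rho> -` {c} \<in> null_sets M"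
      by (simp add: null_sets_def)
    then have "emeasure \<nu> {c} = 0"
      by (subst em) (auto intro!: nn_integral_null_set)
    then show ?thesis by (simp add: measure_def)
  qed
  have m_cont: "continuous_on {-1..1} (cdf \<nu>)"
    by (intro continuous_at_imp_continuous_on) (simp add: \<nu>.isCont_cdf no_atom)
  define I where "I r = enn2real (\<integral>\<^sup>+ w. f (-1) r w * ennreal (q w) \<partial>M)" for r
  have fq: "(\<integral>\<^sup>+ w. f r s w * ennreal (q w) \<partial>M) < \<infinity>" for r s
  proof (rule fin)
    show "f r s x * ennreal (q x) \<le> g x" for x
      using mult_mono[OF f_le(2)[of r s x], of "ennreal (q x)" 1] q01[of x] by (simp add: ennreal_le_1)
  qed
  have I_diff: "ennreal (I s - I r) = (\<integral>\<^sup>+ w. f r s w * ennreal (q w) \<partial>M)" "I r \<le> I s"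
    if "-1 \<le> r" "r \<le> s" for r s
  proof -
    have *: "ennreal (I r) = (\<integral>\<^sup>+ w. f (-1) r w * ennreal (q w) \<partial>M)" for r
      unfolding I_def using fq by (simp add: less_top)
    have "f (-1) s w = f (-1) r w + f r s w" for w
      using that by (auto simp: f_def indicator_def)
    then have "(\<integral>\<^sup>+ w. f (-1) s w * ennreal (q w) \<partial>M) = (\<integral>\<^sup>+ w. f (-1) r w * ennreal (q w) \<partial>M) + (\<integral>\<^sup>+ w. f r s w * ennreal (q w) \<partial>M)"
      by (simp add: distrib_right nn_integral_add)
    then have 1: "ennreal (I s) = ennreal (I r) + (\<integral>\<^sup>+ w. f r s w * ennreal (q w) \<partial>M)"
      by (simp only: *)
    then have "ennreal (I r) \<le> ennreal (I s)" by simp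
    moreover have I0: "0 \<le> I r" "0 \<le> I s" by (auto simp: I_def)
    ultimately show "I r \<le> I s" by simp
    have "ennreal (I s - I r) = ennreal (I s) - ennreal (I r)"
      using I0 by (simp add: ennreal_minus)
    then show "ennreal (I s - I r) = (\<integral>\<^sup>+ w. f r s w * ennreal (q w) \<partial>M)"
      using 1 by (simp add: ennreal_add_diff_cancel_left)
  qed
  \<comment> \<open>Growing the ball lowers ln zeta at the rate at which I grows, so the sum is
    constant in r. Increments quadratic in those of the cdf take the place of differentiability in
    r.\<close>
  have "ln (zeta (gr (-1))) + I (-1) = ln (zeta (gr 1)) + I 1"
  proof (rule eq_endpoints_if_quadratic_increments[where F = "\<lambda>r. ln (zeta (gr r)) + I r" and a = "-1" and b = 1
        and m = "cdf \<nu>" and K = "2 * exp G"])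
    fix r s :: real
    assume rs: "-1 \<le> r" "r \<le> s" "s \<le> 1"
    show "cdf \<nu> r \<le> cdf \<nu> s" by (intro \<nu>.cdf_nondecreasing rs)
    have d: "(\<integral>\<^sup>+ x. f r s x \<partial>M) = ennreal (cdf \<nu> s - cdf \<nu> r)"
    proof (cases "r = s")
      case False
      then have "ennreal (cdf \<nu> s - cdf \<nu> r) = emeasure \<nu> {r<..s}"
        using rs by (subst \<nu>.cdf_diff_eq) (auto simp: \<nu>.emeasure_eq_measure)
      also have "\<dots> = (\<integral>\<^sup>+ x. f r s x \<partial>M)"
        by (subst em) (auto simp: f_def intro!: nn_integral_cong split: split_indicator)
      finally show ?thesis by simp
    qed (simp add: f_def)
    have "\<bar>ln (zeta (gr r)) - ln (zeta (gr s)) - (I s - I r)\<bar> \<le> 2 * exp G * (cdf \<nu> s - cdf \<nu> r)\<^sup>2"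
      unfolding gr_split[OF rs(2)]
    proof (rule ln_zeta_increment[where q = q])
      show "(\<integral>\<^sup>+ x. gr s x + f r s x \<partial>M) \<le> ennreal G"
        by (rule order_trans[OF nn_integral_mono G(1)]) (simp add: gr_le fun_cong[OF gr_split[OF rs(2)], symmetric])
      show "(\<integral>\<^sup>+ w. f r s w * ennreal (q w) \<partial>M) = ennreal (I s - I r)" "0 \<le> I s - I r"
        using I_diff[of r s] rs by auto
      fix w
      assume "f r s w \<noteq> 0"
      then have w: "r < \<rho> w" "\<rho> w \<le> s" by (auto simp: f_def indicator_def split: if_splits)
      \<comment> \<open>For w in the shell between r and s the ball through w lies between the two
        balls, so its activity lies between \<open>gr s\<close> and \<open>gr r\<close>. This gives
        the sandwich for q.\<close>
      have 1: "gr s x \<le> branch g v w x" for x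
        using w(2) \<rho>_less_iff[of x w] by (auto simp: gr_def branch_def)
      have 2: "branch g v w x \<le> gr r x" for x
        using w(1) \<rho>_less_iff[of x w] by (auto simp: gr_def branch_def)
      have 3: "branch g v w x * E w x \<le> g x" "gr r x * E w x \<le> g x" for x
        using order_trans[OF mult_E_le_self gr_le] order_trans[OF mult_E_le_self branch_le] by auto
      have "zeta (\<lambda>x. gr s x * E w x) / zeta (gr r) \<le> q w"
        unfolding q_def density_ratio_def
        by (intro frac_le order_less_le_trans[OF _ zeta_ge_1] zeta_mono fin gr_le branch_le 1 2 3 mult_right_mono)
           (auto simp: zeta_def)
      then show "zeta (\<lambda>x. gr s x * E w x) / zeta (\<lambda>x. gr s x + f r s x) \<le> q w"
        by (simp add: gr_split[OF rs(2), symmetric])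
      have "q w \<le> zeta (\<lambda>x. gr r x * E w x) / zeta (gr s)"
        unfolding q_def density_ratio_def
        by (intro frac_le order_less_le_trans[OF _ zeta_ge_1] zeta_mono fin gr_le branch_le 1 2 3 mult_right_mono)
           (auto simp: zeta_def)
      then show "q w \<le> zeta (\<lambda>x. (gr s x + f r s x) * E w x) / zeta (gr s)"
        by (simp add: gr_split[OF rs(2), symmetric] fun_cong[OF gr_split[OF rs(2)], symmetric])
    qed (use d G rs \<nu>.cdf_nondecreasing[OF rs(2)] in auto)
    then show "\<bar>ln (zeta (gr s)) + I s - (ln (zeta (gr r)) + I r)\<bar> \<le> 2 * exp G * (cdf \<nu> s - cdf \<nu> r)\<^sup>2"
      by (simp add: abs_le_iff)
  qed (use m_cont in auto)
  moreover have "gr (-1) = g"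
    using \<rho>_bounds(1) by (auto simp: gr_def fun_eq_iff) (smt (verit) \<rho>_bounds(1))
  moreover have "gr 1 = (\<lambda>x. g x * E v x)"
    using \<rho>_bounds(2) by (auto simp: gr_def fun_eq_iff less_imp_le)
  moreover have "f (-1) 1 = h" "f (-1) (-1) = (\<lambda>_. 0)"
    using \<rho>_bounds by (auto simp: f_def fun_eq_iff indicator_def less_imp_le) (smt (verit) \<rho>_bounds)+
  ultimately show ?thesis
    by (simp add: I_def h_def q_def)
qed

text \<open>\<open>ln_zeta_increment\<close> for f = (s - r) u: monotonicity in the activity puts
  the density at t between the two ratios as soon as r \<le> t \<le> s. Taking t as one end of the
  interval bounds the difference quotients on both sides, with an error linear in |s - t|.\<close>

lemma ln_zeta_has_derivative:
  assumes u [measurable]: "u \<in> borel_measurable M" and m: "(\<integral>\<^sup>+ x. u x \<partial>M) = ennreal m" "0 \<le> m"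
    and t: "t \<in> {0..T}"
  shows "((\<lambda>t. ln (zeta (\<lambda>x. ennreal t * u x))) has_real_derivative
      enn2real (\<integral>\<^sup>+ w. u w * ennreal (density_ratio (\<lambda>x. ennreal t * u x) w) \<partial>M)) (at t within {0..T})"
proof -
  define q where "q w = density_ratio (\<lambda>x. ennreal t * u x) w" for w
  have [measurable]: "q \<in> borel_measurable M"
    unfolding q_def by measurable
  define g where "g s x = ennreal s * u x" for s x
  have [measurable]: "g s \<in> borel_measurable M" for s
    unfolding g_def by measurable
  have g_int: "(\<integral>\<^sup>+ x. g s x \<partial>M) = ennreal (s * m)" if "0 \<le> s" for s
    using m that by (simp add: g_def nn_integral_cmult ennreal_mult)
  have fin: "(\<integral>\<^sup>+ x. h x \<partial>M) < \<infinity>" if "\<And>x. h x \<le> g s x" "0 \<le> s" for h s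
    by (rule le_less_trans[OF nn_integral_mono[of M h "g s"]]) (simp_all add: that g_int)
  have q01: "0 < q w" "q w \<le> 1" for w
    unfolding q_def using t fin[of _ t] by (auto intro!: density_ratio_bounds simp: g_def)
  define D where "D = enn2real (\<integral>\<^sup>+ w. u w * ennreal (q w) \<partial>M)"
  have "(\<integral>\<^sup>+ w. u w * ennreal (q w) \<partial>M) \<le> (\<integral>\<^sup>+ w. u w \<partial>M)"
    using mult_left_mono[of "ennreal (q w)" 1 "u w" for w] q01 by (intro nn_integral_mono) (auto simp: ennreal_le_1)
  then have D: "(\<integral>\<^sup>+ w. u w * ennreal (q w) \<partial>M) = ennreal D" "0 \<le> D"
    using m by (simp_all add: D_def le_less_trans[of _ "ennreal m"])
  define F where "F s = ln (zeta (g s))" for s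
  define K where "K = 2 * exp (T * m) * m\<^sup>2"
  have g_split: "g s = (\<lambda>x. g r x + ennreal (s - r) * u x)" if "0 \<le> r" "r \<le> s" for r s
    using that by (auto simp: g_def fun_eq_iff simp flip: distrib_right ennreal_plus)
  have g_mono: "g r x \<le> g s x" "g r x * E w x \<le> g s x * E w x" "g r x * E w x \<le> g s x" if "r \<le> s" for r s w x
  proof -
    show *: "g r x \<le> g s x"
      using that by (auto simp: g_def intro!: mult_right_mono ennreal_leI)
    then show "g r x * E w x \<le> g s x * E w x" by (rule mult_right_mono) simp
    show "g r x * E w x \<le> g s x" using order_trans[OF mult_E_le_self *] .
  qed
  have key: "\<bar>F s - F r - (s - r) * D\<bar> \<le> K * (s - r)\<^sup>2"
    if rs: "0 \<le> r" "r \<le> s" "s \<le> T" "r = t \<or> s = t" for r s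
  proof -
    have rts: "r \<le> t" "t \<le> s" using rs by auto
    have "\<bar>F s - F r - (s - r) * D\<bar> \<le> 2 * exp (T * m) * ((s - r) * m)\<^sup>2"
      unfolding F_def g_split[OF rs(1,2)]
    proof (rule ln_zeta_increment[where q = q])
      show "(\<integral>\<^sup>+ x. g r x + ennreal (s - r) * u x \<partial>M) \<le> ennreal (T * m)"
        unfolding g_split[OF rs(1,2), symmetric, THEN fun_cong] using rs m
        by (subst g_int) (auto intro!: ennreal_leI mult_right_mono)
      show "(\<integral>\<^sup>+ w. ennreal (s - r) * u w * ennreal (q w) \<partial>M) = ennreal ((s - r) * D)"
        using rs D by (simp add: mult.assoc nn_integral_cmult ennreal_mult)
      fix w
      have q_eq: "q w = zeta (\<lambda>x. g t x * E w x) / zeta (g t)"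
        by (simp add: q_def density_ratio_def g_def[abs_def])
      have "zeta (\<lambda>x. g r x * E w x) / zeta (g s) \<le> q w"
        unfolding q_eq using rs rts t
        by (intro frac_le order_less_le_trans[OF _ zeta_ge_1] zeta_mono fin[of _ s] g_mono) (auto simp: zeta_def)
      then show "zeta (\<lambda>x. g r x * E w x) / zeta (\<lambda>x. g r x + ennreal (s - r) * u x) \<le> q w"
        by (simp add: g_split[OF rs(1,2), symmetric])
      have "q w \<le> zeta (\<lambda>x. g s x * E w x) / zeta (g r)"
        unfolding q_eq using rs rts t
        by (intro frac_le order_less_le_trans[OF _ zeta_ge_1] zeta_mono fin[of _ s] g_mono) (auto simp: zeta_def)
      then show "q w \<le> zeta (\<lambda>x. (g r x + ennreal (s - r) * u x) * E w x) / zeta (g r)"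
        by (simp add: fun_cong[OF g_split[OF rs(1,2)], symmetric])
    qed (use rs m D in \<open>auto simp: nn_integral_cmult ennreal_mult\<close>)
    then show ?thesis by (simp add: K_def power_mult_distrib mult_ac)
  qed
  have "\<bar>(F s - F t) / (s - t) - D\<bar> \<le> K * \<bar>s - t\<bar>" if "s \<in> {0..T}" "s \<noteq> t" for s
  proof -
    have "\<bar>F s - F t - (s - t) * D\<bar> \<le> K * (s - t)\<^sup>2"
    proof (cases "t \<le> s")
      case True then show ?thesis using key[of t s] that t by auto
    next
      case False
      then have "\<bar>F t - F s - (t - s) * D\<bar> \<le> K * (t - s)\<^sup>2"
        using key[of s t] that t by auto
      moreover have "F t - F s - (t - s) * D = - (F s - F t - (s - t) * D)" by (simp add: algebra_simps)
      ultimately show ?thesis by (simp only: abs_minus_cancel power2_commute[of t s])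
    qed
    moreover have "(F s - F t) / (s - t) - D = (F s - F t - (s - t) * D) / (s - t)"
      using that by (simp add: field_simps)
    moreover have "(s - t)\<^sup>2 = \<bar>s - t\<bar> * \<bar>s - t\<bar>" by (simp add: power2_eq_square)
    ultimately show ?thesis
      using that by (simp add: divide_le_eq abs_divide mult.assoc)
  qed
  then have "eventually (\<lambda>s. norm ((F s - F t) / (s - t) - D) \<le> K * \<bar>s - t\<bar>) (at t within {0..T})"
    by (auto simp: eventually_at_filter)
  moreover have "((\<lambda>s. K * \<bar>s - t\<bar>) \<longlongrightarrow> 0) (at t within {0..T})"
  proof -
    have "((\<lambda>s. K * \<bar>s - t\<bar>) \<longlongrightarrow> K * \<bar>t - t\<bar>) (at t within {0..T})"
      by (rule tendsto_mult tendsto_const tendsto_rabs tendsto_diff tendsto_ident_at)+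
    then show ?thesis by (simp only: diff_self abs_zero mult_zero_right)
  qed
  ultimately have "((\<lambda>s. (F s - F t) / (s - t) - D) \<longlongrightarrow> 0) (at t within {0..T})"
    by (rule Lim_null_comparison)
  then have "((\<lambda>s. (F s - F t) / (s - t)) \<longlongrightarrow> D) (at t within {0..T})"
    by (rule LIM_zero_cancel)
  then show ?thesis
    unfolding F_def g_def D_def q_def by (simp add: has_field_derivative_iff)
qed

end

section \<open>Iterating the recursion\<close>

lemma norm_exp_minus_1_le: "norm (exp z - 1) \<le> norm z * exp (norm z)" for z :: complex
proof -
  have "norm (exp z - exp 0) \<le> exp (norm z) * norm (z - 0)"
  proof (rule field_differentiable_bound[where S = "cball 0 (norm z)" and f' = exp])
    fix x :: complex assume "x \<in> cball 0 (norm z)"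
    then show "norm (exp x) \<le> exp (norm z)"
      by (intro order_trans[OF norm_exp]) simp
  qed (auto intro!: derivative_eq_intros)
  then show ?thesis by (simp add: mult.commute)
qed

lemma norm_integral_le:
  fixes f :: "'a \<Rightarrow> 'b::{banach, second_countable_topology}"
  assumes "integrable M f" "integrable M g" "\<And>x. norm (f x) \<le> g x"
  shows "norm (integral\<^sup>L M f) \<le> integral\<^sup>L M g"
  using assms by (intro order_trans[OF Bochner_Integration.integral_norm_bound Bochner_Integration.integral_mono]) auto

lemma mult_exp_minus_le: "x * exp (- x) \<le> exp (- 1)" for x :: real
proof -
  have "x \<le> exp (x - 1)" using exp_ge_add_one_self[of "x - 1"] by simp
  then have "x * exp (- x) \<le> exp (x - 1) * exp (- x)" by (rule mult_right_mono) simp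
  then show ?thesis by (simp flip: exp_add)
qed

lemma measurable_component_borel:
  assumes "f \<in> N \<rightarrow>\<^sub>M Pi\<^sub>M UNIV (\<lambda>_::nat. borel)"
  shows "(\<lambda>p. f p i) \<in> N \<rightarrow>\<^sub>M borel"
  using measurable_compose[OF assms measurable_component_singleton[of i]] by simp

lemma measurable_path_upd [measurable (raw)]:
  assumes "f \<in> N \<rightarrow>\<^sub>M Pi\<^sub>M UNIV (\<lambda>_::nat. borel)" "g \<in> N \<rightarrow>\<^sub>M borel"
  shows "(\<lambda>p. (f p)(i := g p)) \<in> N \<rightarrow>\<^sub>M Pi\<^sub>M UNIV (\<lambda>_::nat. borel)"
  by (rule measurable_fun_upd[where J = UNIV]) (use assms in auto)

text \<open>The quadratic s \<mapsto> \<integral> p (s - d)^2 is nonnegative and is evaluated at its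
  minimiser I / J. If J = 0 it is affine in s, and the value s = (K + 1) / (2 I) would make it -1
  unless I \<le> 0.\<close>

lemma (in sigma_finite_measure) integral_Cauchy_Schwarz_weighted:
  fixes p d :: "'a \<Rightarrow> real"
  assumes [measurable]: "p \<in> borel_measurable M" "d \<in> borel_measurable M"
    and p: "\<And>x. 0 \<le> p x" "integrable M p" and d: "\<And>x. 0 \<le> d x" "\<And>x. d x \<le> B"
  shows "(LINT x|M. p x * d x)\<^sup>2 \<le> (LINT x|M. p x) * (LINT x|M. p x * (d x)\<^sup>2)"
proof -
  have le1: "norm (p x * d x) \<le> norm (B * p x)" for x
    using mult_mono[of "\<bar>p x\<bar>" "\<bar>p x\<bar>" "\<bar>d x\<bar>" "\<bar>B\<bar>"] d[of x] by (auto simp: abs_mult mult.commute)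
  have le2: "norm (p x * (d x)\<^sup>2) \<le> norm (B\<^sup>2 * p x)" for x
    using mult_mono[of "\<bar>p x\<bar>" "\<bar>p x\<bar>" "(d x)\<^sup>2" "B\<^sup>2"] power_mono[OF d(2) d(1), of x 2] by (auto simp: abs_mult mult.commute)
  have int1: "integrable M (\<lambda>x. p x * d x)"
    by (rule Bochner_Integration.integrable_bound[OF _ _ AE_I2[OF le1]]) (use p in auto)
  have int2: "integrable M (\<lambda>x. p x * (d x)\<^sup>2)"
    by (rule Bochner_Integration.integrable_bound[OF _ _ AE_I2[OF le2]]) (use p in auto)
  define I J K where "I = (LINT x|M. p x * d x)" and "J = (LINT x|M. p x)" and "K = (LINT x|M. p x * (d x)\<^sup>2)"
  have quad: "0 \<le> s\<^sup>2 * J - 2 * s * I + K" for s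
  proof -
    have "0 \<le> (LINT x|M. p x * (s - d x)\<^sup>2)"
      using p by (intro Bochner_Integration.integral_nonneg) auto
    also have "(\<lambda>x. p x * (s - d x)\<^sup>2) = (\<lambda>x. s\<^sup>2 * p x - 2 * s * (p x * d x) + p x * (d x)\<^sup>2)"
      by (auto simp: power2_eq_square algebra_simps)
    finally show ?thesis
      using p int1 int2 by (simp add: I_def J_def K_def)
  qed
  have "0 \<le> J" using p by (auto simp: J_def)
  show "I\<^sup>2 \<le> J * K"
  proof (cases "J = 0")
    case True
    have "I \<le> 0"
    proof (rule ccontr)
      assume "\<not> I \<le> 0"
      then have "2 * ((K + 1) / (2 * I)) * I = K + 1" by simp
      then show False
        using quad[of "(K + 1) / (2 * I)"] unfolding True by linarith
    qed
    moreover have "0 \<le> I" using p d by (auto simp: I_def intro!: Bochner_Integration.integral_nonneg)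
    ultimately show ?thesis using True by simp
  next
    case False
    then have "0 < J" using \<open>0 \<le> J\<close> by simp
    define r where "r = I / J"
    have I: "I = r * J" using \<open>0 < J\<close> by (simp add: r_def)
    have "0 \<le> J * (r\<^sup>2 * J - 2 * r * I + K)"
      by (rule mult_nonneg_nonneg[OF \<open>0 \<le> J\<close> quad])
    also have "\<dots> = J * K - I\<^sup>2"
      unfolding I by (simp add: power2_eq_square algebra_simps)
    finally show ?thesis by simp
  qed
qed

context repulsive_gas
begin

text \<open>A node of the recursion tree is a path \<open>v 0, \<dots>, v m\<close>, encoded as the pair of \<open>m\<close> and an infinite sequence
  \<open>v\<close> whose later entries are ignored; keeping all paths in one type makes the measurability proofs by
  induction on the depth possible.\<close>

definition hist :: "nat \<Rightarrow> (nat \<Rightarrow> 'a) \<Rightarrow> 'a \<Rightarrow> real" where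
  "hist m v x = (\<Prod>i<m. if dist x (v i) < dist (v i) (v (Suc i)) then e (v i) x else 1)"

text \<open>The kernel of the recursion at the last vertex \<open>v m\<close>. For \<Lambda> =
  \<open>UNIV\<close> it is the factor with index j = m + 1 in the integrand of V_k.\<close>

definition wt :: "'a set \<Rightarrow> nat \<Rightarrow> (nat \<Rightarrow> 'a) \<Rightarrow> 'a \<Rightarrow> real" where
  "wt \<Lambda> m v w = indicator \<Lambda> w * hist m v w * (1 - e (v m) w)"

lemma hist_measurable [measurable (raw)]:
  assumes [measurable]: "f \<in> N \<rightarrow>\<^sub>M Pi\<^sub>M UNIV (\<lambda>_::nat. borel)" "g \<in> N \<rightarrow>\<^sub>M borel"
  shows "(\<lambda>p. hist m (f p) (g p)) \<in> borel_measurable N"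
proof -
  note [measurable] = measurable_component_borel[OF assms(1)]
  show ?thesis
    unfolding hist_def by measurable
qed

lemma wt_measurable [measurable (raw)]:
  assumes [measurable]: "f \<in> N \<rightarrow>\<^sub>M Pi\<^sub>M UNIV (\<lambda>_::nat. borel)" "g \<in> N \<rightarrow>\<^sub>M borel" "\<Lambda> \<in> sets borel"
  shows "(\<lambda>p. wt \<Lambda> m (f p) (g p)) \<in> borel_measurable N"
proof -
  note [measurable] = measurable_component_borel[OF assms(1)]
  show ?thesis
    unfolding wt_def by measurable
qed

lemma hist_bounds [simp]: "0 \<le> hist m v x" "hist m v x \<le> 1"
  unfolding hist_def by (auto intro!: prod_nonneg prod_le_1)

lemma hist_0 [simp]: "hist 0 v x = 1"
  by (simp add: hist_def)

lemma hist_upd: "hist (Suc m) (v(Suc m := w)) x =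
    hist m v x * (if dist x (v m) < dist (v m) w then e (v m) x else 1)"
proof -
  have "(\<Prod>i<m. if dist x ((v(Suc m := w)) i) < dist ((v(Suc m := w)) i) ((v(Suc m := w)) (Suc i)) then e ((v(Suc m := w)) i) x else 1) =
    hist m v x"
    unfolding hist_def by (intro prod.cong) auto
  then show ?thesis
    by (simp add: hist_def)
qed

lemma wt_nonneg [simp]: "0 \<le> wt \<Lambda> m v w"
  by (simp add: wt_def)

lemma wt_le: "wt \<Lambda> m v w \<le> 1 - e (v m) w"
proof -
  have "indicator \<Lambda> w * hist m v w \<le> 1" by (rule mult_le_one) auto
  then show ?thesis
    unfolding wt_def using mult_right_mono[of _ 1 "1 - e (v m) w"] by simp
qed

lemma wt_mono: "\<Lambda> \<subseteq> \<Lambda>' \<Longrightarrow> wt \<Lambda> m v w \<le> wt \<Lambda>' m v w"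
  unfolding wt_def by (intro mult_right_mono) (auto simp: indicator_def)

lemma nn_integral_wt_le: "(\<integral>\<^sup>+ w. ennreal (wt \<Lambda> m v w) \<partial>M) \<le> ennreal C"
  by (rule order_trans[OF nn_integral_mono mayer_bound[of "v m"]]) (rule ennreal_leI, rule wt_le)

lemma const_path_measurable [measurable]: "(\<lambda>_. v) \<in> N \<rightarrow>\<^sub>M Pi\<^sub>M UNIV (\<lambda>_::nat. borel :: 'a measure)"
  by (rule measurable_const) (simp add: space_PiM)

lemma integrable_wt:
  assumes [measurable]: "\<Lambda> \<in> sets borel"
  shows "integrable M (wt \<Lambda> m v)"
proof (rule integrableI_nonneg)
  show "(\<integral>\<^sup>+ w. ennreal (wt \<Lambda> m v w) \<partial>M) < \<infinity>"
    using nn_integral_wt_le[of \<Lambda> m v] by (rule le_less_trans) simp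
qed auto

lemma integral_wt_le: "\<Lambda> \<in> sets borel \<Longrightarrow> (LINT w|M. wt \<Lambda> m v w) \<le> C"
  using nn_integral_wt_le[of \<Lambda> m v] C_nonneg
  by (subst (asm) nn_integral_eq_integral) (auto simp: integrable_wt)

text \<open>Here n counts the levels still to be evaluated and m is the depth of the node, so a step
  lowers n and raises m. The leaves get the value 0.\<close>

primrec X :: "real \<Rightarrow> 'a set \<Rightarrow> nat \<Rightarrow> nat \<Rightarrow> (nat \<Rightarrow> 'a) \<Rightarrow> real" where
  "X t \<Lambda> 0 m v = 0"
| "X t \<Lambda> (Suc n) m v = t * (LINT w|M. wt \<Lambda> m v w * exp (- X t \<Lambda> n (Suc m) (v(Suc m := w))))"

primrec S :: "complex \<Rightarrow> 'a set \<Rightarrow> nat \<Rightarrow> nat \<Rightarrow> (nat \<Rightarrow> 'a) \<Rightarrow> complex" where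
  "S z \<Lambda> 0 m v = 0"
| "S z \<Lambda> (Suc n) m v = z * (LINT w|M. of_real (wt \<Lambda> m v w) * exp (- S z \<Lambda> n (Suc m) (v(Suc m := w))))"

text \<open>The total weight of all n-step continuations of a path, which is what the linearised
  recursion accumulates. The whole space in place of \<Lambda> keeps it independent of the
  volume.\<close>

primrec T :: "nat \<Rightarrow> nat \<Rightarrow> (nat \<Rightarrow> 'a) \<Rightarrow> ennreal" where
  "T 0 m v = 1"
| "T (Suc n) m v = (\<integral>\<^sup>+ w. ennreal (wt UNIV m v w) * T n (Suc m) (v(Suc m := w)) \<partial>M)"

lemma X_measurable0:
  assumes [measurable]: "\<Lambda> \<in> sets borel"
  shows "X t \<Lambda> n m \<in> borel_measurable (Pi\<^sub>M UNIV (\<lambda>_::nat. borel))"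
proof (induction n arbitrary: m)
  case 0
  have "X t \<Lambda> 0 m = (\<lambda>_. 0)" by auto
  then show ?case by simp
next
  case (Suc n)
  note [measurable (raw)] = measurable_compose[OF _ Suc.IH]
  have "X t \<Lambda> (Suc n) m = (\<lambda>v. t * (LINT w|M. wt \<Lambda> m v w * exp (- X t \<Lambda> n (Suc m) (v(Suc m := w)))))" by auto
  then show ?case by simp
qed

lemma S_measurable0:
  assumes [measurable]: "\<Lambda> \<in> sets borel"
  shows "S z \<Lambda> n m \<in> borel_measurable (Pi\<^sub>M UNIV (\<lambda>_::nat. borel))"
proof (induction n arbitrary: m)
  case 0
  have "S z \<Lambda> 0 m = (\<lambda>_. 0)" by auto
  then show ?case by simp
next
  case (Suc n)
  note [measurable (raw)] = measurable_compose[OF _ Suc.IH]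
  have "S z \<Lambda> (Suc n) m = (\<lambda>v. z * (LINT w|M. of_real (wt \<Lambda> m v w) * exp (- S z \<Lambda> n (Suc m) (v(Suc m := w)))))" by auto
  then show ?case by simp
qed

lemma T_measurable0: "T n m \<in> borel_measurable (Pi\<^sub>M UNIV (\<lambda>_::nat. borel))"
proof (induction n arbitrary: m)
  case 0
  have "T 0 m = (\<lambda>_. 1)" by auto
  then show ?case by simp
next
  case (Suc n)
  note [measurable (raw)] = measurable_compose[OF _ Suc.IH]
  have "T (Suc n) m = (\<lambda>v. (\<integral>\<^sup>+ w. ennreal (wt UNIV m v w) * T n (Suc m) (v(Suc m := w)) \<partial>M))" by auto
  then show ?case by simp
qed

lemmas X_measurable [measurable (raw)] = measurable_compose[OF _ X_measurable0]
lemmas S_measurable [measurable (raw)] = measurable_compose[OF _ S_measurable0]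
lemmas T_measurable [measurable (raw)] = measurable_compose[OF _ T_measurable0]

lemma X_bounds0:
  assumes [measurable]: "\<Lambda> \<in> sets borel" and t: "0 \<le> t"
  shows "0 \<le> X t \<Lambda> n m v \<and> X t \<Lambda> n m v \<le> t * C"
proof (induction n arbitrary: m v)
  case (Suc n)
  have le: "wt \<Lambda> m v w * exp (- X t \<Lambda> n (Suc m) (v(Suc m := w))) \<le> wt \<Lambda> m v w" for w
    using Suc by (intro mult_left_le) auto
  have "(LINT w|M. wt \<Lambda> m v w * exp (- X t \<Lambda> n (Suc m) (v(Suc m := w)))) \<le> (LINT w|M. wt \<Lambda> m v w)"
    by (intro integral_mono' integrable_wt le) auto
  also have "\<dots> \<le> C" by (rule integral_wt_le) simp
  finally show ?case using t by (auto simp: mult_left_mono intro!: mult_nonneg_nonneg Bochner_Integration.integral_nonneg)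
qed (use t C_nonneg in auto)

lemma X_bounds:
  assumes "\<Lambda> \<in> sets borel" "0 \<le> t"
  shows "0 \<le> X t \<Lambda> n m v" "X t \<Lambda> n m v \<le> t * C"
  using X_bounds0[OF assms] by auto

lemma integrable_wt_exp_X:
  assumes [measurable]: "\<Lambda> \<in> sets borel" and t: "0 \<le> t"
  shows "integrable M (\<lambda>w. wt \<Lambda> m v w * exp (- X t \<Lambda> n (Suc m) (v(Suc m := w))))"
proof (rule Bochner_Integration.integrable_bound[OF integrable_wt[OF assms(1)] _ AE_I2])
  fix w
  show "norm (wt \<Lambda> m v w * exp (- X t \<Lambda> n (Suc m) (v(Suc m := w)))) \<le> norm (wt \<Lambda> m v w)"
    using X_bounds(1)[OF assms, of n "Suc m" "v(Suc m := w)"] by (simp add: abs_mult mult_left_le)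
qed measurable

lemma wt_exp_integral:
  fixes s :: "'a \<Rightarrow> complex"
  assumes [measurable]: "\<Lambda> \<in> sets borel" "s \<in> borel_measurable M" and s: "\<And>w. norm (s w) \<le> B"
  shows "integrable M (\<lambda>w. of_real (wt \<Lambda> m v w) * exp (- s w))"
    and "norm (LINT w|M. of_real (wt \<Lambda> m v w) * exp (- s w)) \<le> C * exp B"
proof -
  have le: "norm (of_real (wt \<Lambda> m v w) * exp (- s w)) \<le> exp B * wt \<Lambda> m v w" for w
  proof -
    have "norm (exp (- s w)) \<le> exp B"
      by (rule order_trans[OF norm_exp]) (simp add: s)
    then show ?thesis
      by (subst mult.commute) (simp add: norm_mult mult_right_mono del: norm_exp_eq_Re)
  qed
  have int: "integrable M (\<lambda>w. exp B * wt \<Lambda> m v w)"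
    by (intro integrable_mult_right integrable_wt) simp
  show int': "integrable M (\<lambda>w. of_real (wt \<Lambda> m v w) * exp (- s w))"
  proof (rule Bochner_Integration.integrable_bound[OF int])
    show "AE w in M. norm (of_real (wt \<Lambda> m v w) * exp (- s w)) \<le> norm (exp B * wt \<Lambda> m v w)"
      by (rule AE_I2) (rule order_trans[OF le], simp)
  qed measurable
  have "norm (LINT w|M. of_real (wt \<Lambda> m v w) * exp (- s w)) \<le> (LINT w|M. exp B * wt \<Lambda> m v w)"
    by (rule norm_integral_le[OF int' int le])
  also have "\<dots> \<le> C * exp B"
    using integral_wt_le[of \<Lambda> m v] by simp
  finally show "norm (LINT w|M. of_real (wt \<Lambda> m v w) * exp (- s w)) \<le> C * exp B" .
qed

text \<open>A crude bound that grows like an iterated exponential. It secures integrability and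
  holomorphy at each fixed n; bounds uniform in n come from
  \<open>complex_iterate_close_to_real\<close>.\<close>

primrec S_bound :: "real \<Rightarrow> nat \<Rightarrow> real" where
  "S_bound R 0 = 0"
| "S_bound R (Suc n) = R * (C * exp (S_bound R n))"

lemma norm_S_le:
  assumes [measurable]: "\<Lambda> \<in> sets borel" and z: "norm z \<le> R"
  shows "norm (S z \<Lambda> n m v) \<le> S_bound R n"
proof (induction n arbitrary: m v)
  case (Suc n)
  have "0 \<le> R" using z norm_ge_zero order_trans by blast
  moreover have "norm (LINT w|M. of_real (wt \<Lambda> m v w) * exp (- S z \<Lambda> n (Suc m) (v(Suc m := w)))) \<le> C * exp (S_bound R n)"
    by (rule wt_exp_integral(2)) (auto intro: Suc)
  ultimately show ?case
    using z by (auto simp: norm_mult intro!: mult_mono)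
qed simp

lemma integrable_wt_exp_S:
  assumes [measurable]: "\<Lambda> \<in> sets borel"
  shows "integrable M (\<lambda>w. of_real (wt \<Lambda> m v w) * exp (- S z \<Lambda> n (Suc m) (v(Suc m := w))))"
  by (rule wt_exp_integral(1)[where B = "S_bound (norm z) n"]) (auto intro: norm_S_le)


text \<open>One step of the recursion for exp(-X) |S - X|^2. The linear part costs l / e, the
  nonlinearity of exp on a disc of radius \<eta> costs exp(2 \<eta>), and separating the source |z -
  t| from the propagated error costs 1 + 1/\<eta> on the former and 1 + \<eta> on the
  latter.\<close>

lemma complex_iterate_contraction:
  assumes [measurable]: "\<Lambda> \<in> sets borel" and t: "0 \<le> t" "t \<le> l" and \<eta>: "0 < \<eta>"
    and z: "norm (z - of_real t) \<le> \<epsilon>"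
    and close: "\<And>v. norm (S z \<Lambda> n (Suc m) v - of_real (X t \<Lambda> n (Suc m) v)) \<le> \<eta>"
  defines "D \<equiv> \<lambda>n m v. norm (S z \<Lambda> n m v - of_real (X t \<Lambda> n m v))"
  shows "exp (- X t \<Lambda> (Suc n) m v) * (D (Suc n) m v)\<^sup>2 \<le>
     (1 + 1 / \<eta>) * (exp (2 * \<eta>) * C\<^sup>2) * \<epsilon>\<^sup>2 + (1 + \<eta>) * exp (2 * \<eta>) * l / exp 1 *
       (LINT w|M. wt \<Lambda> m v w * (exp (- X t \<Lambda> n (Suc m) (v(Suc m := w))) * (D n (Suc m) (v(Suc m := w)))\<^sup>2))"
proof -
  define x where "x w = X t \<Lambda> n (Suc m) (v(Suc m := w))" for w
  define s where "s w = S z \<Lambda> n (Suc m) (v(Suc m := w))" for w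
  define d where "d w = D n (Suc m) (v(Suc m := w))" for w
  define p where "p w = wt \<Lambda> m v w * exp (- x w)" for w
  have [measurable]: "x \<in> borel_measurable M" "s \<in> borel_measurable M" "d \<in> borel_measurable M" "p \<in> borel_measurable M"
    unfolding x_def[abs_def] s_def[abs_def] d_def[abs_def] D_def p_def[abs_def] by measurable
  have d_eq: "d w = norm (s w - of_real (x w))" for w
    by (simp add: d_def D_def s_def x_def)
  have d: "0 \<le> d w" "d w \<le> \<eta>" for w
    using close by (auto simp: d_def D_def)
  have x0: "0 \<le> x w" for w using X_bounds[OF assms(1) t(1)] by (simp add: x_def)
  have p: "0 \<le> p w" for w by (simp add: p_def)
  have p_int: "integrable M p"
    unfolding p_def[abs_def] x_def by (rule integrable_wt_exp_X) (use t in auto)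
  have s_int: "integrable M (\<lambda>w. of_real (wt \<Lambda> m v w) * exp (- s w))"
    unfolding s_def by (rule integrable_wt_exp_S) simp
  have pd_int: "integrable M (\<lambda>w. p w * d w)"
    by (rule Bochner_Integration.integrable_bound[OF integrable_mult_right[OF p_int, of \<eta>] _ AE_I2])
       (use p d \<eta> in \<open>auto simp: abs_mult mult.commute intro!: mult_right_mono\<close>)
  define J I K where "J = (LINT w|M. p w)" and "I = (LINT w|M. p w * d w)" and "K = (LINT w|M. p w * (d w)\<^sup>2)"
  have nonneg: "0 \<le> J" "0 \<le> I" "0 \<le> K"
    unfolding J_def I_def K_def using p d by (auto intro!: Bochner_Integration.integral_nonneg)
  have CS: "I\<^sup>2 \<le> J * K"
    unfolding I_def J_def K_def using p_int p d by (intro integral_Cauchy_Schwarz_weighted) auto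
  have X_Suc: "X t \<Lambda> (Suc n) m v = t * J"
    by (simp add: J_def p_def x_def)
  \<comment> \<open>Splitting off exp(- x w) exactly produces p, the density for Cauchy-Schwarz;
    only s - x, of norm at most \<eta>, is estimated.\<close>
  have exp_s: "exp (- s w) = exp (- (s w - of_real (x w))) * of_real (exp (- x w))" for w
    by (simp flip: exp_of_real exp_add)
  have ns: "norm (exp (- s w)) \<le> exp \<eta>" for w
  proof -
    have "norm (exp (- (s w - of_real (x w)))) \<le> exp \<eta>"
      by (rule order_trans[OF norm_exp]) (use d[of w] in \<open>simp add: d_eq norm_minus_commute\<close>)
    then have "norm (exp (- s w)) \<le> exp \<eta> * exp (- x w)"
      unfolding exp_s norm_mult by (intro mult_mono) auto
    also have "\<dots> \<le> exp \<eta> * 1" by (intro mult_left_mono) (use x0 in auto)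
    finally show ?thesis by simp
  qed
  have diff: "norm (exp (- s w) - of_real (exp (- x w))) \<le> exp \<eta> * (exp (- x w) * d w)" for w
  proof -
    have "exp (- s w) - of_real (exp (- x w)) = (exp (- (s w - of_real (x w))) - 1) * of_real (exp (- x w))"
      unfolding exp_s by (simp add: algebra_simps)
    also have "norm \<dots> \<le> (d w * exp (d w)) * exp (- x w)"
      unfolding norm_mult using norm_exp_minus_1_le[of "- (s w - of_real (x w))"]
      by (intro mult_mono) (auto simp: d_eq norm_minus_commute)
    also have "\<dots> \<le> (d w * exp \<eta>) * exp (- x w)"
      by (intro mult_left_mono mult_right_mono) (use d in auto)
    finally show ?thesis by (simp add: mult_ac)
  qed
  have A: "norm (LINT w|M. of_real (wt \<Lambda> m v w) * exp (- s w)) \<le> exp \<eta> * C"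
  proof -
    have "norm (LINT w|M. of_real (wt \<Lambda> m v w) * exp (- s w)) \<le> (LINT w|M. exp \<eta> * wt \<Lambda> m v w)"
    proof (rule norm_integral_le[OF s_int])
      fix w
      show "norm (of_real (wt \<Lambda> m v w) * exp (- s w)) \<le> exp \<eta> * wt \<Lambda> m v w"
        using mult_right_mono[OF ns[of w], of "wt \<Lambda> m v w"] by (simp add: norm_mult mult.commute del: norm_exp_eq_Re)
    qed (intro integrable_mult_right integrable_wt, simp)
    also have "\<dots> \<le> exp \<eta> * C"
      using integral_wt_le[of \<Lambda> m v] by simp
    finally show ?thesis .
  qed
  have p_cint: "integrable M (\<lambda>w. complex_of_real (p w))" using p_int by simp
  have B: "norm ((LINT w|M. of_real (wt \<Lambda> m v w) * exp (- s w)) - of_real J) \<le> exp \<eta> * I"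
  proof -
    have "(LINT w|M. of_real (wt \<Lambda> m v w) * exp (- s w)) - of_real J =
       (LINT w|M. of_real (wt \<Lambda> m v w) * exp (- s w) - of_real (p w))"
      unfolding J_def using s_int p_cint by simp
    also have "norm \<dots> \<le> (LINT w|M. exp \<eta> * (p w * d w))"
    proof (rule norm_integral_le)
      fix w
      have "of_real (wt \<Lambda> m v w) * exp (- s w) - of_real (p w) = of_real (wt \<Lambda> m v w) * (exp (- s w) - of_real (exp (- x w)))"
        by (simp add: p_def algebra_simps)
      also have "norm \<dots> \<le> wt \<Lambda> m v w * (exp \<eta> * (exp (- x w) * d w))"
        using mult_left_mono[OF diff[of w], of "wt \<Lambda> m v w"] by (simp add: norm_mult)
      finally show "norm (of_real (wt \<Lambda> m v w) * exp (- s w) - of_real (p w)) \<le> exp \<eta> * (p w * d w)"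
        by (simp add: p_def mult_ac)
    qed (use s_int p_cint pd_int in auto)
    also have "\<dots> = exp \<eta> * I" by (simp add: I_def)
    finally show ?thesis .
  qed
  have D_le: "D (Suc n) m v \<le> exp \<eta> * (\<epsilon> * C + t * I)"
  proof -
    have "S z \<Lambda> (Suc n) m v - of_real (X t \<Lambda> (Suc n) m v) =
       (z - of_real t) * (LINT w|M. of_real (wt \<Lambda> m v w) * exp (- s w)) +
       of_real t * ((LINT w|M. of_real (wt \<Lambda> m v w) * exp (- s w)) - of_real J)"
      unfolding X_Suc by (simp add: s_def algebra_simps)
    then have "D (Suc n) m v \<le> norm (z - of_real t) * norm (LINT w|M. of_real (wt \<Lambda> m v w) * exp (- s w)) +
       t * norm ((LINT w|M. of_real (wt \<Lambda> m v w) * exp (- s w)) - of_real J)"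
      unfolding D_def using t by (simp only:) (rule order_trans[OF norm_triangle_ineq], simp add: norm_mult)
    also have "\<dots> \<le> \<epsilon> * (exp \<eta> * C) + t * (exp \<eta> * I)"
      using A B z t C_nonneg order_trans[OF norm_ge_zero z] by (intro add_mono mult_mono) auto
    finally show ?thesis by (simp add: algebra_simps)
  qed
  define y where "y = X t \<Lambda> (Suc n) m v"
  have y0: "0 \<le> y" using X_bounds[OF assms(1) t(1), of "Suc n" m v] by (simp only: y_def)
  \<comment> \<open>Since y = t J, the factor J from Cauchy-Schwarz is absorbed into y exp(-y) \<le>
    1/e. This is the origin of e in the range of \<lambda>.\<close>
  have key: "exp (- y) * (t * I)\<^sup>2 \<le> l / exp 1 * K"
  proof -
    have "exp (- y) * (t * I)\<^sup>2 \<le> exp (- y) * (t\<^sup>2 * (J * K))"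
      using CS by (intro mult_left_mono) (auto simp: power_mult_distrib intro!: mult_left_mono)
    also have "\<dots> = (y * exp (- y)) * (t * K)"
      by (simp add: y_def X_Suc power2_eq_square del: X.simps)
    also have "\<dots> \<le> exp (- 1) * (l * K)"
      using t nonneg by (intro mult_mono mult_exp_minus_le mult_right_mono) auto
    finally show ?thesis by (simp add: exp_minus field_simps)
  qed
  have "(D (Suc n) m v)\<^sup>2 \<le> (exp \<eta> * (\<epsilon> * C + t * I))\<^sup>2"
    by (intro power_mono D_le) (simp add: D_def)
  also have "\<dots> = exp (2 * \<eta>) * (\<epsilon> * C + t * I)\<^sup>2"
    by (simp add: power_mult_distrib exp_double)
  \<comment> \<open>Young's inequality with parameter \<eta>: the source may pay 1/\<eta>, as
    \<epsilon> is chosen last, while the propagated error must keep a factor near 1.\<close>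
  also have "(\<epsilon> * C + t * I)\<^sup>2 \<le> (1 + 1 / \<eta>) * (\<epsilon> * C)\<^sup>2 + (1 + \<eta>) * (t * I)\<^sup>2"
  proof -
    have "0 \<le> (\<epsilon> * C - \<eta> * (t * I))\<^sup>2 / \<eta>" using \<eta> by simp
    also have "\<dots> = (\<epsilon> * C)\<^sup>2 / \<eta> + \<eta> * (t * I)\<^sup>2 - 2 * (\<epsilon> * C) * (t * I)"
      using \<eta> by (simp add: power2_eq_square field_simps)
    finally show ?thesis by (simp add: power2_sum algebra_simps)
  qed
  finally have "(D (Suc n) m v)\<^sup>2 \<le> exp (2 * \<eta>) * ((1 + 1 / \<eta>) * (\<epsilon> * C)\<^sup>2 + (1 + \<eta>) * (t * I)\<^sup>2)"
    by simp
  then have "exp (- y) * (D (Suc n) m v)\<^sup>2 \<le> exp (- y) * (exp (2 * \<eta>) * ((1 + 1 / \<eta>) * (\<epsilon> * C)\<^sup>2 + (1 + \<eta>) * (t * I)\<^sup>2))"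
    by (intro mult_left_mono) auto
  also have "\<dots> = exp (- y) * ((1 + 1 / \<eta>) * (exp (2 * \<eta>) * C\<^sup>2) * \<epsilon>\<^sup>2) + (1 + \<eta>) * exp (2 * \<eta>) * (exp (- y) * (t * I)\<^sup>2)"
    by (simp add: power_mult_distrib algebra_simps)
  also have "\<dots> \<le> 1 * ((1 + 1 / \<eta>) * (exp (2 * \<eta>) * C\<^sup>2) * \<epsilon>\<^sup>2) + (1 + \<eta>) * exp (2 * \<eta>) * (l / exp 1 * K)"
    using y0 \<eta> t nonneg by (intro add_mono mult_right_mono mult_left_mono key) auto
  finally show ?thesis
    by (simp add: y_def K_def p_def x_def d_def mult.assoc del: X.simps)
qed

text \<open>The contraction applies only where the children are already \<eta>-close. The induction
  therefore carries the weighted bound P \<Sum> \<kappa>^j T_j for all nodes at once: at depth n it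
  implies closeness, which licenses the step to n + 1.\<close>

lemma complex_iterate_close_to_real:
  assumes [measurable]: "\<Lambda> \<in> sets borel" and t: "0 \<le> t" "t \<le> l" and \<eta>: "0 < \<eta>"
    and z: "norm (z - of_real t) \<le> \<epsilon>"
    and \<kappa>: "\<kappa> = (1 + \<eta>) * exp (2 * \<eta>) * l / exp 1"
    and Q: "\<And>n m v. (\<Sum>j<n. ennreal (\<kappa> ^ j) * T j m v) \<le> ennreal Q" "0 \<le> Q"
    and \<epsilon>: "exp (l * C) * ((1 + 1 / \<eta>) * (exp (2 * \<eta>) * C\<^sup>2) * \<epsilon>\<^sup>2 * Q) \<le> \<eta>\<^sup>2"
  shows "norm (S z \<Lambda> n m v - of_real (X t \<Lambda> n m v)) \<le> \<eta>"
proof -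
  define D where "D n m v = norm (S z \<Lambda> n m v - of_real (X t \<Lambda> n m v))" for n m v
  define P where "P = (1 + 1 / \<eta>) * (exp (2 * \<eta>) * C\<^sup>2) * \<epsilon>\<^sup>2"
  define F where "F n m v = exp (- X t \<Lambda> n m v) * (D n m v)\<^sup>2" for n m v
  have P0: "0 \<le> P" using \<eta> by (simp add: P_def)
  have l0: "0 \<le> l" using t by simp
  have \<kappa>0: "0 \<le> \<kappa>" using \<eta> l0 by (simp add: \<kappa>)
  \<comment> \<open>Undoes the weight: the real iterate is at most l C, so exp(l C) bounds the loss,
    and the hypothesis on \<epsilon> is made for this factor.\<close>
  have close: "D n m v \<le> \<eta>" if "ennreal (F n m v) \<le> ennreal P * (\<Sum>j<n. ennreal (\<kappa> ^ j) * T j m v)" for n m v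
  proof -
    have "ennreal (F n m v) \<le> ennreal P * ennreal Q"
      by (rule order_trans[OF that]) (intro mult_left_mono Q, simp)
    then have "F n m v \<le> P * Q" using P0 Q(2) by (simp flip: ennreal_mult)
    then have "exp (l * C) * F n m v \<le> \<eta>\<^sup>2"
      by (intro order_trans[OF mult_left_mono \<epsilon>[folded P_def]]) auto
    moreover have "X t \<Lambda> n m v \<le> l * C"
      using X_bounds(2)[OF assms(1) t(1), of n m v] mult_right_mono[OF t(2) C_nonneg] by simp
    then have "(D n m v)\<^sup>2 \<le> exp (l * C) * F n m v"
      using mult_right_mono[of 1 "exp (l * C) * exp (- X t \<Lambda> n m v)" "(D n m v)\<^sup>2"]
      unfolding F_def mult.assoc[symmetric] by (simp flip: exp_add)
    ultimately have "(D n m v)\<^sup>2 \<le> \<eta>\<^sup>2" by linarith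
    then show ?thesis using \<eta> by (simp add: power2_le_iff_abs_le D_def)
  qed
  have "ennreal (F n m v) \<le> ennreal P * (\<Sum>j<n. ennreal (\<kappa> ^ j) * T j m v)" for n m v
  proof (induction n arbitrary: m v)
    case 0
    then show ?case by (simp add: F_def D_def)
  next
    case (Suc n)
    let ?u = "\<lambda>w. v(Suc m := w)"
    have cl: "D n m v \<le> \<eta>" for m v by (rule close[OF Suc])
    have F_nonneg: "0 \<le> F n m v" for m v by (simp add: F_def)
    have F_le: "F n m v \<le> \<eta>\<^sup>2" for m v
    proof -
      have "F n m v \<le> 1 * \<eta>\<^sup>2"
        unfolding F_def using cl[of m v] X_bounds(1)[OF assms(1) t(1), of n m v]
        by (intro mult_mono power_mono) (auto simp: D_def)
      then show ?thesis by simp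
    qed
    have [measurable]: "(\<lambda>w. F n (Suc m) (?u w)) \<in> borel_measurable M"
      unfolding F_def D_def by measurable
    have int: "integrable M (\<lambda>w. wt \<Lambda> m v w * F n (Suc m) (?u w))"
    proof (rule Bochner_Integration.integrable_bound[OF integrable_mult_right[OF integrable_wt[OF assms(1), of m v], of "\<eta>\<^sup>2"] _ AE_I2])
      fix w
      have "wt \<Lambda> m v w * F n (Suc m) (?u w) \<le> wt \<Lambda> m v w * \<eta>\<^sup>2"
        by (intro mult_left_mono F_le) simp
      then show "norm (wt \<Lambda> m v w * F n (Suc m) (?u w)) \<le> norm (\<eta>\<^sup>2 * wt \<Lambda> m v w)"
        by (simp add: abs_mult F_nonneg mult.commute)
    qed measurable
    have "F (Suc n) m v \<le> P + \<kappa> * (LINT w|M. wt \<Lambda> m v w * F n (Suc m) (?u w))"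
      using complex_iterate_contraction[OF assms(1) t \<eta> z, of n m v] cl[of "Suc m"]
      unfolding F_def D_def P_def \<kappa> by auto
    then have "ennreal (F (Suc n) m v) \<le> ennreal P + ennreal \<kappa> * ennreal (LINT w|M. wt \<Lambda> m v w * F n (Suc m) (?u w))"
      using P0 \<kappa>0 F_nonneg by (subst ennreal_mult[symmetric], simp_all flip: ennreal_plus)
    also have "ennreal (LINT w|M. wt \<Lambda> m v w * F n (Suc m) (?u w)) = (\<integral>\<^sup>+ w. ennreal (wt \<Lambda> m v w) * ennreal (F n (Suc m) (?u w)) \<partial>M)"
      using int F_nonneg by (subst nn_integral_eq_integral[symmetric]) (auto simp: ennreal_mult)
    \<comment> \<open>Enlarging \<Lambda> to the whole space turns the weights into those of V_k and
      frees the bound from the volume.\<close>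
    also have "\<dots> \<le> (\<integral>\<^sup>+ w. ennreal (wt UNIV m v w) * (ennreal P * (\<Sum>j<n. ennreal (\<kappa> ^ j) * T j (Suc m) (?u w))) \<partial>M)"
      by (intro nn_integral_mono mult_mono Suc ennreal_leI wt_mono) auto
    also have "\<dots> = (\<integral>\<^sup>+ w. (\<Sum>j<n. ennreal P * ennreal (\<kappa> ^ j) * (ennreal (wt UNIV m v w) * T j (Suc m) (?u w))) \<partial>M)"
      by (simp add: sum_distrib_left mult_ac)
    also have "\<dots> = ennreal P * (\<Sum>j<n. ennreal (\<kappa> ^ j) * T (Suc j) m v)"
      by (simp add: nn_integral_sum nn_integral_cmult sum_distrib_left mult_ac)
    also have "ennreal P + ennreal \<kappa> * \<dots> = ennreal P * (\<Sum>j<Suc n. ennreal (\<kappa> ^ j) * T j m v)"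
      unfolding sum.lessThan_Suc_shift using \<kappa>0
      by (simp add: distrib_left sum_distrib_left ennreal_mult mult_ac)
    finally show ?case
      by (simp add: add_left_mono mult_left_mono)
  qed
  then show ?thesis
    using close unfolding D_def by blast
qed

end

section \<open>Path weights and the connective constant\<close>

text \<open>Fekete's lemma in multiplicative form, without logarithms because terms may vanish. For
  r above the infimum choose m with a m \<le> r^m and write n = q m + s, which gives a n \<le> r^n
  K.\<close>

lemma submultiplicative_root_tendsto:
  fixes a :: "nat \<Rightarrow> real"
  assumes nonneg: "\<And>n. 0 \<le> a n" and submult: "\<And>m n. a (m + n) \<le> a m * a n"
  shows "convergent (\<lambda>n. root n (a n))"
proof -
  define L where "L = (INF n\<in>{1..}. root n (a n))"
  have bdd: "bdd_below ((\<lambda>n. root n (a n)) ` {1..})"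
    by (rule bdd_belowI[of _ 0]) (auto simp: nonneg)
  have L_le: "L \<le> root n (a n)" if "1 \<le> n" for n
    unfolding L_def using bdd that by (intro cINF_lower) auto
  have L0: "0 \<le> L"
    unfolding L_def by (rule cINF_greatest) (auto simp: nonneg)
  have "(\<lambda>n. root n (a n)) \<longlonglongrightarrow> L"
  proof (rule order_tendstoI)
    fix x assume "x < L"
    then show "eventually (\<lambda>n. x < root n (a n)) sequentially"
      using L_le by (intro eventually_sequentiallyI[of 1]) (auto intro: less_le_trans)
  next
    fix x assume "L < x"
    then obtain r where r: "L < r" "r < x" using dense by blast
    then obtain m where m: "1 \<le> m" "root m (a m) < r"
      using cINF_less_iff[OF _ bdd, of r] by (auto simp: L_def)
    have r0: "0 < r" using L0 r by simp
    have am: "a m \<le> r ^ m"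
    proof -
      have "root m (a m) ^ m \<le> r ^ m" using m nonneg by (intro power_mono) auto
      then show ?thesis using m nonneg by simp
    qed
    \<comment> \<open>The sum covers all remainders s < m; the + 1 makes K positive, so that its
      n-th root tends to 1.\<close>
    define K where "K = (\<Sum>s<m. a s / r ^ s) + 1"
    have sum_nonneg: "0 \<le> (\<Sum>s<m. a s / r ^ s)" using r0 nonneg by (intro sum_nonneg) auto
    then have K: "0 < K" by (simp add: K_def)
    have bound: "a (q * m + s) \<le> r ^ (q * m) * a s" for q s
    proof (induction q)
      case (Suc q)
      have "a (Suc q * m + s) \<le> a m * a (q * m + s)"
        using submult[of m "q * m + s"] by (simp add: add.assoc)
      also have "\<dots> \<le> r ^ m * (r ^ (q * m) * a s)"
        using am Suc nonneg r0 by (intro mult_mono) auto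
      finally show ?case by (simp add: power_add mult.assoc)
    qed simp
    have "root n (a n) \<le> r * root n K" if n: "1 \<le> n" for n
    proof -
      define q s where "q = n div m" and "s = n mod m"
      have ns: "n = q * m + s" "s < m" using m by (auto simp: q_def s_def)
      have "a s / r ^ s \<le> (\<Sum>s<m. a s / r ^ s)"
        using ns r0 nonneg by (intro member_le_sum) auto
      then have "a s \<le> r ^ s * K" using r0 by (simp add: K_def field_simps add_increasing)
      then have "r ^ (q * m) * a s \<le> r ^ (q * m) * (r ^ s * K)"
        using r0 by (intro mult_left_mono) auto
      with bound[of q s] have "a n \<le> r ^ n * K"
        unfolding ns(1) by (simp add: power_add mult.assoc)
      then have "root n (a n) \<le> root n (r ^ n * K)" using n by simp
      also have "\<dots> = r * root n K" using n r0 by (simp add: real_root_mult real_root_power_cancel)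
      finally show ?thesis .
    qed
    then have ev: "eventually (\<lambda>n. root n (a n) \<le> r * root n K) sequentially"
      by (rule eventually_sequentiallyI)
    have "(\<lambda>n. r * root n K) \<longlonglongrightarrow> r * 1"
      by (intro tendsto_mult tendsto_const LIMSEQ_root_const K)
    then have "eventually (\<lambda>n. r * root n K < x) sequentially"
      using r by (auto dest: order_tendstoD)
    with ev show "eventually (\<lambda>n. root n (a n) < x) sequentially"
      by eventually_elim simp
  qed
  then show ?thesis by (auto simp: convergent_def)
qed

context repulsive_gas
begin

lemma hist_add: "hist (m + k) v x = hist m v x * hist k (\<lambda>i. v (m + i)) x"
  by (induction k) (simp_all add: hist_def)

text \<open>Forgetting the first m vertices drops factors at most 1 from \<open>hist\<close>. This
  is the source of submultiplicativity: the last steps of a path weigh no more than a path started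
  afresh.\<close>

lemma T_shift: "T n (m + k) v \<le> T n k (\<lambda>i. v (m + i))"
proof (induction n arbitrary: k v)
  case (Suc n)
  have "T n (Suc (m + k)) (v(Suc (m + k) := w)) \<le> T n (Suc k) ((\<lambda>i. v (m + i))(Suc k := w))" for w
  proof -
    have "(\<lambda>i. (v(Suc (m + k) := w)) (m + i)) = (\<lambda>i. v (m + i))(Suc k := w)"
      by (auto simp: fun_eq_iff)
    then show ?thesis using Suc[of "Suc k" "v(Suc (m + k) := w)"] by (simp only: add_Suc_right)
  qed
  moreover have "wt UNIV (m + k) v w \<le> wt UNIV k (\<lambda>i. v (m + i)) w" for w
    unfolding wt_def hist_add by (intro mult_right_mono) (auto intro!: mult_left_le_one_le)
  ultimately show ?case
    unfolding T.simps by (intro nn_integral_mono mult_mono ennreal_leI) auto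
qed simp

text \<open>This is V_n of the theorem, given through iterated integrals because the recursion
  produces that form; \<open>V_eq_path_integral\<close> makes the connection.\<close>

definition V :: "nat \<Rightarrow> ennreal" where
  "V n = (SUP v. T n 0 v)"

lemma T_le_V: "T n m v \<le> V n"
  using T_shift[of n m 0 v] unfolding V_def by (auto intro: order_trans SUP_upper)

lemma T_add_le: "T (j + k) m v \<le> T j m v * V k"
proof (induction j arbitrary: m v)
  case (Suc j)
  have "T (Suc j + k) m v \<le> (\<integral>\<^sup>+ w. ennreal (wt UNIV m v w) * T j (Suc m) (v(Suc m := w)) * V k \<partial>M)"
    unfolding add_Suc T.simps mult.assoc by (intro nn_integral_mono mult_left_mono Suc) auto
  also have "\<dots> = T (Suc j) m v * V k"
    by (simp add: nn_integral_multc)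
  finally show ?case .
qed (simp add: T_le_V)

lemma V_add_le: "V (j + k) \<le> V j * V k"
  unfolding V_def[of "j + k"]
  by (intro SUP_least order_trans[OF T_add_le] mult_right_mono T_le_V) simp

lemma V_le_power: "V n \<le> ennreal (C ^ n)"
proof -
  have "T n m v \<le> ennreal (C ^ n)" for m v
  proof (induction n arbitrary: m v)
    case (Suc n)
    have "T (Suc n) m v \<le> (\<integral>\<^sup>+ w. ennreal (wt UNIV m v w) * ennreal (C ^ n) \<partial>M)"
      unfolding T.simps by (intro nn_integral_mono mult_left_mono Suc) auto
    also have "\<dots> = (\<integral>\<^sup>+ w. ennreal (wt UNIV m v w) \<partial>M) * ennreal (C ^ n)"
      by (rule nn_integral_multc) simp
    also have "\<dots> \<le> ennreal C * ennreal (C ^ n)"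
      by (intro mult_right_mono nn_integral_wt_le) simp
    finally show ?case using C_nonneg by (simp add: ennreal_mult)
  qed simp
  then show ?thesis unfolding V_def by (intro SUP_least)
qed

lemma ennreal_V: "ennreal (enn2real (V n)) = V n"
  using V_le_power[of n] by (intro ennreal_enn2real) (auto simp: less_top[symmetric] top_unique intro: le_less_trans)

lemma convergent_root_V: "convergent (\<lambda>n. root n (enn2real (V n)))"
proof (rule submultiplicative_root_tendsto)
  fix m n
  have "ennreal (enn2real (V (m + n))) \<le> ennreal (enn2real (V m) * enn2real (V n))"
    using V_add_le[of m n] by (simp add: ennreal_mult ennreal_V)
  then show "enn2real (V (m + n)) \<le> enn2real (V m) * enn2real (V n)"
    by (subst (asm) ennreal_le_iff) auto
qed simp

text \<open>Root test with limit \<kappa> \<Delta> < 1. The bound is uniform over depth and path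
  because \<open>T_le_V\<close> is.\<close>

lemma weighted_sum_T_bounded:
  assumes lim: "(\<lambda>n. root n (enn2real (V n))) \<longlonglongrightarrow> \<Delta>" and \<kappa>: "0 \<le> \<kappa>" "\<kappa> * \<Delta> < 1"
  obtains Q where "0 \<le> Q" "\<And>n m v. (\<Sum>j<n. ennreal (\<kappa> ^ j) * T j m v) \<le> ennreal Q"
proof -
  have "summable (\<lambda>n. \<kappa> ^ n * enn2real (V n))"
  proof (rule root_test_convergence)
    have "(\<lambda>n. \<kappa> * root n (enn2real (V n))) \<longlonglongrightarrow> \<kappa> * \<Delta>"
      by (intro tendsto_mult tendsto_const lim)
    moreover have "eventually (\<lambda>n. \<kappa> * root n (enn2real (V n)) = root n (norm (\<kappa> ^ n * enn2real (V n)))) sequentially"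
      using \<kappa> by (intro eventually_sequentiallyI[of 1]) (simp add: real_root_mult real_root_power_cancel)
    ultimately show "(\<lambda>n. root n (norm (\<kappa> ^ n * enn2real (V n)))) \<longlonglongrightarrow> \<kappa> * \<Delta>"
      by (rule Lim_transform_eventually)
  qed (fact \<kappa>)
  then have sum_le: "(\<Sum>j<n. \<kappa> ^ j * enn2real (V j)) \<le> (\<Sum>j. \<kappa> ^ j * enn2real (V j))" for n
    using \<kappa> by (intro sum_le_suminf) auto
  have "(\<Sum>j<n. ennreal (\<kappa> ^ j) * T j m v) \<le> ennreal (\<Sum>j. \<kappa> ^ j * enn2real (V j))" for n m v
  proof -
    have "(\<Sum>j<n. ennreal (\<kappa> ^ j) * T j m v) \<le> (\<Sum>j<n. ennreal (\<kappa> ^ j) * V j)"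
      by (intro sum_mono mult_left_mono T_le_V) simp
    also have "\<dots> = ennreal (\<Sum>j<n. \<kappa> ^ j * enn2real (V j))"
      using \<kappa> by (simp add: ennreal_mult ennreal_V flip: sum_ennreal)
    also have "\<dots> \<le> ennreal (\<Sum>j. \<kappa> ^ j * enn2real (V j))"
      by (intro ennreal_leI sum_le)
    finally show ?thesis .
  qed
  moreover have "0 \<le> (\<Sum>j. \<kappa> ^ j * enn2real (V j))"
    using sum_le[of 0] by simp
  ultimately show ?thesis using that by blast
qed

section \<open>Exact log ratios at the nodes of the recursion tree\<close>

definition activity :: "real \<Rightarrow> 'a set \<Rightarrow> nat \<Rightarrow> (nat \<Rightarrow> 'a) \<Rightarrow> 'a \<Rightarrow> ennreal" where
  "activity t \<Lambda> m v x = ennreal t * indicator \<Lambda> x * ennreal (hist m v x)"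

text \<open>The quantity s(g, v) of the overview at the node v: the exact solution that
  \<open>X\<close> approximates.\<close>

definition log_ratio :: "real \<Rightarrow> 'a set \<Rightarrow> nat \<Rightarrow> (nat \<Rightarrow> 'a) \<Rightarrow> real" where
  "log_ratio t \<Lambda> m v = ln (zeta (activity t \<Lambda> m v)) - ln (zeta (\<lambda>x. activity t \<Lambda> m v x * E (v m) x))"

lemma activity_measurable [measurable (raw)]:
  assumes [measurable]: "f \<in> N \<rightarrow>\<^sub>M Pi\<^sub>M UNIV (\<lambda>_::nat. borel)" "g \<in> N \<rightarrow>\<^sub>M borel" "\<Lambda> \<in> sets borel"
  shows "(\<lambda>p. activity t \<Lambda> m (f p) (g p)) \<in> borel_measurable N"
  unfolding activity_def by measurable

lemma log_ratio_measurable [measurable (raw)]: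
  assumes [measurable]: "f \<in> N \<rightarrow>\<^sub>M Pi\<^sub>M UNIV (\<lambda>_::nat. borel)" "\<Lambda> \<in> sets borel"
  shows "(\<lambda>p. log_ratio t \<Lambda> m (f p)) \<in> borel_measurable N"
proof -
  note [measurable] = measurable_component_borel[OF assms(1)]
  show ?thesis
    unfolding log_ratio_def by measurable
qed

lemma nn_integral_activity_le:
  assumes [measurable]: "\<Lambda> \<in> sets borel" and fin: "emeasure M \<Lambda> < \<infinity>" and t: "0 \<le> t"
  shows "(\<integral>\<^sup>+ x. activity t \<Lambda> m v x \<partial>M) \<le> ennreal (t * measure M \<Lambda>)"
proof -
  have "activity t \<Lambda> m v x \<le> ennreal t * indicator \<Lambda> x" for x
    unfolding activity_def using mult_left_mono[of "ennreal (hist m v x)" 1 "ennreal t * indicator \<Lambda> x"]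
    by (simp add: ennreal_le_1)
  then have "(\<integral>\<^sup>+ x. activity t \<Lambda> m v x \<partial>M) \<le> (\<integral>\<^sup>+ x. ennreal t * indicator \<Lambda> x \<partial>M)"
    by (intro nn_integral_mono)
  also have "\<dots> = ennreal (t * measure M \<Lambda>)"
    using fin t by (simp add: nn_integral_cmult_indicator emeasure_eq_ennreal_measure less_top ennreal_mult)
  finally show ?thesis .
qed

text \<open>Branching from the last vertex towards w amounts to appending w to the path. Hence path
  activities are closed under the recursion, and \<open>hist\<close> records all that has to be
  remembered.\<close>

lemma branch_activity:
  "branch (activity t \<Lambda> m v) (v m) w = activity t \<Lambda> (Suc m) (v(Suc m := w))"
  by (auto simp: fun_eq_iff branch_def activity_def hist_upd ennreal_mult mult.assoc)

context
  fixes t :: real and \<Lambda> :: "'a set"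
  assumes \<Lambda>[measurable]: "\<Lambda> \<in> sets borel" and fin: "emeasure M \<Lambda> < \<infinity>" and t: "0 \<le> t"
begin

lemma activity_integral_finite: "(\<integral>\<^sup>+ x. activity t \<Lambda> m v x \<partial>M) < \<infinity>"
  using nn_integral_activity_le[OF \<Lambda> fin t, of m v] by (rule le_less_trans) simp

lemma density_ratio_activity:
  "density_ratio (activity t \<Lambda> m v) (v m) = exp (- log_ratio t \<Lambda> m v)"
proof -
  have "0 < zeta (activity t \<Lambda> m v)"
    using zeta_ge_1[OF _ activity_integral_finite, of m v] by simp
  moreover have "0 < zeta (\<lambda>x. activity t \<Lambda> m v x * E (v m) x)"
  proof -
    have "(\<integral>\<^sup>+ x. activity t \<Lambda> m v x * E (v m) x \<partial>M) < \<infinity>"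
      by (rule le_less_trans[OF nn_integral_mono activity_integral_finite[of m v]]) simp
    then show ?thesis using zeta_ge_1[of "\<lambda>x. activity t \<Lambda> m v x * E (v m) x"] by simp
  qed
  ultimately show ?thesis
    by (simp add: density_ratio_def log_ratio_def exp_diff)
qed

lemma log_ratio_nonneg: "0 \<le> log_ratio t \<Lambda> m v"
  using density_ratio_bounds(2)[OF _ activity_integral_finite, of m v "v m"]
  by (simp add: density_ratio_activity)

lemma log_ratio_recursion:
  "log_ratio t \<Lambda> m v = t * (LINT w|M. wt \<Lambda> m v w * exp (- log_ratio t \<Lambda> (Suc m) (v(Suc m := w))))"
proof -
  have "log_ratio t \<Lambda> m v = enn2real (\<integral>\<^sup>+ w. activity t \<Lambda> m v w * ennreal (1 - e (v m) w) *
      ennreal (density_ratio (branch (activity t \<Lambda> m v) (v m) w) w) \<partial>M)"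
    unfolding log_ratio_def using t
    by (intro ln_zeta_recursion[where G = "t * measure M \<Lambda>"] nn_integral_activity_le fin) auto
  also have "\<dots> = enn2real (\<integral>\<^sup>+ w. ennreal (t * (wt \<Lambda> m v w * exp (- log_ratio t \<Lambda> (Suc m) (v(Suc m := w))))) \<partial>M)"
  proof (intro arg_cong[where f = enn2real] nn_integral_cong)
    fix w
    have "density_ratio (branch (activity t \<Lambda> m v) (v m) w) w = exp (- log_ratio t \<Lambda> (Suc m) (v(Suc m := w)))"
      using density_ratio_activity[of "Suc m" "v(Suc m := w)"] by (simp add: branch_activity)
    then show "activity t \<Lambda> m v w * ennreal (1 - e (v m) w) *
      ennreal (density_ratio (branch (activity t \<Lambda> m v) (v m) w) w) =
      ennreal (t * (wt \<Lambda> m v w * exp (- log_ratio t \<Lambda> (Suc m) (v(Suc m := w)))))"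
      using t by (auto simp: activity_def wt_def ennreal_mult mult.assoc indicator_def)
  qed
  also have "\<dots> = (LINT w|M. t * (wt \<Lambda> m v w * exp (- log_ratio t \<Lambda> (Suc m) (v(Suc m := w)))))"
    using t by (intro integral_eq_nn_integral[symmetric]) auto
  finally show ?thesis by simp
qed

lemma integrable_wt_exp_log_ratio:
  "integrable M (\<lambda>w. wt \<Lambda> m v w * exp (- log_ratio t \<Lambda> (Suc m) (v(Suc m := w))))"
proof (rule Bochner_Integration.integrable_bound[OF integrable_wt[OF \<Lambda>] _ AE_I2])
  fix w
  show "norm (wt \<Lambda> m v w * exp (- log_ratio t \<Lambda> (Suc m) (v(Suc m := w)))) \<le> norm (wt \<Lambda> m v w)"
    using log_ratio_nonneg[of "Suc m" "v(Suc m := w)"] by (simp add: abs_mult mult_left_le)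
qed measurable

text \<open>The map a \<mapsto> exp(-a) is 1-Lipschitz on [0, \<infinity>) and the weights have mass
  at most C, so each step gains a factor t C. The first factor comes from 0 \<le>
  \<open>log_ratio\<close> \<le> t C. The bound tends to 0 when t C < 1, which is enough to identify
  limits near 0.\<close>

lemma X_close_log_ratio: "\<bar>X t \<Lambda> n m v - log_ratio t \<Lambda> m v\<bar> \<le> (t * C) ^ Suc n"
proof (induction n arbitrary: m v)
  case 0
  have "(LINT w|M. wt \<Lambda> m v w * exp (- log_ratio t \<Lambda> (Suc m) (v(Suc m := w)))) \<le> (LINT w|M. wt \<Lambda> m v w)"
    using log_ratio_nonneg by (intro Bochner_Integration.integral_mono integrable_wt_exp_log_ratio integrable_wt mult_left_le) auto
  also have "\<dots> \<le> C" by (rule integral_wt_le) simp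
  finally have "log_ratio t \<Lambda> m v \<le> t * C"
    unfolding log_ratio_recursion[of m v] using t by (rule mult_left_mono)
  then show ?case using log_ratio_nonneg[of m v] by simp
next
  case (Suc n)
  let ?x = "\<lambda>w. X t \<Lambda> n (Suc m) (v(Suc m := w))" and ?y = "\<lambda>w. log_ratio t \<Lambda> (Suc m) (v(Suc m := w))"
  have lip: "\<bar>exp (- a) - exp (- b)\<bar> \<le> \<bar>a - b\<bar>" if "0 \<le> a" "0 \<le> b" for a b :: real
  proof -
    have *: "exp (- a) - exp (- b) \<le> b - a" if "0 \<le> a" "a \<le> b" for a b :: real
    proof -
      have "exp (- a) - exp (- b) = exp (- a) * (1 - exp (a - b))"
        by (simp add: right_diff_distrib flip: exp_add)
      also have "\<dots> \<le> 1 * (b - a)"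
      proof (intro mult_mono)
        have "1 + (a - b) \<le> exp (a - b)" by (rule exp_ge_add_one_self)
        then show "1 - exp (a - b) \<le> b - a" by linarith
      qed (use that in auto)
      finally show ?thesis by simp
    qed
    show ?thesis
      using *[of a b] *[of b a] that by (cases "a \<le> b") (auto simp: abs_if)
  qed
  have "X t \<Lambda> (Suc n) m v - log_ratio t \<Lambda> m v = t * ((LINT w|M. wt \<Lambda> m v w * exp (- ?x w)) - (LINT w|M. wt \<Lambda> m v w * exp (- ?y w)))"
    by (subst log_ratio_recursion) (simp add: right_diff_distrib)
  also have "\<dots> = t * (LINT w|M. wt \<Lambda> m v w * (exp (- ?x w) - exp (- ?y w)))"
    using integrable_wt_exp_X[OF \<Lambda> t, of m v n] integrable_wt_exp_log_ratio[of m v]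
    by (simp add: right_diff_distrib)
  finally have eq: "\<bar>X t \<Lambda> (Suc n) m v - log_ratio t \<Lambda> m v\<bar> = t * \<bar>LINT w|M. wt \<Lambda> m v w * (exp (- ?x w) - exp (- ?y w))\<bar>"
    using t by (simp add: abs_mult)
  have "norm (LINT w|M. wt \<Lambda> m v w * (exp (- ?x w) - exp (- ?y w))) \<le> (LINT w|M. wt \<Lambda> m v w * (t * C) ^ Suc n)"
  proof (rule norm_integral_le)
    show "integrable M (\<lambda>w. wt \<Lambda> m v w * (exp (- ?x w) - exp (- ?y w)))"
      using integrable_wt_exp_X[OF \<Lambda> t, of m v n] integrable_wt_exp_log_ratio[of m v]
      by (simp add: right_diff_distrib)
    show "integrable M (\<lambda>w. wt \<Lambda> m v w * (t * C) ^ Suc n)"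
      by (intro integrable_mult_left integrable_wt) simp
    fix w
    show "norm (wt \<Lambda> m v w * (exp (- ?x w) - exp (- ?y w))) \<le> wt \<Lambda> m v w * (t * C) ^ Suc n"
      using order_trans[OF lip Suc] X_bounds(1)[OF \<Lambda> t] log_ratio_nonneg
      by (auto simp: abs_mult intro!: mult_left_mono)
  qed
  also have "\<dots> \<le> C * (t * C) ^ Suc n"
    using integral_wt_le[OF \<Lambda>, of m v] t C_nonneg by (simp add: mult_right_mono)
  finally show ?case
    unfolding eq using t by (auto simp: mult.assoc intro!: mult_left_mono)
qed

end

end

section \<open>Analyticity in the fugacity\<close>

text \<open>Dominated convergence for difference quotients. Cauchy's inequality turns the bound on f
  into a bound B / r on its derivative and hence on the quotients, so no hypothesis on derivatives
  is made.\<close>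

lemma holomorphic_on_integral:
  fixes f :: "complex \<Rightarrow> 'b \<Rightarrow> complex"
  assumes D: "open D" and hol: "\<And>w. (\<lambda>z. f z w) holomorphic_on D"
    and meas: "\<And>z. z \<in> D \<Longrightarrow> f z \<in> borel_measurable M"
    and B: "integrable M B" "\<And>z w. z \<in> D \<Longrightarrow> norm (f z w) \<le> B w"
  shows "(\<lambda>z. LINT w|M. f z w) holomorphic_on D"
proof (rule holomorphic_onI)
  fix z0 assume "z0 \<in> D"
  obtain R where R: "0 < R" "cball z0 R \<subseteq> D"
    using open_contains_cball D \<open>z0 \<in> D\<close> by blast
  \<comment> \<open>Half the radius, so that discs of radius r around points of
    \<open>ball z0 r\<close> stay inside D.\<close>
  define r where "r = R / 2"
  have r: "0 < r" "cball z0 (2 * r) \<subseteq> D" using R by (auto simp: r_def)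
  have sub: "cball \<zeta> r \<subseteq> D" if "\<zeta> \<in> ball z0 r" for \<zeta>
  proof -
    have "cball \<zeta> r \<subseteq> cball z0 (2 * r)"
      using that dist_triangle[of z0 _ \<zeta>] by (auto simp: subset_eq) (smt (verit))
    then show ?thesis using r by blast
  qed
  have ball_D: "\<zeta> \<in> D" if "\<zeta> \<in> ball z0 r" for \<zeta>
    using subsetD[OF sub[OF that], of \<zeta>] r by simp
  have int: "integrable M (f z)" if "z \<in> D" for z
    by (rule Bochner_Integration.integrable_bound[OF B(1) meas[OF that] AE_I2])
       (simp add: order_trans[OF B(2)[OF that] abs_ge_self])
  define f' where "f' w = deriv (\<lambda>z. f z w) z0" for w
  have diff: "((\<lambda>z. f z w) has_field_derivative deriv (\<lambda>z. f z w) \<zeta>) (at \<zeta>)" if "\<zeta> \<in> D" for \<zeta> w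
    using hol D that by (intro holomorphic_derivI)
  have deriv_le: "norm (deriv (\<lambda>z. f z w) \<zeta>) \<le> B w / r" if "\<zeta> \<in> ball z0 r" for \<zeta> w
  proof -
    have "norm ((deriv ^^ 1) (\<lambda>z. f z w) \<zeta>) \<le> fact 1 * B w / r ^ 1"
    proof (rule Cauchy_inequality)
      show "(\<lambda>z. f z w) holomorphic_on ball \<zeta> r"
        by (rule holomorphic_on_subset[OF hol order_trans[OF ball_subset_cball sub[OF that]]])
      show "continuous_on (cball \<zeta> r) (\<lambda>z. f z w)"
        by (rule holomorphic_on_imp_continuous_on[OF holomorphic_on_subset[OF hol sub[OF that]]])
      fix x assume "norm (\<zeta> - x) = r"
      then have "x \<in> D" using sub[OF that] by (auto simp: subset_eq dist_norm)
      then show "norm (f x w) \<le> B w" by (rule B)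
    qed (use r in auto)
    then show ?thesis by simp
  qed
  have quot: "norm ((f z w - f z0 w) / (z - z0)) \<le> B w / r" if "z \<in> ball z0 r" "z \<noteq> z0" for z w
  proof -
    have "norm (f z w - f z0 w) \<le> B w / r * norm (z - z0)"
    proof (rule field_differentiable_bound[where S = "ball z0 r" and f = "\<lambda>z. f z w" and f' = "deriv (\<lambda>z. f z w)"])
      fix \<zeta> assume "\<zeta> \<in> ball z0 r"
      then show "((\<lambda>z. f z w) has_field_derivative deriv (\<lambda>z. f z w) \<zeta>) (at \<zeta> within ball z0 r)"
        by (rule has_field_derivative_at_within[OF diff[OF ball_D]])
      show "norm (deriv (\<lambda>z. f z w) \<zeta>) \<le> B w / r" if "\<zeta> \<in> ball z0 r" for \<zeta>
        by (rule deriv_le[OF that])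
    qed (use that(1) r(1) in simp_all)
    then show ?thesis using that(2) by (simp add: norm_divide divide_le_eq)
  qed
  have "((\<lambda>z. ((LINT w|M. f z w) - (LINT w|M. f z0 w)) / (z - z0)) \<longlongrightarrow> (LINT w|M. f' w)) (at z0 within ball z0 r)"
    unfolding tendsto_at_iff_sequentially comp_def
  proof (intro allI impI)
    fix X assume X: "\<forall>i. X i \<in> ball z0 r - {z0}" and lim: "X \<longlonglongrightarrow> z0"
    have XD: "X i \<in> D" for i using X by (intro ball_D) auto
    have lim_f: "(\<lambda>i. (f (X i) w - f z0 w) / (X i - z0)) \<longlonglongrightarrow> f' w" for w
    proof -
      have "((\<lambda>z. (f z w - f z0 w) / (z - z0)) \<longlongrightarrow> f' w) (at z0)"
        using diff[OF \<open>z0 \<in> D\<close>, of w] by (simp add: f'_def has_field_derivative_iff)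
      then show ?thesis
        using X lim unfolding tendsto_at_iff_sequentially comp_def by auto
    qed
    have [measurable]: "f (X i) \<in> borel_measurable M" "f z0 \<in> borel_measurable M" for i
      using meas XD \<open>z0 \<in> D\<close> by auto
    have q_meas: "(\<lambda>w. (f (X i) w - f z0 w) / (X i - z0)) \<in> borel_measurable M" for i
      by measurable
    have "(\<lambda>i. LINT w|M. (f (X i) w - f z0 w) / (X i - z0)) \<longlonglongrightarrow> (LINT w|M. f' w)"
    proof (rule integral_dominated_convergence)
      show "f' \<in> borel_measurable M"
        by (rule borel_measurable_LIMSEQ_metric[OF q_meas lim_f])
      show "integrable M (\<lambda>w. B w / r)" using B by simp
      show "AE w in M. (\<lambda>i. (f (X i) w - f z0 w) / (X i - z0)) \<longlonglongrightarrow> f' w"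
        using lim_f by simp
      show "AE w in M. norm ((f (X i) w - f z0 w) / (X i - z0)) \<le> B w / r" for i
        using X quot by simp
    qed (rule q_meas)
    then show "(\<lambda>i. ((LINT w|M. f (X i) w) - (LINT w|M. f z0 w)) / (X i - z0)) \<longlonglongrightarrow> (LINT w|M. f' w)"
      using int XD \<open>z0 \<in> D\<close> by simp
  qed
  then have "((\<lambda>z. LINT w|M. f z w) has_field_derivative (LINT w|M. f' w)) (at z0)"
    using r by (simp add: has_field_derivative_iff at_within_open[of z0 "ball z0 r"])
  then show "(\<lambda>z. LINT w|M. f z w) field_differentiable at z0 within D"
    unfolding field_differentiable_def by (intro exI) (rule has_field_derivative_at_within)
qed

context repulsive_gas
begin

lemma norm_exp_minus_S_le:
  assumes "\<Lambda> \<in> sets borel" "norm z \<le> R"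
  shows "norm (exp (- S z \<Lambda> n m v)) \<le> exp (S_bound R n)"
  using norm_S_le[OF assms, of n m v] by (intro order_trans[OF norm_exp]) simp

lemma S_holomorphic:
  assumes [measurable]: "\<Lambda> \<in> sets borel"
  shows "(\<lambda>z. S z \<Lambda> n m v) holomorphic_on ball 0 R"
proof (induction n arbitrary: m v)
  case (Suc n)
  have "(\<lambda>z. LINT w|M. of_real (wt \<Lambda> m v w) * exp (- S z \<Lambda> n (Suc m) (v(Suc m := w)))) holomorphic_on ball 0 R"
  proof (rule holomorphic_on_integral[where B = "\<lambda>w. exp (S_bound R n) * wt \<Lambda> m v w"])
    show "(\<lambda>z. of_real (wt \<Lambda> m v w) * exp (- S z \<Lambda> n (Suc m) (v(Suc m := w)))) holomorphic_on ball 0 R" for w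
      by (intro holomorphic_intros Suc)
    show "integrable M (\<lambda>w. exp (S_bound R n) * wt \<Lambda> m v w)"
      by (intro integrable_mult_right integrable_wt) simp
    fix z w assume "z \<in> ball (0 :: complex) R"
    then have "norm (exp (- S z \<Lambda> n (Suc m) (v(Suc m := w)))) \<le> exp (S_bound R n)"
      by (intro norm_exp_minus_S_le) auto
    then show "norm (of_real (wt \<Lambda> m v w) * exp (- S z \<Lambda> n (Suc m) (v(Suc m := w)))) \<le> exp (S_bound R n) * wt \<Lambda> m v w"
      by (subst mult.commute) (simp add: norm_mult mult_right_mono del: norm_exp_eq_Re)
  qed auto
  then show ?case by (auto intro!: holomorphic_intros)
qed simp

lemma S_of_real:
  assumes [measurable]: "\<Lambda> \<in> sets borel"
  shows "S (of_real t) \<Lambda> n m v = of_real (X t \<Lambda> n m v)"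
proof (induction n arbitrary: m v)
  case (Suc n)
  have eq: "of_real (wt \<Lambda> m v w) * exp (- S (of_real t) \<Lambda> n (Suc m) (v(Suc m := w))) =
      complex_of_real (wt \<Lambda> m v w * exp (- X t \<Lambda> n (Suc m) (v(Suc m := w))))" for w
    by (simp only: Suc of_real_mult flip: of_real_minus exp_of_real)
  show ?case
    unfolding S.simps X.simps eq integral_complex_of_real by simp
qed simp

text \<open>The approximation of depth n to the logarithmic derivative of Z; compare
  \<open>ln_zeta_derivative_log_ratio\<close>. The constant sequence encodes the path with the
  single vertex w.\<close>

definition density_approx :: "'a set \<Rightarrow> nat \<Rightarrow> complex \<Rightarrow> complex" where
  "density_approx \<Lambda> n z = (LINT w|M. of_real (indicator \<Lambda> w) * exp (- S z \<Lambda> n 0 (\<lambda>_. w)))"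

lemma path_const_measurable: "(\<lambda>w _. w) \<in> M \<rightarrow>\<^sub>M Pi\<^sub>M UNIV (\<lambda>_::nat. borel :: 'a measure)"
  by (rule measurable_PiM_single') (auto intro: measurable_ident_sets)

declare S_measurable [measurable del] X_measurable [measurable del] log_ratio_measurable [measurable del]

lemma root_measurable [measurable]:
  assumes "\<Lambda> \<in> sets borel"
  shows "(\<lambda>w. S z \<Lambda> n 0 (\<lambda>_. w)) \<in> borel_measurable M"
    and "(\<lambda>w. X t \<Lambda> n 0 (\<lambda>_. w)) \<in> borel_measurable M"
    and "(\<lambda>w. log_ratio t \<Lambda> 0 (\<lambda>_. w)) \<in> borel_measurable M"
  by (rule S_measurable[OF path_const_measurable assms] X_measurable[OF path_const_measurable assms]
      log_ratio_measurable[OF path_const_measurable assms])+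

lemma integrable_indicator_real:
  assumes "\<Lambda> \<in> sets borel" "emeasure M \<Lambda> < \<infinity>"
  shows "integrable M (indicator \<Lambda> :: 'a \<Rightarrow> real)"
  using assms by (intro integrable_real_indicator) auto

lemma density_approx_holomorphic:
  assumes [measurable]: "\<Lambda> \<in> sets borel" and fin: "emeasure M \<Lambda> < \<infinity>"
  shows "density_approx \<Lambda> n holomorphic_on ball 0 R"
proof -
  have "(\<lambda>z. LINT w|M. of_real (indicator \<Lambda> w) * exp (- S z \<Lambda> n 0 (\<lambda>_. w))) holomorphic_on ball 0 R"
  proof (rule holomorphic_on_integral[where B = "\<lambda>w. exp (S_bound R n) * indicator \<Lambda> w"])
    show "(\<lambda>z. of_real (indicator \<Lambda> w) * exp (- S z \<Lambda> n 0 (\<lambda>_. w))) holomorphic_on ball 0 R" for w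
      by (intro holomorphic_intros S_holomorphic) simp
    show "integrable M (\<lambda>w. exp (S_bound R n) * indicator \<Lambda> w)"
      using fin by (intro integrable_mult_right integrable_indicator_real) auto
    fix z w assume "z \<in> ball (0 :: complex) R"
    then have "norm (exp (- S z \<Lambda> n 0 (\<lambda>_. w))) \<le> exp (S_bound R n)"
      by (intro norm_exp_minus_S_le) auto
    then show "norm (of_real (indicator \<Lambda> w) * exp (- S z \<Lambda> n 0 (\<lambda>_. w))) \<le> exp (S_bound R n) * indicator \<Lambda> w"
      by (auto simp: indicator_def simp del: norm_exp_eq_Re)
  qed auto
  then show ?thesis by (simp add: density_approx_def[abs_def])
qed

text \<open>Only the real part of S matters: X \<ge> 0 gives Re S \<ge> -\<eta> and so |exp(-S)|
  \<le> exp(\<eta>), whatever n is.\<close>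

lemma density_approx_bound:
  assumes [measurable]: "\<Lambda> \<in> sets borel" and fin: "emeasure M \<Lambda> < \<infinity>"
    and t: "0 \<le> t" and close: "\<And>v. norm (S z \<Lambda> n 0 v - of_real (X t \<Lambda> n 0 v)) \<le> \<eta>"
  shows "norm (density_approx \<Lambda> n z) \<le> exp \<eta> * measure M \<Lambda>"
proof -
  have le: "norm (of_real (indicator \<Lambda> w) * exp (- S z \<Lambda> n 0 (\<lambda>_. w))) \<le> exp \<eta> * indicator \<Lambda> w" for w
  proof -
    let ?s = "S z \<Lambda> n 0 (\<lambda>_. w)" and ?x = "X t \<Lambda> n 0 (\<lambda>_. w)"
    have "Re (- ?s) \<le> Re (- (?s - of_real ?x))"
      using X_bounds(1)[OF assms(1) t] by simp
    also have "\<dots> \<le> \<eta>"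
      using complex_Re_le_cmod[of "- (?s - of_real ?x)"] close[of "\<lambda>_. w"] by (simp only: norm_minus_cancel)
    finally show ?thesis by (auto simp: indicator_def)
  qed
  have int: "integrable M (\<lambda>w. exp \<eta> * indicator \<Lambda> w)"
    using fin by (intro integrable_mult_right integrable_indicator_real) auto
  have "norm (density_approx \<Lambda> n z) \<le> (LINT w|M. exp \<eta> * indicator \<Lambda> w)"
    unfolding density_approx_def
  proof (rule norm_integral_le[OF _ int le])
    show "integrable M (\<lambda>w. of_real (indicator \<Lambda> w) * exp (- S z \<Lambda> n 0 (\<lambda>_. w)))"
    proof (rule Bochner_Integration.integrable_bound[OF int _ AE_I2])
      show "norm (of_real (indicator \<Lambda> w) * exp (- S z \<Lambda> n 0 (\<lambda>_. w))) \<le> norm (exp \<eta> * indicator \<Lambda> w)" for w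
        by (rule order_trans[OF le]) simp
    qed measurable
  qed
  also have "\<dots> = exp \<eta> * measure M \<Lambda>" by simp
  finally show ?thesis .
qed

lemma density_approx_tendsto:
  assumes \<Lambda>[measurable]: "\<Lambda> \<in> sets borel" and fin: "emeasure M \<Lambda> < \<infinity>"
    and t: "0 \<le> t" "t * C < 1"
  shows "(\<lambda>n. density_approx \<Lambda> n (of_real t)) \<longlonglongrightarrow>
     of_real (LINT w|M. indicator \<Lambda> w * exp (- log_ratio t \<Lambda> 0 (\<lambda>_. w)))"
proof -
  have eq: "density_approx \<Lambda> n (of_real t) = of_real (LINT w|M. indicator \<Lambda> w * exp (- X t \<Lambda> n 0 (\<lambda>_. w)))" for n
  proof -
    have eq: "of_real (indicator \<Lambda> w) * exp (- S (of_real t) \<Lambda> n 0 (\<lambda>_. w)) =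
      complex_of_real (indicator \<Lambda> w * exp (- X t \<Lambda> n 0 (\<lambda>_. w)))" for w
      by (simp only: S_of_real[OF \<Lambda>] of_real_mult flip: of_real_minus exp_of_real)
    show ?thesis unfolding density_approx_def eq integral_complex_of_real ..
  qed
  have "(\<lambda>n. LINT w|M. indicator \<Lambda> w * exp (- X t \<Lambda> n 0 (\<lambda>_. w))) \<longlonglongrightarrow>
     (LINT w|M. indicator \<Lambda> w * exp (- log_ratio t \<Lambda> 0 (\<lambda>_. w)))"
  proof (rule integral_dominated_convergence)
    show "integrable M (indicator \<Lambda> :: 'a \<Rightarrow> real)"
      using fin by (intro integrable_indicator_real) auto
    have "(\<lambda>n. X t \<Lambda> n 0 v) \<longlonglongrightarrow> log_ratio t \<Lambda> 0 v" for v
    proof -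
      have "(\<lambda>n. (t * C) * (t * C) ^ n) \<longlonglongrightarrow> (t * C) * 0"
        using t C_nonneg by (intro tendsto_mult_left LIMSEQ_realpow_zero) auto
      then have lim: "(\<lambda>n. (t * C) ^ Suc n) \<longlonglongrightarrow> 0"
        by (simp only: power_Suc mult_zero_right)
      have "(\<lambda>n. X t \<Lambda> n 0 v - log_ratio t \<Lambda> 0 v) \<longlonglongrightarrow> 0"
      proof (rule Lim_null_comparison[OF _ lim])
        show "\<forall>\<^sub>F n in sequentially. norm (X t \<Lambda> n 0 v - log_ratio t \<Lambda> 0 v) \<le> (t * C) ^ Suc n"
          unfolding real_norm_def by (rule always_eventually) (rule allI, rule X_close_log_ratio[OF \<Lambda> fin t(1)])
      qed
      then show ?thesis by (rule LIM_zero_cancel)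
    qed
    then show "AE w in M. (\<lambda>n. indicator \<Lambda> w * exp (- X t \<Lambda> n 0 (\<lambda>_. w))) \<longlonglongrightarrow> indicator \<Lambda> w * exp (- log_ratio t \<Lambda> 0 (\<lambda>_. w))"
      by (intro AE_I2 tendsto_intros)
    show "AE w in M. norm (indicator \<Lambda> w * exp (- X t \<Lambda> n 0 (\<lambda>_. w))) \<le> indicator \<Lambda> w" for n
      using X_bounds(1)[OF \<Lambda> t(1)] by (intro AE_I2) (auto simp: indicator_def)
  qed auto
  then show ?thesis unfolding eq by (rule tendsto_of_real)
qed

end

text \<open>Continuity at \<eta> = 0. The strictness of \<lambda> \<Delta> < e is spent here, on the
  nonlinear losses.\<close>

lemma contraction_slack:
  fixes a :: real
  assumes "a < 1" "0 \<le> a"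
  obtains \<eta> where "0 < \<eta>" "(1 + \<eta>) * exp (2 * \<eta>) * a < 1"
proof -
  have "((\<lambda>\<eta>. (1 + \<eta>) * exp (2 * \<eta>) * a) \<longlongrightarrow> (1 + 0) * exp (2 * 0) * a) (at_right 0)"
    by (intro tendsto_intros)
  then have "eventually (\<lambda>\<eta>. (1 + \<eta>) * exp (2 * \<eta>) * a < 1) (at_right 0)"
    using assms by (intro order_tendstoD(2)) auto
  moreover have "eventually (\<lambda>\<eta>::real. 0 < \<eta>) (at_right 0)"
    by (rule eventually_at_right_less)
  ultimately have "eventually (\<lambda>\<eta>. 0 < \<eta> \<and> (1 + \<eta>) * exp (2 * \<eta>) * a < 1) (at_right 0)"
    by eventually_elim simp
  then show ?thesis
    using that eventually_happens'[OF trivial_limit_at_right_real] by blast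
qed

context repulsive_gas
begin

lemma zeta_zero: "zeta (\<lambda>x. 0) = 1"
proof -
  have "Z (\<lambda>x. 0) \<le> ennreal (exp 0)" by (rule Z_le_exp) auto
  then have "Z (\<lambda>x. 0) = 1" using Z_ge_1[of "\<lambda>x. 0"] by (simp add: antisym)
  then show ?thesis by (simp add: zeta_def)
qed

lemma ln_zeta_derivative_log_ratio:
  assumes \<Lambda>[measurable]: "\<Lambda> \<in> sets borel" and fin: "emeasure M \<Lambda> < \<infinity>" and t: "t \<in> {0..T0}"
  shows "((\<lambda>t. ln (zeta (\<lambda>x. ennreal t * indicator \<Lambda> x))) has_real_derivative
      (LINT w|M. indicator \<Lambda> w * exp (- log_ratio t \<Lambda> 0 (\<lambda>_. w)))) (at t within {0..T0})"
proof -
  have "(\<integral>\<^sup>+ x. indicator \<Lambda> x \<partial>M) = ennreal (measure M \<Lambda>)"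
    using fin by (simp add: emeasure_eq_ennreal_measure less_top)
  then have "((\<lambda>t. ln (zeta (\<lambda>x. ennreal t * indicator \<Lambda> x))) has_real_derivative
      enn2real (\<integral>\<^sup>+ w. indicator \<Lambda> w * ennreal (density_ratio (\<lambda>x. ennreal t * indicator \<Lambda> x) w) \<partial>M)) (at t within {0..T0})"
    using t by (intro ln_zeta_has_derivative) auto
  also have "enn2real (\<integral>\<^sup>+ w. indicator \<Lambda> w * ennreal (density_ratio (\<lambda>x. ennreal t * indicator \<Lambda> x) w) \<partial>M) =
      enn2real (\<integral>\<^sup>+ w. ennreal (indicator \<Lambda> w * exp (- log_ratio t \<Lambda> 0 (\<lambda>_. w))) \<partial>M)"
  proof (intro arg_cong[where f = enn2real] nn_integral_cong)
    fix w
    have "(\<lambda>x. ennreal t * indicator \<Lambda> x) = activity t \<Lambda> 0 (\<lambda>_. w)"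
      by (simp add: activity_def fun_eq_iff)
    then have "density_ratio (\<lambda>x. ennreal t * indicator \<Lambda> x) w = exp (- log_ratio t \<Lambda> 0 (\<lambda>_. w))"
      using density_ratio_activity[OF \<Lambda> fin, of t 0 "\<lambda>_. w"] t by simp
    then show "indicator \<Lambda> w * ennreal (density_ratio (\<lambda>x. ennreal t * indicator \<Lambda> x) w) =
        ennreal (indicator \<Lambda> w * exp (- log_ratio t \<Lambda> 0 (\<lambda>_. w)))"
      by (auto simp: indicator_def)
  qed
  also have "\<dots> = (LINT w|M. indicator \<Lambda> w * exp (- log_ratio t \<Lambda> 0 (\<lambda>_. w)))"
    by (intro integral_eq_nn_integral[symmetric]) auto
  finally show ?thesis .
qed

text \<open>The constants \<eta>, Q, \<epsilon>, R and \<tau> are fixed before \<Lambda> appears,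
  which is why one D and one K serve all volumes. The function exp L is identified on a short real
  segment only; the rest is left to the identity theorem.\<close>

lemma analytic_log_zeta:
  assumes lim: "(\<lambda>n. root n (enn2real (V n))) \<longlonglongrightarrow> \<Delta>" and l: "0 \<le> l" "l * \<Delta> < exp 1"
  obtains D K \<tau> where "open D" "convex D" "complex_of_real ` {0..l} \<subseteq> D" "0 < K" "0 < \<tau>" "complex_of_real ` {0..\<tau>} \<subseteq> D"
    and "\<And>\<Lambda>. \<Lambda> \<in> sets borel \<Longrightarrow> emeasure M \<Lambda> < \<infinity> \<Longrightarrow>
       \<exists>L. L holomorphic_on D \<and> L 0 = 0 \<and> (\<forall>z\<in>D. norm (L z) \<le> K * measure M \<Lambda>) \<and>
         (\<forall>t\<in>{0..\<tau>}. exp (L (of_real t)) = of_real (zeta (\<lambda>x. ennreal t * indicator \<Lambda> x)))"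
proof -
  have \<Delta>0: "0 \<le> \<Delta>"
    by (rule LIMSEQ_le_const[OF lim]) (auto intro!: real_root_ge_zero)
  obtain \<eta> where \<eta>: "0 < \<eta>" "(1 + \<eta>) * exp (2 * \<eta>) * (l * \<Delta> / exp 1) < 1"
    using contraction_slack[of "l * \<Delta> / exp 1"] l \<Delta>0 by (auto simp: divide_less_eq)
  define \<kappa> where "\<kappa> = (1 + \<eta>) * exp (2 * \<eta>) * l / exp 1"
  have \<kappa>: "0 \<le> \<kappa>" "\<kappa> * \<Delta> < 1"
    using \<eta> l by (auto simp: \<kappa>_def mult_ac)
  obtain Q where Q: "0 \<le> Q" "\<And>n m v. (\<Sum>j<n. ennreal (\<kappa> ^ j) * T j m v) \<le> ennreal Q"
    using weighted_sum_T_bounded[OF lim \<kappa>] by blast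
  define A where "A = exp (l * C) * ((1 + 1 / \<eta>) * (exp (2 * \<eta>) * C\<^sup>2) * Q)"
  have A0: "0 \<le> A" using \<eta> Q by (simp add: A_def)
  \<comment> \<open>Chosen for A \<epsilon>^2 \<le> \<eta>^2; the + 1 keeps the denominator positive
    when A = 0.\<close>
  define \<epsilon> where "\<epsilon> = \<eta> / sqrt (A + 1)"
  have \<epsilon>0: "0 < \<epsilon>" using \<eta> A0 by (simp add: \<epsilon>_def)
  have \<epsilon>: "exp (l * C) * ((1 + 1 / \<eta>) * (exp (2 * \<eta>) * C\<^sup>2) * \<epsilon>\<^sup>2 * Q) \<le> \<eta>\<^sup>2"
  proof -
    have "exp (l * C) * ((1 + 1 / \<eta>) * (exp (2 * \<eta>) * C\<^sup>2) * \<epsilon>\<^sup>2 * Q) = A * \<epsilon>\<^sup>2"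
      by (simp add: A_def mult_ac)
    also have "\<dots> = A * (\<eta>\<^sup>2 / (A + 1))" using A0 by (simp add: \<epsilon>_def power_divide)
    also have "\<dots> \<le> \<eta>\<^sup>2"
      using A0 by (simp add: divide_le_eq mult_right_mono distrib_left mult.commute)
    finally show ?thesis .
  qed
  define D where "D = box (Complex (- \<epsilon> / 2) (- \<epsilon> / 2)) (Complex (l + \<epsilon> / 2) (\<epsilon> / 2))"
  have D_iff: "z \<in> D \<longleftrightarrow> - \<epsilon> / 2 < Re z \<and> Re z < l + \<epsilon> / 2 \<and> - \<epsilon> / 2 < Im z \<and> Im z < \<epsilon> / 2" for z
    by (auto simp: D_def in_box_complex_iff)
  have D: "open D" "convex D" by (auto simp: D_def open_box convex_box)
  \<comment> \<open>D lies in the ball of radius R. This yields holomorphy of the iterates on D and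
    bounds the distance from 0 when the density is integrated.\<close>
  define R where "R = l + 2 * \<epsilon>"
  have D_norm: "norm z < R" if "z \<in> D" for z
    using that cmod_le[of z] l by (auto simp: D_iff R_def)
  \<comment> \<open>The segment [0, \<tau>] must fit into D even when l = 0, and t C < 1 must hold
    on it so that the real iterates converge.\<close>
  define \<tau> where "\<tau> = min (\<epsilon> / 4) (1 / (2 * (C + 1)))"
  have \<tau>: "0 < \<tau>" "\<tau> < \<epsilon> / 2" using \<epsilon>0 C_nonneg by (auto simp: \<tau>_def)
  have \<tau>C: "t * C < 1" if "0 \<le> t" "t \<le> \<tau>" for t
  proof -
    have "t * C \<le> 1 / (2 * (C + 1)) * C"
      using that C_nonneg by (intro mult_right_mono) (auto simp: \<tau>_def)
    also have "\<dots> < 1" using C_nonneg by (simp add: divide_less_eq)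
    finally show ?thesis .
  qed
  have seg: "complex_of_real ` {0..l} \<subseteq> D" "complex_of_real ` {0..\<tau>} \<subseteq> D"
    using \<epsilon>0 \<tau> l by (auto simp: D_iff)
  have "0 \<in> D" using \<epsilon>0 l by (simp add: D_iff)
  have close: "\<exists>t\<ge>0. \<forall>n v. norm (S z \<Lambda> n 0 v - of_real (X t \<Lambda> n 0 v)) \<le> \<eta>" if "\<Lambda> \<in> sets borel" "z \<in> D" for z \<Lambda>
  proof -
    \<comment> \<open>The point of [0, l] nearest to Re z; the real and the imaginary offset are
      each below \<epsilon> / 2.\<close>
    define t where "t = max 0 (min l (Re z))"
    have t: "0 \<le> t" "t \<le> l" using l by (auto simp: t_def)
    have "norm (z - of_real t) \<le> \<bar>Re z - t\<bar> + \<bar>Im z\<bar>"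
      using cmod_le[of "z - of_real t"] by simp
    also have "\<dots> \<le> \<epsilon>" using that(2) l by (auto simp: D_iff t_def)
    finally have "norm (S z \<Lambda> n 0 v - of_real (X t \<Lambda> n 0 v)) \<le> \<eta>" for n v
      by (intro complex_iterate_close_to_real[OF that(1) t \<eta>(1) _ \<kappa>_def Q(2,1) \<epsilon>])
    then show ?thesis using t by blast
  qed
  \<comment> \<open>The derivative of L is bounded by exp(\<eta>) \<mu>(\<Lambda>), and |z| < R on
    D.\<close>
  define K where "K = exp \<eta> * R"
  have K: "0 < K" using \<epsilon>0 l by (simp add: K_def R_def)
  have main: "\<exists>L. L holomorphic_on D \<and> L 0 = 0 \<and> (\<forall>z\<in>D. norm (L z) \<le> K * measure M \<Lambda>) \<and>
         (\<forall>t\<in>{0..\<tau>}. exp (L (of_real t)) = of_real (zeta (\<lambda>x. ennreal t * indicator \<Lambda> x)))"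
    if \<Lambda>: "\<Lambda> \<in> sets borel" and fin: "emeasure M \<Lambda> < \<infinity>" for \<Lambda>
  proof -
    define B where "B = exp \<eta> * measure M \<Lambda>"
    have hol: "density_approx \<Lambda> n holomorphic_on D" for n
      using D_norm by (intro holomorphic_on_subset[OF density_approx_holomorphic[OF \<Lambda> fin, of n R]]) auto
    have bound: "norm (density_approx \<Lambda> n z) \<le> B" if "z \<in> D" for n z
      using close[OF \<Lambda> that] density_approx_bound[OF \<Lambda> fin] by (auto simp: B_def)
    obtain g r where g: "g holomorphic_on D" "strict_mono (r :: nat \<Rightarrow> nat)"
      "\<And>x. x \<in> D \<Longrightarrow> (\<lambda>n. density_approx \<Lambda> (r n) x) \<longlonglongrightarrow> g x"
    proof (rule Montel[of D "range (density_approx \<Lambda>)" "density_approx \<Lambda>"])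
      show "\<exists>B. \<forall>h\<in>range (density_approx \<Lambda>). \<forall>z\<in>K. norm (h z) \<le> B" if "compact K" "K \<subseteq> D" for K
        using bound that by (intro exI[of _ B]) auto
    qed (use D hol in auto)
    have g_le: "norm (g z) \<le> B" if "z \<in> D" for z
      using bound[OF that] by (intro LIMSEQ_le_const2[OF tendsto_norm[OF g(3)[OF that]]]) auto
    have g_eq: "g (of_real t) = of_real (LINT w|M. indicator \<Lambda> w * exp (- log_ratio t \<Lambda> 0 (\<lambda>_. w)))" if "t \<in> {0..\<tau>}" for t
    proof (rule LIMSEQ_unique)
      show "(\<lambda>n. density_approx \<Lambda> (r n) (of_real t)) \<longlonglongrightarrow> g (of_real t)"
        using seg that by (intro g) auto
      show "(\<lambda>n. density_approx \<Lambda> (r n) (of_real t)) \<longlonglongrightarrow> of_real (LINT w|M. indicator \<Lambda> w * exp (- log_ratio t \<Lambda> 0 (\<lambda>_. w)))"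
        using LIMSEQ_subseq_LIMSEQ[OF density_approx_tendsto[OF \<Lambda> fin] g(2), of t] \<tau>C that by (auto simp: comp_def)
    qed
    obtain G where G: "\<And>z. z \<in> D \<Longrightarrow> (G has_field_derivative g z) (at z within D)"
      using holomorphic_convex_primitive'[OF D(2,1) g(1)] by blast
    define L where "L z = G z - G 0" for z
    have L: "(L has_field_derivative g z) (at z within D)" if "z \<in> D" for z
      unfolding L_def using DERIV_diff[OF G[OF that] DERIV_const[of "G 0"]] by simp
    have L_le: "norm (L z) \<le> K * measure M \<Lambda>" if "z \<in> D" for z
    proof -
      have "norm (L z - L 0) \<le> B * norm (z - 0)"
        by (rule field_differentiable_bound[where f = L and f' = g, OF D(2) L g_le that \<open>0 \<in> D\<close>])
      also have "\<dots> \<le> B * R"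
        using D_norm[OF that] by (intro mult_left_mono) (auto simp: B_def)
      finally show ?thesis by (simp add: L_def B_def K_def mult_ac)
    qed
    define F where "F t = ln (zeta (\<lambda>x. ennreal t * indicator \<Lambda> x))" for t
    \<comment> \<open>Along the real segment both L and ln zeta have the limiting density integral
      as derivative, so they differ by their difference at 0, which vanishes.\<close>
    have deriv: "((\<lambda>t. L (of_real t) - of_real (F t)) has_vector_derivative 0) (at t within {0..\<tau>})" if t: "t \<in> {0..\<tau>}" for t
    proof -
      have "((L \<circ> of_real) has_vector_derivative (1 * g (of_real t))) (at t within {0..\<tau>})"
      proof (rule field_vector_diff_chain_within)
        show "(complex_of_real has_vector_derivative 1) (at t within {0..\<tau>})"
          by (auto intro!: derivative_eq_intros)
        show "(L has_field_derivative g (of_real t)) (at (of_real t) within complex_of_real ` {0..\<tau>})"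
          using seg t by (intro DERIV_subset[OF L]) auto
      qed
      moreover have "((\<lambda>t. complex_of_real (F t)) has_vector_derivative
          of_real (LINT w|M. indicator \<Lambda> w * exp (- log_ratio t \<Lambda> 0 (\<lambda>_. w)))) (at t within {0..\<tau>})"
        unfolding F_def using ln_zeta_derivative_log_ratio[OF \<Lambda> fin t]
        by (intro has_vector_derivative_of_real)
      ultimately show ?thesis
        using has_vector_derivative_diff g_eq[OF t] by (fastforce simp: comp_def)
    qed
    obtain c where c: "\<And>t. t \<in> {0..\<tau>} \<Longrightarrow> L (of_real t) - of_real (F t) = c"
      using has_vector_derivative_zero_constant[OF convex_real_interval(5) deriv] by blast
    have "F 0 = 0" by (simp add: F_def zeta_zero)
    then have "c = 0" using c[of 0] \<tau> by (simp add: L_def)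
    have "exp (L (of_real t)) = of_real (zeta (\<lambda>x. ennreal t * indicator \<Lambda> x))" if t: "t \<in> {0..\<tau>}" for t
    proof -
      have "(\<integral>\<^sup>+ x. ennreal t * indicator \<Lambda> x \<partial>M) < \<infinity>"
        using \<Lambda> fin by (simp add: nn_integral_cmult_indicator ennreal_mult_less_top)
      then have "1 \<le> zeta (\<lambda>x. ennreal t * indicator \<Lambda> x)"
        using \<Lambda> by (intro zeta_ge_1) auto
      then have "exp (F t) = zeta (\<lambda>x. ennreal t * indicator \<Lambda> x)" by (simp add: F_def)
      moreover have "L (of_real t) = of_real (F t)" using c[OF t] \<open>c = 0\<close> by simp
      ultimately show ?thesis by (simp add: exp_of_real)
    qed
    moreover have "L holomorphic_on D"
      using L by (auto simp: holomorphic_on_def field_differentiable_def)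
    ultimately show ?thesis
      using L_le by (intro exI[of _ L]) (auto simp: L_def)
  qed
  show ?thesis
    by (rule that[OF D seg(1) K \<tau>(1) seg(2) main])
qed


section \<open>Specialisation to potentials\<close>

lemma T_cong: "(\<And>i. i \<le> m \<Longrightarrow> v i = v' i) \<Longrightarrow> T n m v = T n m v'"
proof (induction n arbitrary: m v v')
  case (Suc n)
  have "wt UNIV m v w = wt UNIV m v' w" for w
    unfolding wt_def hist_def using Suc.prems by (auto intro!: arg_cong2[where f = "(*)"] prod.cong)
  moreover have "T n (Suc m) (v(Suc m := w)) = T n (Suc m) (v'(Suc m := w))" for w
    by (rule Suc.IH) (use Suc.prems in auto)
  ultimately show ?case by simp
qed simp

lemma fun_upd_path_measurable:
  "(\<lambda>v. v(0 := v0)) \<in> (\<Pi>\<^sub>M j\<in>{1..k}. M) \<rightarrow>\<^sub>M Pi\<^sub>M UNIV (\<lambda>_::nat. borel :: 'a measure)"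
proof (rule measurable_PiM_single')
  fix j :: nat
  show "(\<lambda>v. (v(0 := v0)) j) \<in> (\<Pi>\<^sub>M j\<in>{1..k}. M) \<rightarrow>\<^sub>M borel"
  proof (cases "j = 0 \<or> j \<in> {1..k}")
    case True
    then show ?thesis
    proof
      assume j: "j \<in> {1..k}"
      then have "(\<lambda>v. v j) \<in> (\<Pi>\<^sub>M j\<in>{1..k}. M) \<rightarrow>\<^sub>M M" by (rule measurable_component_singleton)
      then have "(\<lambda>v. v j) \<in> (\<Pi>\<^sub>M j\<in>{1..k}. M) \<rightarrow>\<^sub>M borel"
        using measurable_cong_sets[OF refl sets_M] by blast
      then show ?thesis using j by simp
    qed simp
  next
    case False
    \<comment> \<open>Points of the product space are extensional: coordinates above k have the
      value \<open>undefined\<close>, so this projection is constant there.\<close>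
    have "(\<lambda>v. (v(0 := v0)) j) \<in> (\<Pi>\<^sub>M j\<in>{1..k}. M) \<rightarrow>\<^sub>M borel \<longleftrightarrow> (\<lambda>_. undefined) \<in> (\<Pi>\<^sub>M j\<in>{1..k}. M) \<rightarrow>\<^sub>M (borel :: 'a measure)"
      by (rule measurable_cong) (use False in \<open>auto simp: space_PiM PiE_def extensional_def\<close>)
    then show ?thesis by (rule iffD2) (rule measurable_const, simp)
  qed
qed auto

text \<open>Passes from iterated integrals to the product measure. Integrating out the last vertex
  turns \<open>T k (Suc m)\<close> into \<open>T (Suc k) m\<close>, so k has to vary in the
  induction; k = 0 is the case of interest.\<close>

lemma path_integral_eq_T:
  "(\<integral>\<^sup>+ v. (\<Prod>j\<in>{1..m}. ennreal (wt UNIV (j - 1) (v(0 := v0)) ((v(0 := v0)) j))) * T k m (v(0 := v0)) \<partial>(\<Pi>\<^sub>M j\<in>{1..m}. M))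
    = T (m + k) 0 (\<lambda>_. v0)"
proof (induction m arbitrary: k)
  case 0
  show ?case
    by (simp add: PiM_empty nn_integral_count_space_finite) (rule T_cong, simp)
next
  case (Suc m)
  let ?P = "\<lambda>m v. \<Prod>j\<in>{1..m}. ennreal (wt UNIV (j - 1) (v(0 := v0)) ((v(0 := v0)) j))"
  have I: "{1..Suc m} = insert (Suc m) {1..m}" by auto
  have [measurable]: "(\<lambda>v. v(0 := v0)) \<in> (\<Pi>\<^sub>M j\<in>{1..n}. M) \<rightarrow>\<^sub>M Pi\<^sub>M UNIV (\<lambda>_::nat. borel :: 'a measure)" for n
    by (rule fun_upd_path_measurable)
  note [measurable] = measurable_component_borel[OF fun_upd_path_measurable]
  have meas: "(\<lambda>v. ?P (Suc m) v * T k (Suc m) (v(0 := v0))) \<in> borel_measurable (\<Pi>\<^sub>M j\<in>{1..Suc m}. M)"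
    by measurable
  have "(\<integral>\<^sup>+ v. ?P (Suc m) v * T k (Suc m) (v(0 := v0)) \<partial>(\<Pi>\<^sub>M j\<in>{1..Suc m}. M)) =
    (\<integral>\<^sup>+ v. (\<integral>\<^sup>+ w. ?P (Suc m) (v(Suc m := w)) * T k (Suc m) ((v(Suc m := w))(0 := v0)) \<partial>M) \<partial>(\<Pi>\<^sub>M j\<in>{1..m}. M))"
    using meas unfolding I by (subst prod_sf.product_nn_integral_insert) simp_all
  also have "\<dots> = (\<integral>\<^sup>+ v. (\<integral>\<^sup>+ w. ?P m v * (ennreal (wt UNIV m (v(0 := v0)) w) * T k (Suc m) ((v(0 := v0))(Suc m := w))) \<partial>M) \<partial>(\<Pi>\<^sub>M j\<in>{1..m}. M))"
  proof (intro nn_integral_cong)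
    fix v :: "nat \<Rightarrow> 'a" and w
    have upd: "(v(Suc m := w))(0 := v0) = (v(0 := v0))(Suc m := w)"
      by (rule fun_upd_twist) simp
    have "wt UNIV (j - 1) ((v(0 := v0))(Suc m := w)) (((v(0 := v0))(Suc m := w)) j) =
        wt UNIV (j - 1) (v(0 := v0)) ((v(0 := v0)) j)" if "j \<in> {1..m}" for j
      using that unfolding wt_def hist_def by (auto intro!: arg_cong2[where f = "(*)"] prod.cong)
    then have "(\<Prod>j\<in>{1..m}. ennreal (wt UNIV (j - 1) ((v(0 := v0))(Suc m := w)) (((v(0 := v0))(Suc m := w)) j))) = ?P m v"
      by (intro prod.cong) auto
    moreover have "wt UNIV m ((v(0 := v0))(Suc m := w)) w = wt UNIV m (v(0 := v0)) w"
      unfolding wt_def hist_def by (auto intro!: arg_cong2[where f = "(*)"] prod.cong)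
    ultimately show "?P (Suc m) (v(Suc m := w)) * T k (Suc m) ((v(Suc m := w))(0 := v0)) =
       ?P m v * (ennreal (wt UNIV m (v(0 := v0)) w) * T k (Suc m) ((v(0 := v0))(Suc m := w)))"
      unfolding upd I by (subst prod.insert) (simp_all add: mult_ac)
  qed
  also have "\<dots> = (\<integral>\<^sup>+ v. ?P m v * T (Suc k) m (v(0 := v0)) \<partial>(\<Pi>\<^sub>M j\<in>{1..m}. M))"
    unfolding T.simps by (intro nn_integral_cong nn_integral_cmult) measurable
  also have "\<dots> = T (Suc m + k) 0 (\<lambda>_. v0)"
    using Suc[of "Suc k"] by (simp only: add_Suc_right add_Suc)
  finally show ?case .
qed

lemma V_eq_path_integral:
  "V k = (SUP v0. \<integral>\<^sup>+ v. (\<Prod>j\<in>{1..k}. ennreal (wt UNIV (j - 1) (v(0 := v0)) ((v(0 := v0)) j))) \<partial>(\<Pi>\<^sub>M j\<in>{1..k}. M))"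
proof -
  \<comment> \<open>\<open>V\<close> takes the supremum over sequences, V_k over starting points; at
    depth 0 only \<open>v 0\<close> is seen.\<close>
  have "T k 0 v = T k 0 (\<lambda>_. v 0)" for v by (rule T_cong) simp
  then have "range (T k 0) = range (\<lambda>v0. T k 0 (\<lambda>_. v0))"
    by (auto simp: image_iff)
  then show ?thesis
    using path_integral_eq_T[of k _ 0] by (simp add: V_def)
qed

section \<open>Power series in the fugacity\<close>

lemma W_cmult: 
  assumes [measurable]: "g \<in> borel_measurable M"
  shows "W k (\<lambda>x. c * g x) = c ^ k * W k g"
  unfolding W_def by (subst nn_integral_cmult[symmetric]) (simp_all add: prod.distrib mult_ac)

definition coeff :: "'a set \<Rightarrow> nat \<Rightarrow> real" where
  "coeff \<Lambda> k = inverse (fact k) * enn2real (W k (indicator \<Lambda>))"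

lemma coeff_bounds:
  assumes [measurable]: "\<Lambda> \<in> sets borel" and fin: "emeasure M \<Lambda> < \<infinity>"
  shows coeff_nonneg: "0 \<le> coeff \<Lambda> k"
    and ennreal_coeff: "ennreal (coeff \<Lambda> k) = ennreal (inverse (fact k)) * W k (indicator \<Lambda>)"
    and coeff_le: "coeff \<Lambda> k \<le> inverse (fact k) * measure M \<Lambda> ^ k"
proof -
  have le: "W k (indicator \<Lambda>) \<le> ennreal (measure M \<Lambda> ^ k)"
    using W_le_power[of "indicator \<Lambda>" k] fin by (simp add: emeasure_eq_ennreal_measure less_top ennreal_power)
  then have eq: "ennreal (enn2real (W k (indicator \<Lambda>))) = W k (indicator \<Lambda>)"
    by (intro ennreal_enn2real) (simp add: le_less_trans)
  show "0 \<le> coeff \<Lambda> k" by (simp add: coeff_def)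
  show "ennreal (coeff \<Lambda> k) = ennreal (inverse (fact k)) * W k (indicator \<Lambda>)"
    by (simp add: coeff_def ennreal_mult eq)
  have "enn2real (W k (indicator \<Lambda>)) \<le> measure M \<Lambda> ^ k"
    using enn2real_mono[OF le] by simp
  then show "coeff \<Lambda> k \<le> inverse (fact k) * measure M \<Lambda> ^ k"
    unfolding coeff_def by (rule mult_left_mono) simp
qed

lemma summable_coeff:
  assumes "\<Lambda> \<in> sets borel" and "emeasure M \<Lambda> < \<infinity>"
  shows "summable (\<lambda>k. of_real (coeff \<Lambda> k) * (y::complex) ^ k)"
proof (rule summable_comparison_test')
  show "summable (\<lambda>k. inverse (fact k) * (measure M \<Lambda> * norm y) ^ k)"
    by (rule summable_exp)
  show "norm (of_real (coeff \<Lambda> k) * y ^ k) \<le> inverse (fact k) * (measure M \<Lambda> * norm y) ^ k" if "0 \<le> k" for k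
    using mult_right_mono[OF coeff_le[OF assms, of k], of "norm y ^ k"] coeff_nonneg[OF assms, of k]
    by (simp add: norm_mult norm_power power_mult_distrib mult.assoc)
qed

lemma zeta_power_series:
  assumes \<Lambda>[measurable]: "\<Lambda> \<in> sets borel" and fin: "emeasure M \<Lambda> < \<infinity>" and t: "0 \<le> t"
  shows "of_real (zeta (\<lambda>x. ennreal t * indicator \<Lambda> x)) = (\<Sum>k. of_real (coeff \<Lambda> k) * (of_real t :: complex) ^ k)"
proof -
  have "summable (\<lambda>k. of_real (coeff \<Lambda> k * t ^ k) :: complex)"
    using summable_coeff[OF \<Lambda> fin, of "of_real t"] by simp
  then have sm: "summable (\<lambda>k. coeff \<Lambda> k * t ^ k)"
    by (simp only: summable_of_real_iff)
  have "Z (\<lambda>x. ennreal t * indicator \<Lambda> x) = (\<Sum>k. ennreal (coeff \<Lambda> k * t ^ k))"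
    unfolding Z_def using t
    by (intro suminf_cong) (simp add: W_cmult ennreal_mult coeff_nonneg[OF \<Lambda> fin] ennreal_coeff[OF \<Lambda> fin] ennreal_power mult_ac)
  also have "\<dots> = ennreal (\<Sum>k. coeff \<Lambda> k * t ^ k)"
    using sm t coeff_nonneg[OF \<Lambda> fin] by (intro suminf_ennreal2) auto
  finally have "zeta (\<lambda>x. ennreal t * indicator \<Lambda> x) = (\<Sum>k. coeff \<Lambda> k * t ^ k)"
    using suminf_nonneg[OF sm] t coeff_nonneg[OF \<Lambda> fin] by (simp add: zeta_def)
  then show ?thesis
    using suminf_of_real[OF sm, where 'a = complex] by simp
qed

end

text \<open>Nonnegative terms exclude \<infinity> - \<infinity>. An infinite term makes the sum
  infinite and the product zero, in accordance with exp(-\<infinity>) = 0.\<close>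

lemma exp_neg_sum:
  assumes "finite I" "\<And>i. i \<in> I \<Longrightarrow> 0 \<le> f i"
  shows "exp_neg (\<Sum>i\<in>I. f i) = (\<Prod>i\<in>I. exp_neg (f i))"
  using assms
proof (induction I rule: finite_induct)
  case empty
  then show ?case by (simp add: exp_neg_def)
next
  case (insert i I)
  have "exp_neg (a + b) = exp_neg a * exp_neg b" if "0 \<le> a" "0 \<le> b" for a b
    using that by (cases a; cases b) (auto simp: exp_neg_def exp_diff exp_minus field_simps)
  then show ?case
    using insert by (simp add: sum_nonneg)
qed

lemma exp_neg_bounds: "0 \<le> exp_neg a" "0 \<le> a \<Longrightarrow> exp_neg a \<le> 1"
  by (cases a; simp add: exp_neg_def)+

lemma exp_neg_measurable [measurable]: "exp_neg \<in> borel_measurable borel"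
  unfolding exp_neg_def[abs_def] by measurable

lemma locally_finite_sigma_finite:
  fixes M :: "'a::polish_space measure"
  assumes sets: "sets M = sets borel" and "locally_finite M"
  shows "sigma_finite_measure M"
proof
  show "\<exists>A. countable A \<and> A \<subseteq> sets M \<and> \<Union> A = space M \<and> (\<forall>a\<in>A. emeasure M a \<noteq> \<infinity>)"
  \<comment> \<open>Balls of integer radius around an arbitrary centre, for which
    \<open>undefined\<close> stands.\<close>
  proof (intro exI[of _ "range (\<lambda>n::nat. ball (undefined :: 'a) (real n))"] conjI ballI)
    show "\<Union> (range (\<lambda>n::nat. ball (undefined :: 'a) (real n))) = space M"
      using sets_eq_imp_space_eq[OF sets] reals_Archimedean2 by auto
    show "emeasure M a \<noteq> \<infinity>" if "a \<in> range (\<lambda>n::nat. ball (undefined :: 'a) (real n))" for a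
    proof -
      obtain n where "a = ball undefined (real n)" using \<open>a \<in> _\<close> by blast
      then have "emeasure M a < \<infinity>"
        using assms(2) unfolding locally_finite_def by simp
      then show ?thesis by simp
    qed
    show "range (\<lambda>n::nat. ball (undefined :: 'a) (real n)) \<subseteq> sets M"
      unfolding sets by auto
  qed simp
qed

text \<open>A single radius is Lebesgue null and its preimage under the distance is the sphere. A
  negative radius lies outside [0, \<infinity>), but then the sphere is empty.\<close>

lemma absolutely_continuous_spheres_null:
  fixes M :: "'a::polish_space measure"
  assumes sets: "sets M = sets borel"
    and ac: "absolutely_continuous (restrict_space lborel {0..}) (distr M (restrict_space lborel {0..}) (\<lambda>y. dist y x))"
  shows "emeasure M {y. dist y x = r} = 0"
proof (cases "0 \<le> r")
  case False
  then have "{y. dist y x = r} = {}" using zero_le_dist order_trans by auto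
  then show ?thesis by simp
next
  case True
  have sp: "space M = UNIV" using sets_eq_imp_space_eq[OF sets] by simp
  have "(\<lambda>y. dist y x) \<in> borel_measurable borel" by simp
  then have "(\<lambda>y. dist y x) \<in> borel_measurable M"
    using measurable_cong_sets[OF sets refl] by blast
  then have meas: "(\<lambda>y. dist y x) \<in> M \<rightarrow>\<^sub>M restrict_space lborel {0..}"
    by (intro measurable_restrict_space2) auto
  have "{r} \<in> null_sets (restrict_space lborel {0..})"
    using True by (auto simp: null_sets_restrict_space)
  then have "{r} \<in> null_sets (distr M (restrict_space lborel {0..}) (\<lambda>y. dist y x))"
    using ac by (auto simp: absolutely_continuous_def)
  then have "emeasure M ((\<lambda>y. dist y x) -` {r} \<inter> space M) = 0"
    by (subst (asm) null_sets_distr_iff[OF meas]) (auto simp: null_sets_def)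
  then show ?thesis by (simp add: sp vimage_def)
qed

lemma (in repulsive_gas) entire_partition_series:
  assumes "\<Lambda> \<in> sets borel" "emeasure M \<Lambda> < \<infinity>"
  shows "(\<lambda>z::complex. \<Sum>k. of_real (coeff \<Lambda> k) * z ^ k) holomorphic_on A"
proof -
  have "((\<lambda>z::complex. \<Sum>k. of_real (coeff \<Lambda> k) * z ^ k) has_field_derivative
      (\<Sum>k. diffs (\<lambda>k. of_real (coeff \<Lambda> k)) k * z ^ k)) (at z)" for z
    by (rule termdiffs_strong_converges_everywhere[OF summable_coeff[OF assms]])
  then show ?thesis
    by (meson DERIV_subset field_differentiable_def holomorphic_on_def subset_UNIV)
qed

lemma exp_neg_hamiltonian:
  assumes "repulsive \<phi>"
  shows "exp_neg (hamiltonian \<phi> k x) = (\<Prod>j\<in>{1..k}. \<Prod>i\<in>{1..<j}. exp_neg (\<phi> (x i) (x j)))"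
  using assms unfolding hamiltonian_def repulsive_def
  by (simp add: exp_neg_sum sum_nonneg)

lemma exp_neg_if: "exp_neg (if b then a else 0) = (if b then exp_neg a else 1)"
  by (simp add: exp_neg_def)

lemma repulsive_gas_of_potential:
  fixes M :: "'a::polish_space measure" and \<phi> :: "'a \<Rightarrow> 'a \<Rightarrow> ereal"
  assumes sets: "sets M = sets borel" and lf: "locally_finite M"
    and ac: "\<And>x. absolutely_continuous (restrict_space lborel {0..})
               (distr M (restrict_space lborel {0..}) (\<lambda>y. dist y x))"
    and pot: "potential M \<phi>" and rep: "repulsive \<phi>" and temp: "tempered M \<phi>"
  shows "repulsive_gas M (\<lambda>x y. exp_neg (\<phi> x y)) (enn2real (temperedness M \<phi>))"
proof (rule repulsive_gas.intro)
  show "sigma_finite_measure M" by (rule locally_finite_sigma_finite[OF sets lf])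
  show "emeasure M {y. dist y x = r} = 0" for x r
    by (rule absolutely_continuous_spheres_null[OF sets ac])
  have "(\<lambda>(x, y). \<phi> x y) \<in> borel_measurable (M \<Otimes>\<^sub>M M)"
    using pot by (simp add: potential_def)
  then have "(\<lambda>(x, y). \<phi> x y) \<in> borel_measurable (borel \<Otimes>\<^sub>M borel)"
    by (subst measurable_cong_sets[OF sets_pair_measure_cong[OF sets sets] refl, symmetric])
  from measurable_compose[OF this exp_neg_measurable]
  show "(\<lambda>(x, y). exp_neg (\<phi> x y)) \<in> borel_measurable (borel \<Otimes>\<^sub>M borel)"
    by (simp add: case_prod_beta)
  show sym: "exp_neg (\<phi> x y) = exp_neg (\<phi> y x)" for x y
    using pot by (metis potential_def)
  show "0 \<le> exp_neg (\<phi> x y)" "exp_neg (\<phi> x y) \<le> 1" for x y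
    using rep by (auto simp: repulsive_def intro!: exp_neg_bounds)
  then have abs: "1 - exp_neg (\<phi> v x) = \<bar>1 - exp_neg (\<phi> x v)\<bar>" for v x
    by (subst sym) (simp add: abs_of_nonneg)
  show "(\<integral>\<^sup>+ x. ennreal (1 - exp_neg (\<phi> v x)) \<partial>M) \<le> ennreal (enn2real (temperedness M \<phi>))" for v
  proof -
    have "(\<integral>\<^sup>+ x. ennreal (1 - exp_neg (\<phi> v x)) \<partial>M) \<le> temperedness M \<phi>"
      unfolding temperedness_def abs[symmetric] by (rule SUP_upper) simp
    also have "\<dots> = ennreal (enn2real (temperedness M \<phi>))"
      using temp by (simp add: tempered_def)
    finally show ?thesis .
  qed
qed (use sets in auto)

theorem theorem4:
  fixes M :: "'a::polish_space measure"
    and \<phi> :: "'a \<Rightarrow> 'a \<Rightarrow> ereal"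
    and lam0 :: real
  assumes "sets M = sets borel"
    and "locally_finite M"
    and "\<And>x. absolutely_continuous (restrict_space lborel {0..})
               (distr M (restrict_space lborel {0..}) (\<lambda>y. dist y x))"
    and "potential M \<phi>"
    and "repulsive \<phi>"
    and "tempered M \<phi>"
    and "0 \<le> lam0"
    and "ereal lam0 < ereal (exp 1) / ereal (connective_constant M \<phi>)"
  shows "\<exists>(D :: complex set) (C :: real).
           open D \<and> simply_connected D \<and> complex_of_real ` {0..lam0} \<subseteq> D \<and> C > 0 \<and>
           (\<forall>\<Lambda>\<in>sets M. emeasure M \<Lambda> < \<infinity> \<longrightarrow>
              (\<forall>z\<in>D. partition_function M \<phi> \<Lambda> z \<noteq> 0) \<and>
              (\<exists>L. log_branch D (partition_function M \<phi> \<Lambda>) L \<and>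
                   (\<forall>z\<in>D. cmod (L z) \<le> C * measure M \<Lambda>)))"
proof -
  define e where "e x y = exp_neg (\<phi> x y)" for x y
  interpret repulsive_gas M e "enn2real (temperedness M \<phi>)"
    unfolding e_def[abs_def] by (rule repulsive_gas_of_potential[OF assms(1-6)])
  have e_sym': "exp_neg (\<phi> x y) = e y x" for x y
    using e_sym by (simp add: e_def)
  have integrand: "pwcc_integrand \<phi> k v = (\<Prod>j\<in>{1..k}. wt UNIV (j - 1) v (v j))" for k v
  proof -
    have "exp_neg (\<Sum>i\<in>{..<m}. if dist x (v i) < dist (v i) (v (i + 1)) then \<phi> x (v i) else 0) = hist m v x" for m x
      using assms(5) unfolding hist_def repulsive_def
      by (subst exp_neg_sum) (auto simp: exp_neg_if e_sym' intro!: prod.cong)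
    then show ?thesis
      by (simp add: pwcc_integrand_def wt_def e_sym')
  qed
  have V_eq: "pwcc_V M \<phi> k = V k" for k
    unfolding pwcc_V_def V_eq_path_integral integrand by (simp add: prod_ennreal)
  define \<Delta> where "\<Delta> = connective_constant M \<phi>"
  have lim: "(\<lambda>n. root n (enn2real (V n))) \<longlonglongrightarrow> \<Delta>"
    \<comment> \<open>The connective constant is defined by \<open>lim\<close>, so convergence has
      to be known before it can be called the limit.\<close>
    using convergent_root_V unfolding \<Delta>_def connective_constant_def V_eq by (simp only: convergent_LIMSEQ_iff)
  have \<Delta>0: "0 \<le> \<Delta>"
    by (rule LIMSEQ_le_const[OF lim]) (auto intro!: real_root_ge_zero)
  have "lam0 * \<Delta> < exp 1"
  \<comment> \<open>For \<Delta> = 0 the quotient in \<open>ereal\<close> is \<infinity> and bounds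
    nothing; the product form holds there trivially and covers both cases.\<close>
  proof (cases "\<Delta> = 0")
    case False
    then have "ereal lam0 < ereal (exp 1 / \<Delta>)"
      using assms(8) by (simp add: \<Delta>_def)
    then show ?thesis using False \<Delta>0 by (simp add: pos_less_divide_eq)
  qed simp
  then obtain D K \<tau> where D: "open D" "convex D" "complex_of_real ` {0..lam0} \<subseteq> D" "0 < K"
    and \<tau>: "0 < \<tau>" "complex_of_real ` {0..\<tau>} \<subseteq> D"
    and L: "\<And>\<Lambda>. \<Lambda> \<in> sets borel \<Longrightarrow> emeasure M \<Lambda> < \<infinity> \<Longrightarrow>
       \<exists>L. L holomorphic_on D \<and> L 0 = 0 \<and> (\<forall>z\<in>D. norm (L z) \<le> K * measure M \<Lambda>) \<and>
         (\<forall>t\<in>{0..\<tau>}. exp (L (of_real t)) = of_real (zeta (\<lambda>x. ennreal t * indicator \<Lambda> x)))"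
    using analytic_log_zeta[OF lim assms(7)] by metis
  have pf: "partition_function M \<phi> \<Lambda> z = (\<Sum>k. of_real (coeff \<Lambda> k) * z ^ k)"
    if \<Lambda>: "\<Lambda> \<in> sets M" and fin: "emeasure M \<Lambda> < \<infinity>" for \<Lambda> z
  proof -
    have \<Lambda>b [measurable]: "\<Lambda> \<in> sets borel" using \<Lambda> by simp
    have int: "(LINT x:({1..k} \<rightarrow>\<^sub>E \<Lambda>)|(\<Pi>\<^sub>M i\<in>{1..k}. M). exp_neg (hamiltonian \<phi> k x)) = enn2real (W k (indicator \<Lambda>))" for k
    proof -
      define F where "F x = (\<Prod>i\<in>{1..k}. indicator \<Lambda> (x i) :: real) * (\<Prod>j\<in>{1..k}. \<Prod>i\<in>{1..<j}. e (x i) (x j))" for x :: "nat \<Rightarrow> 'a"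
      have F_meas: "F \<in> borel_measurable (\<Pi>\<^sub>M i\<in>{1..k}. M)"
        unfolding F_def[abs_def] by measurable
      have F_nonneg: "0 \<le> F x" for x
        unfolding F_def by (intro mult_nonneg_nonneg prod_nonneg) auto
      have "(LINT x:({1..k} \<rightarrow>\<^sub>E \<Lambda>)|(\<Pi>\<^sub>M i\<in>{1..k}. M). exp_neg (hamiltonian \<phi> k x)) = (LINT x|(\<Pi>\<^sub>M i\<in>{1..k}. M). F x)"
        unfolding set_lebesgue_integral_def
      proof (rule Bochner_Integration.integral_cong[OF refl])
        fix x assume x: "x \<in> space (\<Pi>\<^sub>M i\<in>{1..k}. M)"
        have "(\<Prod>i\<in>{1..k}. indicator \<Lambda> (x i) :: real) = indicator ({1..k} \<rightarrow>\<^sub>E \<Lambda>) x"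
        proof (cases "x \<in> {1..k} \<rightarrow>\<^sub>E \<Lambda>")
          case True
          then show ?thesis by (auto simp: PiE_def Pi_def intro!: prod.neutral)
        next
          case False
          \<comment> \<open>As x is already extensional, it can fail to lie in the product set only
            by a coordinate outside \<Lambda>.\<close>
          then obtain i where "i \<in> {1..k}" "x i \<notin> \<Lambda>"
            using x by (auto simp: space_PiM PiE_def Pi_def)
          then show ?thesis using False by (auto simp: indicator_def intro!: prod_zero)
        qed
        then show "indicator ({1..k} \<rightarrow>\<^sub>E \<Lambda>) x *\<^sub>R exp_neg (hamiltonian \<phi> k x) = F x"
          by (simp add: F_def e_def exp_neg_hamiltonian[OF assms(5)])
      qed
      also have "\<dots> = enn2real (\<integral>\<^sup>+ x. ennreal (F x) \<partial>(\<Pi>\<^sub>M i\<in>{1..k}. M))"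
        by (rule integral_eq_nn_integral[OF F_meas]) (simp add: F_nonneg)
      also have "(\<integral>\<^sup>+ x. ennreal (F x) \<partial>(\<Pi>\<^sub>M i\<in>{1..k}. M)) = W k (indicator \<Lambda>)"
        unfolding W_def F_def
        by (intro nn_integral_cong)
           (simp add: ennreal_mult prod_nonneg ennreal_indicator flip: prod_ennreal)
      finally show ?thesis .
    qed
    have "partition_function M \<phi> \<Lambda> z = 1 + (\<Sum>n. of_real (coeff \<Lambda> (Suc n)) * z ^ Suc n)"
      unfolding partition_function_def Let_def int coeff_def
      by (simp add: field_simps del: of_nat_Suc fact_Suc)
    also have "\<dots> = (\<Sum>k. of_real (coeff \<Lambda> k) * z ^ k)"
      using suminf_split_head[OF summable_coeff[OF \<Lambda>b fin, of z]] by (simp add: coeff_def)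
    finally show ?thesis .
  qed
  \<comment> \<open>For the identity theorem: the set of agreement accumulates at 0, a point of
    D.\<close>
  have "0 islimpt complex_of_real ` {0..\<tau>}"
    unfolding islimpt_approachable
  proof (intro allI impI)
    fix r :: real assume "0 < r"
    then show "\<exists>x'\<in>complex_of_real ` {0..\<tau>}. x' \<noteq> 0 \<and> dist x' 0 < r"
      using \<tau>(1) by (intro bexI[of _ "of_real (min \<tau> (r / 2))"]) auto
  qed
  have main: "\<exists>L. log_branch D (partition_function M \<phi> \<Lambda>) L \<and> (\<forall>z\<in>D. cmod (L z) \<le> K * measure M \<Lambda>)"
    if \<Lambda>: "\<Lambda> \<in> sets M" and fin: "emeasure M \<Lambda> < \<infinity>" for \<Lambda>
  proof -
    have \<Lambda>b: "\<Lambda> \<in> sets borel" using \<Lambda> by simp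
    obtain L where L: "L holomorphic_on D" "L 0 = 0" "\<forall>z\<in>D. norm (L z) \<le> K * measure M \<Lambda>"
      and eq: "\<And>t. t \<in> {0..\<tau>} \<Longrightarrow> exp (L (of_real t)) = of_real (zeta (\<lambda>x. ennreal t * indicator \<Lambda> x))"
      using L[OF \<Lambda>b fin] by blast
    let ?F = "\<lambda>z. \<Sum>k. of_real (coeff \<Lambda> k) * z ^ k"
    have "exp (L z) - ?F z = 0" if "z \<in> D" for z
    proof (rule analytic_continuation[where f = "\<lambda>z. exp (L z) - ?F z" and S = D and U = "complex_of_real ` {0..\<tau>}" and \<xi> = 0])
      show "(\<lambda>z. exp (L z) - ?F z) holomorphic_on D"
        by (intro holomorphic_intros L(1) entire_partition_series[OF \<Lambda>b fin])
      show "connected D" using D(2) by (rule convex_connected)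
      have "of_real 0 \<in> complex_of_real ` {0..\<tau>}" using \<tau>(1) by (intro imageI) auto
      then show "0 \<in> D" using \<tau>(2) by auto
      show "exp (L z) - ?F z = 0" if "z \<in> complex_of_real ` {0..\<tau>}" for z
        using that eq zeta_power_series[OF \<Lambda>b fin] by auto
    qed (fact D(1) \<tau>(2) \<open>0 islimpt _\<close> that)+
    then show ?thesis
      using L by (intro exI[of _ L]) (simp add: log_branch_def pf[OF \<Lambda> fin])
  qed
  show ?thesis
  proof (intro exI[of _ D] exI[of _ K] conjI ballI impI)
    fix \<Lambda> z assume "\<Lambda> \<in> sets M" "emeasure M \<Lambda> < \<infinity>" "z \<in> D"
    then show "partition_function M \<phi> \<Lambda> z \<noteq> 0"
      using main[of \<Lambda>] by (metis exp_not_eq_zero log_branch_def)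
  qed (use D main in \<open>auto intro: convex_imp_simply_connected\<close>)
qed

end
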